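(* Let $s>1/2$, let $R_s(x)=\sum_{n=1}^\infty n^{-2s}e^{2\pi i n^2 x}$ on $\mathbb T$, and for $p>0$ let $\eta_s(p)=\sup\{\sigma : R_s\in B^{\sigma/p}_{p,\infty}\}$. Then $R_s$ satisfies the multifractal formalism in dimension 1, that is, \[ d_s(\alpha)=\inf_{p>0}\{\alpha p-\eta_s(p)+1\} \] for all values of $\alpha$ in the range where $\alpha\mapsto d_s(\alpha)$ is increasing, namely for all $\alpha\le s-1/4$.
   Context: $\mathbb T=\mathbb R/\mathbb Z$, $e_n(x)=e^{2\pi i n x}$. Besov spaces on $\mathbb T$: for $f=\sum_n \hat f_n e_n$, let $P_0f=\hat f_0$ and $P_kf=\sum_{2^{k-1}\le |n|<2^{k}}\hat f_n e_n$ for $k\ge1$; then $f\in B^{\sigma}_{p,\infty}$ iff $\sup_k 2^{k\sigma}\|P_kf\|_{L^p(\mathbb T)}<\infty$. A function $f$ is $\alpha$-Hölder at $x_0$, $f\in C^\alpha(x_0)$, if there is a polynomial $P$ of degree at most $\alpha$ and $C>0$ with $|f(x_0+h)-P(h)|\le C|h|^\alpha$ for small $h$; the Hölder exponent is $\alpha_f(x_0)=\sup\{\alpha: f\in C^\alpha(x_0)\}$. The spectrum of singularities of $R_s$ is $d_s(\alpha)=\dim_{\mathcal H}\{x:\alpha_{R_s}(x)=\alpha\}$ (Hausdorff dimension, with the convention $\dim_{\mathcal H}\emptyset=-\infty$). By a known result of Jaffard, $d_s(\alpha)=4\alpha-4s+2$ for $\alpha\in[s-1/2,s-1/4]$, $d_s(2s-1/2)=0$,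 and $d_s(\alpha)=-\infty$ otherwise. *)

theory Defs
  imports "HOL-Analysis.Analysis" "HOL-Computational_Algebra.Polynomial"
begin

definition hd_term :: "real set \<Rightarrow> real \<Rightarrow> ennreal" where
  "hd_term U t = (if U = {} then 0 else if t = 0 then 1 else ennreal (diameter U powr t))"

definition hausdorff_content :: "real \<Rightarrow> real \<Rightarrow> real set \<Rightarrow> ennreal" where
  "hausdorff_content \<delta> t A =
     (INF C \<in> {C :: nat \<Rightarrow> real set. A \<subseteq> (\<Union>n. C n) \<and>
                  (\<forall>n. bounded (C n) \<and> diameter (C n) \<le> \<delta>)}.
        (\<Sum>n. hd_term (C n) t))"

definition hausdorff_measure :: "real \<Rightarrow> real set \<Rightarrow> ennreal" where
  "hausdorff_measure t A = (SUP \<delta> \<in> {0<..}. hausdorff_content \<delta> t A)"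

definition hausdorff_dim :: "real set \<Rightarrow> ereal" where
  "hausdorff_dim A = (if A = {} then -\<infinity>
     else Inf (ereal ` {t. t \<ge> 0 \<and> hausdorff_measure t A = 0}))"

section \<open>Fourier analysis on the torus R/Z (functions are 1-periodic on the reals)\<close>

definition e :: "int \<Rightarrow> real \<Rightarrow> complex" where
  "e n x = cis (2 * pi * of_int n * x)"

definition fourier_coeff :: "(real \<Rightarrow> complex) \<Rightarrow> int \<Rightarrow> complex" where
  "fourier_coeff f n = integral {0..1} (\<lambda>x. f x * cis (- 2 * pi * of_int n * x))"

definition dyadic_block :: "nat \<Rightarrow> int set" where
  "dyadic_block k = (if k = 0 then {0} else {n. 2 ^ (k - 1) \<le> \<bar>n\<bar> \<and> \<bar>n\<bar> < 2 ^ k})"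

definition LP_block :: "nat \<Rightarrow> (real \<Rightarrow> complex) \<Rightarrow> real \<Rightarrow> complex" where
  "LP_block k f x = (\<Sum>n\<in>dyadic_block k. fourier_coeff f n * e n x)"

definition Lp_norm_T :: "real \<Rightarrow> (real \<Rightarrow> complex) \<Rightarrow> real" where
  "Lp_norm_T p g = (integral {0..1} (\<lambda>x. cmod (g x) powr p)) powr (1 / p)"

definition besov_inf :: "real \<Rightarrow> real \<Rightarrow> (real \<Rightarrow> complex) \<Rightarrow> bool" where
  "besov_inf \<sigma> p f \<longleftrightarrow> (\<exists>C. \<forall>k. 2 powr (real k * \<sigma>) * Lp_norm_T p (LP_block k f) \<le> C)"

definition holder_at :: "real \<Rightarrow> (real \<Rightarrow> complex) \<Rightarrow> real \<Rightarrow> bool" where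
  "holder_at \<alpha> f x0 \<longleftrightarrow> (\<exists>P :: complex poly. \<exists>C > 0. \<exists>\<delta> > 0. real (degree P) \<le> \<alpha> \<and>
      (\<forall>h. \<bar>h\<bar> < \<delta> \<longrightarrow> cmod (f (x0 + h) - poly P (of_real h)) \<le> C * \<bar>h\<bar> powr \<alpha>))"

definition holder_exponent :: "(real \<Rightarrow> complex) \<Rightarrow> real \<Rightarrow> ereal" where
  "holder_exponent f x0 = Sup (ereal ` {\<alpha>. holder_at \<alpha> f x0})"

definition R :: "real \<Rightarrow> real \<Rightarrow> complex" where
  "R s x = (\<Sum>n. complex_of_real (real (Suc n) powr (- 2 * s)) * cis (2 * pi * real (Suc n) ^ 2 * x))"

definition spectrum_sing :: "real \<Rightarrow> real \<Rightarrow> ereal" where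
  "spectrum_sing s \<alpha> = hausdorff_dim {x \<in> {0..<1}. holder_exponent (R s) x = ereal \<alpha>}"

definition eta :: "real \<Rightarrow> real \<Rightarrow> ereal" where
  "eta s p = Sup (ereal ` {\<sigma>. besov_inf (\<sigma> / p) p (R s)})"

end

theory Submission
  imports Defs "HOL-Real_Asymp.Real_Asymp"
begin

text \<open>
  Additive energy of the squares bounds the fourth moment of every dyadic block \<open>g\<^sub>k\<close> of \<open>R\<^sub>s\<close> by
  \<open>2\<^bsup>-k(4s-1)\<^esup>\<close> up to powers of \<open>k\<close>. Interpolation with the sup norm, the \<open>L\<^sup>2\<close> norm and the
  behaviour near \<open>0\<close> gives \<open>\<eta>\<^sub>s(p) = p(s-1/4)\<close> for \<open>p \<le> 4\<close> and \<open>p(s-1/2)+1\<close> for \<open>p \<ge> 4\<close>, so the right-hand side is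
  \<open>D = 4\<alpha>-4s+2\<close> for \<open>\<alpha> \<ge> s-1/2\<close> and \<open>-\<infinity>\<close> below.

  The same moment bound, applied to the blocks and their derivatives, shows that few dyadic intervals carry a
  block larger than \<open>2\<^bsup>-j\<alpha>\<^esup>\<close>. A point that avoids these intervals at all small scales is \<open>\<alpha>\<close>-Hoelder, by
  blockwise Taylor expansion, so the points of exponent at most \<open>\<alpha>\<close> have dimension at most \<open>D\<close>.

  For the lower bound, a fractional derivative of order \<open>s\<close> turns \<open>R\<^sub>s\<close> into a theta function whose size near
  \<open>p/q\<close> with \<open>q\<close> odd is governed by a Gauss sum. Hence \<open>\<bar>x - p/q\<bar> \<le> Q\<^bsup>-\<tau>\<^esup>\<close> for infinitely many \<open>Q \<ge> q\<close> forces
  the exponent at \<open>x\<close> to be at most \<open>s - 1/2 + 1/(2\<tau>)\<close>. A Cantor set of such points with \<open>\<tau> = 2/D\<close> is the image of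
  \<open>[0,1)\<close> under a map with \<open>t\<close>-Hoelder inverse for every \<open>t < D\<close>. The points of smaller exponent
  pull back to a Lebesgue null set, so the level set itself does not have dimension below \<open>D\<close>.
\<close>

subsection \<open>Fourth moments of quadratic exponential sums\<close>

text \<open>The exponent 4 is critical on both sides. Up to powers of k the fourth moment of a block
  is the square of its second moment, so up to p = 4 the p-th moment shows no concentration; beyond
  4 it is dominated by the peak at 0, of height 2^(-k(s-1/2)) and width 2^(-k). The infimum is
  therefore decided at p = 4, and the upper bound for the dimension is Chebyshev's inequality with
  that same exponent: 4\<alpha>-4s+2 is 4\<alpha>-\<eta>(4)+1.

  The obstacle to proving irregularity is the polynomial in the Hoelder condition, whose degree is
  not bounded in advance and which a fixed kernel does not annihilate. As \<open>R s\<close> has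
  only positive frequencies, a kernel blind to frequencies <= 0 loses nothing of it, and a
  polynomial in h can be traded for a polynomial in e(-h), which this kernel kills, at the cost of a
  higher power of h.

  Denominators are odd because the Gauss sum vanishes for q = 2 mod 4. The theta estimate has to
  hold for q almost as large as 1/c, with a gain of only a small power of Q in qc; iterating the
  averaging M times turns this gain into any prescribed power.\<close>

lemma cis_integral_unit:
  fixes l :: int
  shows "((\<lambda>x. cis (2 * pi * of_int l * x)) has_integral (if l = 0 then 1 else 0)) {a..a+1}"
proof (cases "l = 0")
  case True
  then show ?thesis using has_integral_const_real[of "1::complex" a "a+1"] by simp
next
  case False
  let ?F = "\<lambda>x::real. cis (2 * pi * of_int l * x) / (2 * pi * \<i> * of_int l)"
  have "((\<lambda>x. cis (2 * pi * of_int l * x)) has_integral (?F (a+1) - ?F a)) {a..a+1}"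
  proof (rule fundamental_theorem_of_calculus)
    fix x assume "x \<in> {a..a+1}"
    have "(?F has_vector_derivative (2 * pi * of_int l) *\<^sub>R (\<i> * cis (2 * pi * of_int l * x)) / (2 * pi * \<i> * of_int l)) (at x within {a..a+1})"
      unfolding cis_conv_exp
      by (rule has_vector_derivative_real_field derivative_eq_intros refl | simp add: scaleR_conv_of_real algebra_simps)+
    moreover have "(2 * pi * of_int l) *\<^sub>R (\<i> * cis (2 * pi * of_int l * x)) / (2 * pi * \<i> * of_int l) = cis (2 * pi * of_int l * x)"
      using False by (simp add: scaleR_conv_of_real)
    ultimately show "(?F has_vector_derivative cis (2 * pi * of_int l * x)) (at x within {a..a+1})"
      by simp
  qed simp
  moreover have "?F (a+1) = ?F a"
  proof -
    have "cis (2 * pi * of_int l * (a+1)) = cis (2 * pi * of_int l * a) * cis (2 * pi * of_int l)"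
      by (simp add: cis_mult algebra_simps)
    also have "cis (2 * pi * of_int l) = 1" by (simp add: cis_multiple_2pi)
    finally show ?thesis by simp
  qed
  ultimately show ?thesis using False by simp
qed

section \<open>Divisor counts and the additive energy of the squares\<close>

lemma harm_le_ln: "harm n \<le> (1 + ln (real n + 1) :: real)"
proof (cases "n = 0")
  case False
  then have "harm n \<le> 1 + ln (real n)" using euler_mascheroni_sequence_decreasing[of 1 n] by (simp add: harm_def)
  also have "\<dots> \<le> 1 + ln (real n + 1)" using False by simp
  finally show ?thesis .
qed (simp add: harm_def)

text \<open>Lattice points under a hyperbola, counted column by column; the harmonic sum of the
  column heights supplies the logarithm.\<close>

lemma divisor_pairs_card:
  fixes X :: nat
  shows "real (card {(a,b). 0 < a \<and> 0 < b \<and> a * b \<le> X}) \<le> real X * (1 + ln (real X + 1))"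
    (is "real (card ?S) \<le> _")
proof -
  have eq: "?S = Sigma {1..X} (\<lambda>a. {1..X div a})"
  proof -
    have "0 < a \<and> 0 < b \<and> a * b \<le> X \<longleftrightarrow> a \<in> {1..X} \<and> b \<in> {1..X div a}" for a b
    proof
      assume h: "0 < a \<and> 0 < b \<and> a * b \<le> X"
      then have "a \<le> a * b" by simp
      then have "a \<le> X" using h le_trans by blast
      then show "a \<in> {1..X} \<and> b \<in> {1..X div a}"
        using h by (simp add: less_eq_div_iff_mult_less_eq mult.commute Suc_le_eq)
    next
      assume "a \<in> {1..X} \<and> b \<in> {1..X div a}"
      then show "0 < a \<and> 0 < b \<and> a * b \<le> X"
        by (auto simp: Suc_le_eq) (metis div_times_less_eq_dividend le_trans mult.commute mult_le_mono2)
    qed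
    then show ?thesis by blast
  qed
  have "real (card ?S) = (\<Sum>a=1..X. real (X div a))"
    unfolding eq by (subst card_SigmaI) auto
  also have "\<dots> \<le> (\<Sum>a=1..X. real X / real a)"
    by (intro sum_mono of_nat_div_le_of_nat)
  also have "\<dots> = real X * harm X"
    by (simp add: harm_def sum_distrib_left divide_inverse)
  also note harm_le_ln[of X]
  finally show ?thesis by (simp add: mult_left_mono)
qed

lemma finite_divisor_pairs: "finite {(a,b). 0 < a \<and> 0 < b \<and> a * b \<le> (X::nat)}"
proof (rule finite_subset)
  show "{(a,b). 0 < a \<and> 0 < b \<and> a * b \<le> X} \<subseteq> {..X} \<times> {..X}"
  proof clarsimp
    fix a b assume h: "0 < a" "0 < b" "a * b \<le> X"
    have "a \<le> a * b" "b \<le> a * b" using h by simp_all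
    then show "a \<le> X \<and> b \<le> X" using h(3) le_trans by blast
  qed
qed auto

text \<open>Four-number lemma: \<open>u v = w z\<close> forces \<open>u = a b\<close>, \<open>v = c d\<close>, \<open>w = a c\<close>, \<open>z = b d\<close>.\<close>

lemma equal_products_card:
  fixes X :: nat
  defines "T \<equiv> {(u,v,w,z). u \<in> {1..X} \<and> v \<in> {1..X} \<and> w \<in> {1..X} \<and> z \<in> {1..X} \<and> u * v = w * z}"
  shows "finite T" "real (card T) \<le> (real X * (1 + ln (real X + 1)))\<^sup>2"
proof -
  let ?S = "{(a,b). 0 < a \<and> 0 < b \<and> a * b \<le> X}"
  let ?f = "\<lambda>((a,b),(c,d)). (a * b, c * d, a * c, b * d)"
  have sub: "T \<subseteq> ?f ` (?S \<times> ?S)"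
  proof
    fix x assume "x \<in> T"
    then obtain u v w z where x: "x = (u,v,w,z)" and h: "u \<in> {1..X}" "v \<in> {1..X}" "w \<in> {1..X}" "z \<in> {1..X}" "u * v = w * z"
      unfolding T_def by auto
    define a where "a = gcd u w"
    have a0: "a > 0" using h by (auto simp: a_def)
    obtain b c where b: "u = a * b" and c: "w = a * c" and cop: "coprime b c"
      using gcd_coprime_exists[of u w] a0 unfolding a_def by (auto simp: mult.commute)
    have e: "b * v = c * z" using h(5) b c a0 by (simp add: mult.assoc)
    then have "c dvd b * v" by simp
    then have "c dvd v" using cop by (simp add: coprime_commute coprime_dvd_mult_right_iff)
    then obtain d where d: "v = c * d" by auto
    have c0: "c > 0" using h(3) c by (cases c) auto
    have z: "z = b * d" using e d c0 by (simp add: mult.left_commute)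
    have "((a,b),(c,d)) \<in> ?S \<times> ?S" using h b c d z a0 c0 by (auto intro!: Nat.gr0I)
    moreover have "x = ?f ((a,b),(c,d))" using x b c d z by simp
    ultimately show "x \<in> ?f ` (?S \<times> ?S)" by blast
  qed
  have fin: "finite (?S \<times> ?S)" using finite_divisor_pairs[of X] by (intro finite_cartesian_product)
  then show "finite T" using sub finite_surj by blast
  have "card T \<le> card (?S \<times> ?S)" using surj_card_le[OF fin sub] .
  also have "\<dots> = card ?S * card ?S" by (rule card_cartesian_product)
  finally have "real (card T) \<le> (real (card ?S))\<^sup>2" by (simp only: power2_eq_square of_nat_mult[symmetric] of_nat_le_iff)
  also have "\<dots> \<le> (real X * (1 + ln (real X + 1)))\<^sup>2"
    by (intro power_mono divisor_pairs_card) auto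
  finally show "real (card T) \<le> (real X * (1 + ln (real X + 1)))\<^sup>2" .
qed

definition square_quads :: "nat set \<Rightarrow> ((nat \<times> nat) \<times> (nat \<times> nat)) set" where
  "square_quads B = {((n1,m1),(n2,m2)). n1 \<in> B \<and> m1 \<in> B \<and> n2 \<in> B \<and> m2 \<in> B \<and> n1\<^sup>2 + m1\<^sup>2 = n2\<^sup>2 + m2\<^sup>2}"

text \<open>An off-diagonal solution satisfies (n1-n2)(n1+n2) = (m2-m1)(m2+m1), an equality of two
  products with factors up to 2N, and is recovered from the four factors. The 9 is 1 for the
  diagonal plus 2 * 4 for the two signs of n1-n2.\<close>

lemma square_quads_card:
  fixes B :: "nat set" and N :: nat
  assumes B: "B \<subseteq> {1..N}"
  shows "real (card (square_quads B)) \<le> 9 * (real N)\<^sup>2 * (1 + ln (2 * real N + 1))\<^sup>2"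
proof -
  define T where "T = {(u,v,w,z). u \<in> {1..2*N} \<and> v \<in> {1..2*N} \<and> w \<in> {1..2*N} \<and> z \<in> {1..2*N} \<and> u * v = w * (z::nat)}"
  have Tfin: "finite T" and Tcard: "real (card T) \<le> (real (2*N) * (1 + ln (real (2*N) + 1)))\<^sup>2"
    using equal_products_card[of "2*N"] unfolding T_def by auto
  have finB: "finite B" using B finite_subset by blast
  define S0 where "S0 = {q \<in> square_quads B. fst (fst q) = fst (snd q)}"
  define S1 where "S1 = {q \<in> square_quads B. fst (fst q) > fst (snd q)}"
  define S2 where "S2 = {q \<in> square_quads B. fst (fst q) < fst (snd q)}"
  have fin: "finite (square_quads B)"
    by (rule finite_subset[of _ "(B \<times> B) \<times> (B \<times> B)"]) (use finB in \<open>auto simp: square_quads_def\<close>)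
  have un: "square_quads B = S0 \<union> S1 \<union> S2" unfolding S0_def S1_def S2_def by auto
  have c0: "card S0 \<le> N\<^sup>2"
  proof -
    have sub: "fst ` S0 \<subseteq> {1..N} \<times> {1..N}" using B by (force simp: S0_def square_quads_def)
    have inj: "inj_on fst S0" by (auto simp: inj_on_def S0_def square_quads_def)
    have "card S0 = card (fst ` S0)" using inj by (simp add: card_image)
    also have "\<dots> \<le> card ({1..N} \<times> {1..N})" using sub by (intro card_mono) auto
    finally show ?thesis by (simp add: power2_eq_square card_cartesian_product)
  qed
  define F where "F = (\<lambda>((n1,m1),(n2,m2)). (n1 - n2, n1 + n2, m2 - m1, m2 + m1) :: nat \<times> nat \<times> nat \<times> nat)"
  have S1: "card S1 \<le> card T"
  proof (rule card_inj_on_le[of F])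
    have key: "n2 < n1 \<and> m1 < m2 \<and> (n1 - n2) * (n1 + n2) = (m2 - m1) * (m2 + m1)"
      if "((n1,m1),(n2,m2)) \<in> S1" for n1 m1 n2 m2
    proof -
      from that have e: "n1\<^sup>2 + m1\<^sup>2 = n2\<^sup>2 + m2\<^sup>2" and l: "n2 < n1" by (auto simp: S1_def square_quads_def)
      have "n2\<^sup>2 < n1\<^sup>2" using l by (simp add: power_strict_mono)
      then have "m1\<^sup>2 < m2\<^sup>2" using e by linarith
      then have m: "m1 < m2" using power_less_imp_less_base by blast
      have "int ((n1 - n2) * (n1 + n2)) = int ((m2 - m1) * (m2 + m1))"
      proof -
        have "int n1 ^ 2 + int m1 ^ 2 = int n2 ^ 2 + int m2 ^ 2"
          using e by (metis of_nat_add of_nat_power)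
        then have "(int n1 - int n2) * (int n1 + int n2) = (int m2 - int m1) * (int m2 + int m1)"
          by (simp add: algebra_simps power2_eq_square)
        then show ?thesis using l m by (simp only: of_nat_mult of_nat_add of_nat_diff less_imp_le)
      qed
      then have "(n1 - n2) * (n1 + n2) = (m2 - m1) * (m2 + m1)" by (simp only: of_nat_eq_iff)
      then show ?thesis using l m by blast
    qed
    show "inj_on F S1"
    proof (rule inj_onI)
      fix x y assume x: "x \<in> S1" and y: "y \<in> S1" and e: "F x = F y"
      obtain n1 m1 n2 m2 where xx: "x = ((n1,m1),(n2,m2))" by (cases x) auto
      obtain n1' m1' n2' m2' where yy: "y = ((n1',m1'),(n2',m2'))" by (cases y) auto
      show "x = y" using key[of n1 m1 n2 m2] key[of n1' m1' n2' m2'] x y e unfolding xx yy F_def by auto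
    qed
    show "F ` S1 \<subseteq> T"
    proof
      fix t assume "t \<in> F ` S1"
      then obtain n1 m1 n2 m2 where s: "((n1,m1),(n2,m2)) \<in> S1" and t: "t = (n1 - n2, n1 + n2, m2 - m1, m2 + m1)"
        by (auto simp: F_def)
      have r: "n1 \<in> {1..N}" "n2 \<in> {1..N}" "m1 \<in> {1..N}" "m2 \<in> {1..N}"
        using s B unfolding S1_def square_quads_def by auto
      show "t \<in> T" unfolding T_def t using key[OF s] r by auto
    qed
    show "finite T" by fact
  qed
  have S2: "card S2 \<le> card S1"
    by (rule card_inj_on_le[of "\<lambda>(a,b). (b,a)"])
       (use fin in \<open>auto simp: inj_on_def S2_def S1_def square_quads_def\<close>)
  have "card (square_quads B) \<le> card S0 + card S1 + card S2"
    unfolding un by (meson add_le_mono card_Un_le dual_order.trans le_refl)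
  also have "\<dots> \<le> N\<^sup>2 + 2 * card T" using c0 S1 S2 by linarith
  finally have "real (card (square_quads B)) \<le> real (N\<^sup>2 + 2 * card T)" by (simp only: of_nat_le_iff)
  also have "\<dots> \<le> (real N)\<^sup>2 + 2 * (2 * real N * (1 + ln (2 * real N + 1)))\<^sup>2"
    using Tcard by simp
  also have "\<dots> \<le> 9 * (real N)\<^sup>2 * (1 + ln (2 * real N + 1))\<^sup>2"
  proof -
    have "1 \<le> (1 + ln (2 * real N + 1))\<^sup>2" by (simp add: one_le_power)
    then have "(real N)\<^sup>2 * 1 \<le> (real N)\<^sup>2 * (1 + ln (2 * real N + 1))\<^sup>2"
      by (intro mult_left_mono) auto
    then show ?thesis by (simp add: power_mult_distrib)
  qed
  finally show ?thesis .
qed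

text \<open>Parseval's identity with repeated frequencies allowed: each coincidence
  \<open>\<phi> i = \<phi> j\<close> contributes. Non-injective \<open>\<phi>\<close> is the point,
  since the square of an exponential sum is indexed by pairs.\<close>

lemma sum_cis_norm2_integral:
  fixes a :: "'i \<Rightarrow> complex" and \<phi> :: "'i \<Rightarrow> int"
  assumes I: "finite I"
  shows "((\<lambda>x. complex_of_real ((cmod (\<Sum>i\<in>I. a i * cis (2 * pi * of_int (\<phi> i) * x)))\<^sup>2)) has_integral
           (\<Sum>(i,j)\<in>{(i,j)\<in>I\<times>I. \<phi> i = \<phi> j}. a i * cnj (a j))) {t..t+1}"
proof -
  have "((\<lambda>x. \<Sum>(i,j)\<in>I\<times>I. a i * cnj (a j) * cis (2 * pi * of_int (\<phi> i - \<phi> j) * x)) has_integral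
     (\<Sum>(i,j)\<in>I\<times>I. a i * cnj (a j) * (if \<phi> i - \<phi> j = 0 then 1 else 0))) {t..t+1}"
    unfolding case_prod_unfold
    by (intro has_integral_sum has_integral_mult_right cis_integral_unit finite_cartesian_product I)
  moreover have "(\<Sum>(i,j)\<in>I\<times>I. a i * cnj (a j) * cis (2 * pi * of_int (\<phi> i - \<phi> j) * x))
      = complex_of_real ((cmod (\<Sum>i\<in>I. a i * cis (2 * pi * of_int (\<phi> i) * x)))\<^sup>2)" for x
  proof -
    have "complex_of_real ((cmod (\<Sum>i\<in>I. a i * cis (2 * pi * of_int (\<phi> i) * x)))\<^sup>2)
      = (\<Sum>i\<in>I. a i * cis (2 * pi * of_int (\<phi> i) * x)) * cnj (\<Sum>i\<in>I. a i * cis (2 * pi * of_int (\<phi> i) * x))"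
      by (simp only: complex_norm_square)
    also have "\<dots> = (\<Sum>(i,j)\<in>I\<times>I. (a i * cis (2 * pi * of_int (\<phi> i) * x)) * cnj (a j * cis (2 * pi * of_int (\<phi> j) * x)))"
      by (simp only: cnj_sum sum_product sum.cartesian_product)
    also have "\<dots> = (\<Sum>(i,j)\<in>I\<times>I. a i * cnj (a j) * cis (2 * pi * of_int (\<phi> i - \<phi> j) * x))"
    proof (rule sum.cong, simp, clarify)
      fix i j
      have "cis (2 * pi * of_int (\<phi> i) * x) * cis (- (2 * pi * of_int (\<phi> j) * x)) = cis (2 * pi * of_int (\<phi> i - \<phi> j) * x)"
        by (simp add: cis_mult algebra_simps)
      then show "a i * cis (2 * pi * of_int (\<phi> i) * x) * cnj (a j * cis (2 * pi * of_int (\<phi> j) * x)) = a i * cnj (a j) * cis (2 * pi * of_int (\<phi> i - \<phi> j) * x)"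
        by (simp add: cis_cnj mult_ac)
    qed
    finally show ?thesis by simp
  qed
  moreover have "(\<Sum>(i,j)\<in>I\<times>I. a i * cnj (a j) * (if \<phi> i - \<phi> j = 0 then 1 else 0))
      = (\<Sum>(i,j)\<in>{(i,j)\<in>I\<times>I. \<phi> i = \<phi> j}. a i * cnj (a j))"
    by (rule sum.mono_neutral_cong_right) (use I in \<open>auto split: if_splits\<close>)
  ultimately show ?thesis by simp
qed

definition sqsum :: "nat set \<Rightarrow> (nat \<Rightarrow> complex) \<Rightarrow> real \<Rightarrow> complex" where
  "sqsum B b x = (\<Sum>n\<in>B. b n * cis (2 * pi * real (n\<^sup>2) * x))"

lemma continuous_on_sqsum [continuous_intros]: "continuous_on S (sqsum B b)"
  unfolding sqsum_def by (intro continuous_intros)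

lemma sqsum_L2:
  assumes "finite B"
  shows "((\<lambda>x. (cmod (sqsum B b x))\<^sup>2) has_integral (\<Sum>n\<in>B. (cmod (b n))\<^sup>2)) {t..t+1}"
proof -
  have "((\<lambda>x. complex_of_real ((cmod (sqsum B b x))\<^sup>2)) has_integral
           (\<Sum>(i,j)\<in>{(i,j)\<in>B\<times>B. int (i\<^sup>2) = int (j\<^sup>2)}. b i * cnj (b j))) {t..t+1}"
    using sum_cis_norm2_integral[OF assms, of b "\<lambda>n. int (n\<^sup>2)"] by (simp add: sqsum_def)
  also have "{(i,j)\<in>B\<times>B. int (i\<^sup>2) = int (j\<^sup>2)} = (\<lambda>i. (i,i)) ` B"
    by (auto simp: power2_eq_iff_nonneg simp del: of_nat_power)
  also have "(\<Sum>(i,j)\<in>(\<lambda>i. (i,i)) ` B. b i * cnj (b j)) = (\<Sum>i\<in>B. b i * cnj (b i))"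
    by (subst sum.reindex) (auto simp: inj_on_def)
  also have "\<dots> = complex_of_real (\<Sum>n\<in>B. (cmod (b n))\<^sup>2)"
    by (simp only: complex_norm_square of_real_sum)
  finally have hi: "((\<lambda>x. complex_of_real ((cmod (sqsum B b x))\<^sup>2)) has_integral
      complex_of_real (\<Sum>n\<in>B. (cmod (b n))\<^sup>2)) {t..t+1}" .
  show ?thesis using has_integral_Re[OF hi] by (simp only: Re_complex_of_real)
qed

text \<open>The fourth power of the modulus is the squared modulus of S^2, and S^2 is a sum over
  pairs with frequency n^2 + m^2. Its coincidences are exactly \<open>square_quads\<close>.\<close>

lemma sqsum_L4:
  assumes B: "B \<subseteq> {1..N}" and b: "\<And>n. n \<in> B \<Longrightarrow> cmod (b n) \<le> A"
  shows "integral {t..t+1} (\<lambda>x. (cmod (sqsum B b x))^4) \<le> A^4 * (9 * (real N)\<^sup>2 * (1 + ln (2 * real N + 1))\<^sup>2)"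
proof -
  have finB: "finite B" using B finite_subset by blast
  let ?a = "\<lambda>(n,m). b n * b m" and ?\<phi> = "\<lambda>(n,m). int (n\<^sup>2 + m\<^sup>2)"
  let ?P = "{(i,j)\<in>(B\<times>B)\<times>(B\<times>B). ?\<phi> i = ?\<phi> j}"
  have eq: "(\<Sum>i\<in>B\<times>B. ?a i * cis (2 * pi * of_int (?\<phi> i) * x)) = (sqsum B b x)\<^sup>2" for x
  proof -
    have "(sqsum B b x)\<^sup>2 = (\<Sum>(n,m)\<in>B\<times>B. (b n * cis (2 * pi * real (n\<^sup>2) * x)) * (b m * cis (2 * pi * real (m\<^sup>2) * x)))"
      unfolding power2_eq_square[of "sqsum B b x"] by (simp only: sqsum_def sum_product sum.cartesian_product)
    also have "\<dots> = (\<Sum>i\<in>B\<times>B. ?a i * cis (2 * pi * of_int (?\<phi> i) * x))"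
    proof (rule sum.cong, simp, clarify)
      fix n m
      have "cis (2 * pi * real (n\<^sup>2) * x) * cis (2 * pi * real (m\<^sup>2) * x) = cis (2 * pi * of_int (int (n\<^sup>2 + m\<^sup>2)) * x)"
        by (simp add: cis_mult algebra_simps)
      then show "b n * cis (2 * pi * real (n\<^sup>2) * x) * (b m * cis (2 * pi * real (m\<^sup>2) * x)) = b n * b m * cis (2 * pi * of_int (int (n\<^sup>2 + m\<^sup>2)) * x)"
        by (simp add: mult_ac)
    qed
    finally show ?thesis by simp
  qed
  have hi: "((\<lambda>x. complex_of_real ((cmod ((sqsum B b x)\<^sup>2))\<^sup>2)) has_integral (\<Sum>(i,j)\<in>?P. ?a i * cnj (?a j))) {t..t+1}"
    using sum_cis_norm2_integral[of "B\<times>B" ?a ?\<phi> t] finB unfolding eq by simp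
  have "((\<lambda>x. (cmod (sqsum B b x))^4) has_integral Re (\<Sum>(i,j)\<in>?P. ?a i * cnj (?a j))) {t..t+1}"
    using has_integral_Re[OF hi] by (simp add: norm_power)
  then have "integral {t..t+1} (\<lambda>x. (cmod (sqsum B b x))^4) = Re (\<Sum>(i,j)\<in>?P. ?a i * cnj (?a j))"
    by (rule integral_unique)
  also have "\<dots> \<le> cmod (\<Sum>(i,j)\<in>?P. ?a i * cnj (?a j))" by (rule complex_Re_le_cmod)
  also have "\<dots> \<le> (\<Sum>(i,j)\<in>?P. A^4)"
  proof (rule order_trans[OF norm_sum], rule sum_mono, clarify)
    fix n1 m1 n2 m2 assume "n1 \<in> B" "m1 \<in> B" "n2 \<in> B" "m2 \<in> B"
    then have le: "cmod (b n1) \<le> A" "cmod (b m1) \<le> A" "cmod (b n2) \<le> A" "cmod (b m2) \<le> A" using b by auto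
    have A0: "0 \<le> A" using le(1) norm_ge_zero order_trans by blast
    have "cmod (b n1) * cmod (b m1) * (cmod (b n2) * cmod (b m2)) \<le> A * A * (A * A)"
      using le A0 by (intro mult_mono) auto
    then show "cmod (b n1 * b m1 * cnj (b n2 * b m2)) \<le> A ^ 4" by (simp add: norm_mult eval_nat_numeral mult.assoc)
  qed
  also have "\<dots> = A^4 * real (card ?P)" by simp
  also have "?P = square_quads B"
    by (auto simp: square_quads_def simp flip: of_nat_power of_nat_add)
  also have "A^4 * real (card (square_quads B)) \<le> A^4 * (9 * (real N)\<^sup>2 * (1 + ln (2 * real N + 1))\<^sup>2)"
    by (intro mult_left_mono square_quads_card B) auto
  finally show ?thesis .
qed

subsection \<open>The series and its dyadic blocks\<close>

lemma integral_suminf_uniform: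
  fixes h :: "nat \<Rightarrow> real \<Rightarrow> complex"
  assumes c: "\<And>n. continuous_on {a..b} (h n)"
    and M: "\<And>n x. x \<in> {a..b} \<Longrightarrow> cmod (h n x) \<le> M n" and sM: "summable M"
  shows "(\<lambda>n. integral {a..b} (h n)) sums integral {a..b} (\<lambda>x. \<Sum>n. h n x)"
    and "continuous_on {a..b} (\<lambda>x. \<Sum>n. h n x)"
proof -
  have ul: "uniform_limit {a..b} (\<lambda>n x. \<Sum>i<n. h i x) (\<lambda>x. suminf (\<lambda>i. h i x)) sequentially"
    by (rule Weierstrass_m_test[OF M sM])
  have cont: "continuous_on {a..b} (\<lambda>x. \<Sum>i<n. h i x)" for n
    by (intro continuous_on_sum c)
  show "continuous_on {a..b} (\<lambda>x. \<Sum>n. h n x)"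
    by (rule uniform_limit_theorem[OF _ ul]) (use cont in auto)
  obtain I J where I: "\<And>n. ((\<lambda>x. \<Sum>i<n. h i x) has_integral I n) {a..b}"
      and J: "((\<lambda>x. \<Sum>n. h n x) has_integral J) {a..b}" and lim: "I \<longlonglongrightarrow> J"
    using uniform_limit_integral[OF ul cont] by auto
  have "I n = (\<Sum>i<n. integral {a..b} (h i))" for n
  proof -
    have "((\<lambda>x. \<Sum>i<n. h i x) has_integral (\<Sum>i<n. integral {a..b} (h i))) {a..b}"
      by (intro has_integral_sum finite_lessThan integrable_integral integrable_continuous_real c)
    then show ?thesis using I has_integral_unique by blast
  qed
  then have "(\<lambda>n. (\<Sum>i<n. integral {a..b} (h i))) \<longlonglongrightarrow> J" using lim by presburger
  then show "(\<lambda>n. integral {a..b} (h n)) sums integral {a..b} (\<lambda>x. \<Sum>n. h n x)"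
    unfolding sums_def using integral_unique[OF J] by simp
qed

definition rterm :: "real \<Rightarrow> nat \<Rightarrow> real \<Rightarrow> complex" where
  "rterm s n x = complex_of_real (real n powr (- 2 * s)) * cis (2 * pi * real (n\<^sup>2) * x)"

lemma R_eq: "R s x = (\<Sum>n. rterm s (Suc n) x)"
  by (simp add: R_def rterm_def del: of_nat_Suc)

lemma norm_rterm: "cmod (rterm s n x) = real n powr (- 2 * s)"
  by (simp add: rterm_def norm_mult)

lemma continuous_on_rterm [continuous_intros]: "continuous_on S (rterm s n)"
  unfolding rterm_def by (intro continuous_intros)

lemma summable_rterm_norm: "s > 1/2 \<Longrightarrow> summable (\<lambda>n. real (Suc n) powr (- 2 * s))"
  using summable_real_powr_iff[of "- 2 * s"] summable_Suc_iff[of "\<lambda>n. real n powr (- 2 * s)"] by simp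

lemma R_sums: assumes "s > 1/2" shows "(\<lambda>n. rterm s (Suc n) x) sums R s x"
  unfolding R_eq
  by (rule summable_sums, rule summable_norm_cancel) (use summable_rterm_norm[OF assms] in \<open>simp add: norm_rterm\<close>)

lemma continuous_on_R: assumes "s > 1/2" shows "continuous_on {a..b} (R s)"
  unfolding R_eq[abs_def]
  by (rule integral_suminf_uniform(2)[OF _ _ summable_rterm_norm[OF assms]]) (auto intro: continuous_intros simp: norm_rterm)

lemma norm_R_bound: assumes "s > 1/2" shows "cmod (R s x) \<le> (\<Sum>n. real (Suc n) powr (- 2 * s))"
proof -
  have "cmod (R s x) \<le> (\<Sum>n. cmod (rterm s (Suc n) x))"
    unfolding R_eq by (rule summable_norm) (use summable_rterm_norm[OF assms] in \<open>simp add: norm_rterm\<close>)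
  then show ?thesis by (simp only: norm_rterm)
qed

text \<open>The doubled inequality replaces n^2 >= 2^(k-1) and so avoids the exponent k-1 at k = 0.
  There the block is empty, in accordance with the vanishing zeroth Fourier coefficient of
  \<open>R s\<close>.\<close>

definition sqblock :: "nat \<Rightarrow> nat set" where
  "sqblock k = {n. 2^k \<le> 2 * n\<^sup>2 \<and> n\<^sup>2 < 2^k}"

lemma fourier_coeff_R:
  assumes s: "s > 1/2"
  shows "fourier_coeff (R s) l = (\<Sum>n. complex_of_real (real (Suc n) powr (- 2 * s)) * (if l = int ((Suc n)\<^sup>2) then 1 else 0))"
proof -
  define h where "h = (\<lambda>n x. rterm s (Suc n) x * cis (- 2 * pi * of_int l * x))"
  have "(\<lambda>n. integral {0..1} (h n)) sums integral {0..1} (\<lambda>x. \<Sum>n. h n x)"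
  proof (rule integral_suminf_uniform(1))
    show "continuous_on {0..1} (h n)" for n unfolding h_def by (intro continuous_intros)
    show "cmod (h n x) \<le> real (Suc n) powr (- 2 * s)" for n x by (simp add: h_def norm_mult norm_rterm)
    show "summable (\<lambda>n. real (Suc n) powr (- 2 * s))" by (rule summable_rterm_norm[OF s])
  qed
  moreover have "(\<Sum>n. h n x) = R s x * cis (- 2 * pi * of_int l * x)" for x
    unfolding h_def R_eq by (rule suminf_mult2[symmetric]) (use R_sums[OF s] in \<open>auto simp: sums_iff\<close>)
  moreover have "integral {0..1} (h n) = complex_of_real (real (Suc n) powr (- 2 * s)) * (if l = int ((Suc n)\<^sup>2) then 1 else 0)" for n
  proof -
    have "h n = (\<lambda>x. complex_of_real (real (Suc n) powr (- 2 * s)) * cis (2 * pi * of_int (int ((Suc n)\<^sup>2) - l) * x))"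
      unfolding h_def rterm_def by (rule ext) (simp add: mult.assoc cis_mult algebra_simps)
    then have "(h n has_integral complex_of_real (real (Suc n) powr (- 2 * s)) * (if int ((Suc n)\<^sup>2) - l = 0 then 1 else 0)) {0..0+1}"
      by (simp only:) (intro has_integral_mult_right cis_integral_unit)
    then have "integral {0..1} (h n) = complex_of_real (real (Suc n) powr (- 2 * s)) * (if int ((Suc n)\<^sup>2) - l = 0 then 1 else 0)"
      by (simp only: add_0_left integral_unique)
    moreover have "int ((Suc n)\<^sup>2) - l = 0 \<longleftrightarrow> l = int ((Suc n)\<^sup>2)" by linarith
    ultimately show ?thesis by presburger
  qed
  ultimately show ?thesis unfolding fourier_coeff_def by (simp add: sums_iff)
qed

lemma fourier_coeff_R_square:
  assumes s: "s > 1/2" and n: "n > 0"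
  shows "fourier_coeff (R s) (int (n\<^sup>2)) = complex_of_real (real n powr (- 2 * s))"
proof -
  obtain m where m: "n = Suc m" using n gr0_conv_Suc by blast
  have eq: "int (n\<^sup>2) = int ((Suc j)\<^sup>2) \<longleftrightarrow> j = m" for j
    unfolding of_nat_eq_iff m by (simp add: power2_eq_iff_nonneg del: power_Suc) auto
  have "(\<lambda>j. complex_of_real (real (Suc j) powr (- 2 * s)) * (if int (n\<^sup>2) = int ((Suc j)\<^sup>2) then 1 else 0))
       = (\<lambda>j. if j = m then complex_of_real (real (Suc j) powr (- 2 * s)) else 0)"
    unfolding eq by auto
  then show ?thesis using fourier_coeff_R[OF s, of "int (n\<^sup>2)"] sums_single[of m "\<lambda>j. complex_of_real (real (Suc j) powr (- 2 * s))"] m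
    by (simp add: sums_iff)
qed

lemma fourier_coeff_R_nonsquare:
  assumes s: "s > 1/2" and "\<And>n. n > 0 \<Longrightarrow> l \<noteq> int (n\<^sup>2)"
  shows "fourier_coeff (R s) l = 0"
  unfolding fourier_coeff_R[OF s] using assms(2) by (auto simp del: of_nat_power)

lemma square_powr: "x > 0 \<Longrightarrow> (x\<^sup>2) powr y = x powr (2 * y)" for x y :: real
  using powr_powr[of x 2 y] by simp

text \<open>The factor (2 pi i n^2)^i comes from i differentiations, so \<open>gk s k i\<close> is
  the i-th derivative of the k-th Littlewood-Paley block.\<close>

definition coef :: "real \<Rightarrow> nat \<Rightarrow> nat \<Rightarrow> complex" where
  "coef s i n = complex_of_real (real n powr (- 2 * s)) * (2 * pi * \<i> * of_nat (n\<^sup>2)) ^ i"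

definition gk :: "real \<Rightarrow> nat \<Rightarrow> nat \<Rightarrow> real \<Rightarrow> complex" where
  "gk s k i = sqsum (sqblock k) (coef s i)"

lemma sqblock_pos: "n \<in> sqblock k \<Longrightarrow> n > 0"
  by (rule Nat.gr0I) (auto simp: sqblock_def)

lemma sqblock_bounds:
  assumes "n \<in> sqblock k"
  shows "(real n)\<^sup>2 < 2^k" "2^k \<le> 2 * (real n)\<^sup>2" "real n < 2 powr (real k / 2)" "real n \<le> 2^k"
proof -
  have a: "n\<^sup>2 < 2^k" and b: "2^k \<le> 2 * n\<^sup>2" using assms by (auto simp: sqblock_def)
  show 1: "(real n)\<^sup>2 < 2^k" using a by (metis of_nat_less_iff of_nat_numeral of_nat_power)
  have "real (2^k) \<le> real (2 * n\<^sup>2)" using b by (simp only: of_nat_le_iff)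
  then show "2^k \<le> 2 * (real n)\<^sup>2" by (simp only: of_nat_mult of_nat_power of_nat_numeral)
  have "(2 powr (real k / 2))\<^sup>2 = (2::real)^k"
    by (simp add: power2_eq_square powr_add[symmetric] powr_realpow)
  then show "real n < 2 powr (real k / 2)" using 1
    by (metis powr_ge_zero power_less_imp_less_base)
  have "n \<le> n\<^sup>2" by (simp add: power2_eq_square)
  then have "n \<le> 2^k" using a by linarith
  then show "real n \<le> 2^k" by (metis of_nat_le_iff of_nat_numeral of_nat_power)
qed

definition blockN :: "nat \<Rightarrow> nat" where "blockN k = nat \<lfloor>2 powr (real k / 2)\<rfloor>"

lemma blockN_bounds: "real (blockN k) \<le> 2 powr (real k / 2)" "(real (blockN k))\<^sup>2 \<le> 2^k"
proof -
  show 1: "real (blockN k) \<le> 2 powr (real k / 2)" unfolding blockN_def by simp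
  have "(2 powr (real k / 2))\<^sup>2 = (2::real)^k"
    by (simp add: power2_eq_square powr_add[symmetric] powr_realpow)
  then show "(real (blockN k))\<^sup>2 \<le> 2^k" using power_mono[OF 1, of 2] by simp
qed

lemma sqblock_sub: "sqblock k \<subseteq> {1..blockN k}"
proof
  fix n assume n: "n \<in> sqblock k"
  have "n \<le> blockN k" unfolding blockN_def using sqblock_bounds(3)[OF n] by (simp add: le_nat_floor)
  then show "n \<in> {1..blockN k}" using sqblock_pos[OF n] by auto
qed

lemma finite_sqblock [simp]: "finite (sqblock k)"
  using sqblock_sub finite_subset by blast

lemma card_sqblock_le: "real (card (sqblock k)) \<le> 2 powr (real k / 2)"
proof -
  have "card (sqblock k) \<le> card {1..blockN k}" by (intro card_mono sqblock_sub) auto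
  then show ?thesis using blockN_bounds(1)[of k] by simp
qed

text \<open>On the block n^2 is comparable to 2^k; the lower edge 2^(k-1) costs the factor
  \<open>2 powr s\<close>.\<close>

definition coefA :: "real \<Rightarrow> nat \<Rightarrow> nat \<Rightarrow> real" where
  "coefA s i k = (2 * pi)^i * 2 powr s * 2 powr (real k * (real i - s))"

lemma coefA_pos: "coefA s i k > 0" by (simp add: coefA_def)

lemma norm_coef_le:
  assumes n: "n \<in> sqblock k" and s: "s > 0"
  shows "cmod (coef s i n) \<le> coefA s i k"
proof -
  have "real n powr (- 2 * s) = ((real n)\<^sup>2) powr (- s)"
    using square_powr[of "real n" "- s"] sqblock_pos[OF n] by simp
  also have "((real n)\<^sup>2) powr (- s) \<le> (2^k / 2) powr (- s)"
    using s sqblock_bounds(2)[OF n] by (intro powr_mono2') auto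
  also have "(2^k / 2) powr (- s) = 2 powr s * 2 powr (- (real k * s))"
    by (simp add: powr_divide powr_realpow[symmetric] powr_powr powr_minus divide_simps)
  finally have 1: "real n powr (- 2 * s) \<le> 2 powr s * 2 powr (- (real k * s))" .
  have "cmod ((2 * pi * \<i> * of_nat (n\<^sup>2)) ^ i) = (2 * pi * (real n)\<^sup>2)^i"
    by (simp add: norm_power norm_mult)
  also have "\<dots> \<le> (2 * pi * 2^k)^i"
    using sqblock_bounds(1)[OF n] by (intro power_mono mult_left_mono) auto
  also have "\<dots> = (2 * pi)^i * 2 powr (real k * real i)"
    by (simp add: power_mult_distrib powr_realpow[symmetric] powr_powr powr_power mult.commute)
  finally have 2: "cmod ((2 * pi * \<i> * of_nat (n\<^sup>2)) ^ i) \<le> (2 * pi)^i * 2 powr (real k * real i)" .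
  have "cmod (coef s i n) \<le> (2 powr s * 2 powr (- (real k * s))) * ((2 * pi)^i * 2 powr (real k * real i))"
    unfolding coef_def norm_mult using 1 2 by (intro mult_mono) auto
  also have "\<dots> = coefA s i k"
    by (simp add: coefA_def powr_add[symmetric] algebra_simps)
  finally show ?thesis .
qed

lemma norm_gk_le:
  assumes s: "s > 0"
  shows "cmod (gk s k i x) \<le> (2 * pi)^i * 2 powr s * 2 powr (real k * (real i - (s - 1/2)))"
proof -
  have "cmod (gk s k i x) \<le> (\<Sum>n\<in>sqblock k. coefA s i k)"
    unfolding gk_def sqsum_def
    by (rule order_trans[OF norm_sum], rule sum_mono) (use norm_coef_le[OF _ s] in \<open>simp add: norm_mult\<close>)
  also have "\<dots> = real (card (sqblock k)) * coefA s i k" by simp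
  also have "\<dots> \<le> 2 powr (real k / 2) * coefA s i k"
    using coefA_pos[of s i k] by (intro mult_right_mono card_sqblock_le) auto
  also have "\<dots> = (2 * pi)^i * 2 powr s * 2 powr (real k * (real i - (s - 1/2)))"
    by (simp add: coefA_def powr_add[symmetric] algebra_simps)
  finally show ?thesis .
qed

lemma gk_L4:
  assumes s: "s > 0"
  shows "integral {t..t+1} (\<lambda>x. (cmod (gk s k i x))^4)
     \<le> 9 * ((2 * pi)^i * 2 powr s)^4 * (real k + 3)\<^sup>2 * 2 powr (real k * (4 * (real i - s) + 1))"
proof -
  have "integral {t..t+1} (\<lambda>x. (cmod (gk s k i x))^4)
      \<le> (coefA s i k)^4 * (9 * (real (blockN k))\<^sup>2 * (1 + ln (2 * real (blockN k) + 1))\<^sup>2)"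
    unfolding gk_def by (rule sqsum_L4[OF sqblock_sub]) (rule norm_coef_le[OF _ s])
  also have "\<dots> \<le> (coefA s i k)^4 * (9 * 2^k * (real k + 3)\<^sup>2)"
  proof -
    \<comment> \<open>The logarithm in the energy bound is linear in k. All later uses have a spare
      exponential factor, so a crude k + 3 suffices.\<close>
    have "2 * real (blockN k) + 1 \<le> 4 * 2 powr (real k / 2)"
      using blockN_bounds(1)[of k] ge_one_powr_ge_zero[of 2 "real k / 2"] by simp
    then have "ln (2 * real (blockN k) + 1) \<le> ln (4 * 2 powr (real k / 2))" by simp
    also have "\<dots> = ln 4 + real k / 2 * ln 2" by (simp add: ln_mult ln_powr)
    also have "ln 4 = 2 * ln (2::real)" using ln_realpow[of 2 2] by simp
    also have "2 * ln 2 + real k / 2 * ln 2 = (2 + real k / 2) * ln 2" by (simp add: algebra_simps)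
    also have "\<dots> \<le> (2 + real k / 2) * 1" by (intro mult_left_mono) (auto simp: ln_2_less_1 less_imp_le)
    finally have "1 + ln (2 * real (blockN k) + 1) \<le> real k + 3" by simp
    then have "(1 + ln (2 * real (blockN k) + 1))\<^sup>2 \<le> (real k + 3)\<^sup>2" by (intro power_mono) auto
    then show ?thesis using blockN_bounds(2)[of k] coefA_pos[of s i k]
      by (intro mult_left_mono mult_mono) auto
  qed
  also have "(coefA s i k)^4 = ((2 * pi)^i * 2 powr s)^4 * 2 powr (real k * (4 * (real i - s)))"
  proof -
    have "(2 powr (real k * (real i - s)))^4 = (2::real) powr (real k * (4 * (real i - s)))"
      by (simp add: powr_power mult_ac)
    then show ?thesis unfolding coefA_def by (simp only: power_mult_distrib)
  qed
  also have "((2 * pi)^i * 2 powr s)^4 * 2 powr (real k * (4 * (real i - s))) * (9 * 2^k * (real k + 3)\<^sup>2)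
     = 9 * ((2 * pi)^i * 2 powr s)^4 * (real k + 3)\<^sup>2 * (2 powr (real k * (4 * (real i - s))) * 2 powr real k)"
    by (simp add: powr_realpow)
  also have "2 powr (real k * (4 * (real i - s))) * 2 powr real k = 2 powr (real k * (4 * (real i - s) + 1))"
    by (simp add: powr_add[symmetric] algebra_simps)
  finally show ?thesis .
qed

lemma LP_block_R:
  assumes s: "s > 1/2"
  shows "LP_block k (R s) = gk s k 0"
proof
  fix x
  have img: "(\<lambda>n. int (n\<^sup>2)) ` sqblock k \<subseteq> dyadic_block k"
  proof
    fix l assume "l \<in> (\<lambda>n. int (n\<^sup>2)) ` sqblock k"
    then obtain n where n: "n \<in> sqblock k" "l = int (n\<^sup>2)" by auto
    have a: "n\<^sup>2 < 2^k" "2^k \<le> 2 * n\<^sup>2" using n by (auto simp: sqblock_def)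
    have k: "k \<noteq> 0" using a by (auto intro!: Nat.gr0I)
    have "2 ^ (k - 1) \<le> n\<^sup>2" using a k by (cases k) auto
    then have "2 ^ (k - 1) \<le> int (n\<^sup>2)" "int (n\<^sup>2) < 2^k" using a
      by (metis of_nat_le_iff of_nat_numeral of_nat_power, metis a(1) of_nat_less_iff of_nat_numeral of_nat_power)
    then show "l \<in> dyadic_block k" using k n by (simp add: dyadic_block_def)
  qed
  have fin: "finite (dyadic_block k)"
    by (rule finite_subset[of _ "{- (2^k)..2^k}"]) (auto simp: dyadic_block_def)
  have zero: "fourier_coeff (R s) l * e l x = 0" if l: "l \<in> dyadic_block k - (\<lambda>n. int (n\<^sup>2)) ` sqblock k" for l
  proof -
    have "l \<noteq> int (n\<^sup>2)" if n: "n > 0" for n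
    proof
      assume e: "l = int (n\<^sup>2)"
      have "k \<noteq> 0" using l e n by (auto simp: dyadic_block_def)
      then have b: "2 ^ (k - 1) \<le> int (n\<^sup>2)" "int (n\<^sup>2) < 2^k" using l e by (auto simp: dyadic_block_def)
      have "2 ^ (k - 1) \<le> n\<^sup>2" using b(1) by (metis of_nat_le_iff of_nat_numeral of_nat_power)
      then have "2^k \<le> 2 * n\<^sup>2" using \<open>k \<noteq> 0\<close> by (cases k) auto
      moreover have "n\<^sup>2 < 2^k" using b(2) by (metis of_nat_less_iff of_nat_numeral of_nat_power)
      ultimately show False using l e by (auto simp: sqblock_def)
    qed
    then show ?thesis using fourier_coeff_R_nonsquare[OF s] by simp
  qed
  have "LP_block k (R s) x = (\<Sum>l\<in>(\<lambda>n. int (n\<^sup>2)) ` sqblock k. fourier_coeff (R s) l * e l x)"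
    unfolding LP_block_def by (rule sum.mono_neutral_right[OF fin img]) (use zero in auto)
  also have "\<dots> = (\<Sum>n\<in>sqblock k. fourier_coeff (R s) (int (n\<^sup>2)) * e (int (n\<^sup>2)) x)"
    by (subst sum.reindex) (auto simp: inj_on_def power2_eq_iff_nonneg simp del: of_nat_power)
  also have "\<dots> = gk s k 0 x"
    unfolding gk_def sqsum_def
    by (rule sum.cong) (auto simp: fourier_coeff_R_square[OF s sqblock_pos] coef_def e_def simp del: of_nat_power)
  finally show "LP_block k (R s) x = gk s k 0 x" .
qed

lemma sqblock_card_ge:
  assumes k: "k \<ge> 6"
  shows "real (card (sqblock k)) \<ge> 2 powr (real k / 2) / 8"
proof -
  define y where "y = 2 powr (real k / 2)"
  have y2: "y\<^sup>2 = 2^k" unfolding y_def by (simp add: power2_eq_square powr_add[symmetric] powr_realpow)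
  have y8: "y \<ge> 8"
  proof -
    have "2 powr 3 \<le> y" unfolding y_def using k by (intro powr_mono) auto
    then show ?thesis by (simp add: powr_numeral)
  qed
  \<comment> \<open>As 3/4 exceeds 1/sqrt 2, the integers in [3y/4, y) all belong to the block.
    Rounding loses at most 1 from the length y/4, and y >= 8, which is where k >= 6 enters, leaves
    y/8.\<close>
  define a where "a = nat \<lceil>3/4 * y\<rceil>"
  define b where "b = nat \<lceil>y\<rceil>"
  have a: "3/4 * y \<le> real a" "real a < 3/4 * y + 1" unfolding a_def using y8 by linarith+
  have b: "y \<le> real b" "real b < y + 1" unfolding b_def using y8 by linarith+
  have "{a..<b} \<subseteq> sqblock k"
  proof
    fix n assume n: "n \<in> {a..<b}"
    have n1: "3/4 * y \<le> real n" using a n by (auto intro: order_trans)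
    have n2: "real n < y"
    proof -
      have "real n + 1 \<le> real b" using n by auto
      then show ?thesis using b by linarith
    qed
    have "(3/4 * y)\<^sup>2 \<le> (real n)\<^sup>2" using n1 y8 by (intro power_mono) auto
    then have "9 * 2^k \<le> (real n)\<^sup>2 * 16" using y2 by (simp add: power_mult_distrib power_divide)
    moreover have "(0::real) \<le> 2^k" by simp
    ultimately have "2^k \<le> 2 * (real n)\<^sup>2" by linarith
    then have "real (2^k) \<le> real (2 * n\<^sup>2)" by (simp only: of_nat_mult of_nat_power of_nat_numeral)
    then have 1: "2^k \<le> 2 * n\<^sup>2" by (simp only: of_nat_le_iff)
    have "(real n)\<^sup>2 < y\<^sup>2" using n2 by (intro power_strict_mono) auto
    then have "n\<^sup>2 < 2^k" unfolding y2 by (metis of_nat_less_iff of_nat_numeral of_nat_power)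
    then show "n \<in> sqblock k" using 1 by (simp add: sqblock_def)
  qed
  then have "card {a..<b} \<le> card (sqblock k)" by (intro card_mono) auto
  then have "real b - real a \<le> real (card (sqblock k))" by simp
  then show ?thesis using a b y8 unfolding y_def[symmetric] by linarith
qed

lemma sqblock_powr_ge:
  assumes "n \<in> sqblock k" "s > 0"
  shows "real n powr (- 2 * s) \<ge> 2 powr (- (real k * s))"
proof -
  have "2 powr (- (real k * s)) = (2^k) powr (- s)" by (simp add: powr_realpow[symmetric] powr_powr)
  also have "\<dots> \<le> ((real n)\<^sup>2) powr (- s)"
    using sqblock_bounds(1)[OF assms(1)] sqblock_pos[OF assms(1)] assms(2) by (intro powr_mono2') auto
  also have "\<dots> = real n powr (- 2 * s)"
    using square_powr[of "real n" "- s"] sqblock_pos[OF assms(1)] by simp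
  finally show ?thesis .
qed

subsection \<open>The scaling function\<close>

lemma square_powr_half: "x > 0 \<Longrightarrow> (x\<^sup>2) powr (y / 2) = x powr y" for x y :: real
  using square_powr[of x "y / 2"] by (simp del: powr_half_sqrt_powr)

lemma poly_exp_bounded:
  assumes "\<epsilon> > 0"
  shows "\<exists>C. \<forall>k::nat. (real k + 3)^m * 2 powr (- (\<epsilon> * real k)) \<le> C"
proof -
  have "(\<lambda>k::nat. (real k + 3)^m * 2 powr (- (\<epsilon> * real k))) \<longlonglongrightarrow> 0"
    using assms by real_asymp
  then have "Bseq (\<lambda>k::nat. (real k + 3)^m * 2 powr (- (\<epsilon> * real k)))"
    using convergent_imp_Bseq convergentI by blast
  then obtain K where "\<And>k. norm ((real k + 3)^m * 2 powr (- (\<epsilon> * real k))) \<le> K" unfolding Bseq_def by blast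
  then have "\<forall>k. (real k + 3)^m * 2 powr (- (\<epsilon> * real k)) \<le> K" by (auto simp: abs_le_iff)
  then show ?thesis by blast
qed

lemma exp_le_poly_imp:
  assumes c: "c > 0" and le: "\<And>k::nat. k \<ge> k0 \<Longrightarrow> c * 2 powr (real k * \<delta>) \<le> C * (real k + 3) powr m"
  shows "\<delta> \<le> 0"
proof (rule ccontr)
  assume "\<not> \<delta> \<le> 0"
  then have d: "\<delta> > 0" by simp
  have "filterlim (\<lambda>k::nat. 2 powr (real k * \<delta>) / (real k + 3) powr m) at_top sequentially"
    using d by real_asymp
  then have "eventually (\<lambda>k. 2 powr (real k * \<delta>) / (real k + 3) powr m > C / c) sequentially"
    by (simp add: filterlim_at_top_dense)
  then obtain k1 where k1: "\<And>k. k \<ge> k1 \<Longrightarrow> 2 powr (real k * \<delta>) / (real k + 3) powr m > C / c"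
    by (auto simp: eventually_sequentially)
  define k where "k = max k0 k1"
  have "C / c < 2 powr (real k * \<delta>) / (real k + 3) powr m" using k1[of k] k_def by simp
  then have "C * (real k + 3) powr m < c * 2 powr (real k * \<delta>)" using c by (simp add: field_simps)
  then show False using le[of k] k_def by simp
qed

lemma continuous_on_gk [continuous_intros]: "continuous_on S (gk s k i)"
  unfolding gk_def by (intro continuous_intros)

lemma continuous_on_gk_powr: "p > 0 \<Longrightarrow> continuous_on S (\<lambda>x. cmod (gk s k i x) powr p)"
  by (intro continuous_on_powr' continuous_intros) auto

lemma integrable_gk_powr: "p > 0 \<Longrightarrow> (\<lambda>x. cmod (gk s k i x) powr p) integrable_on {a..b}"
  by (intro integrable_continuous_real continuous_on_gk_powr)

lemma integrable_gk_power: "(\<lambda>x. cmod (gk s k i x) ^ p) integrable_on {a..b}"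
  by (intro integrable_continuous_real continuous_intros)

lemma gk_Lp_nonneg: "integral {0..1} (\<lambda>x. cmod (gk s k 0 x) powr p) \<ge> 0" if "p > 0"
  by (rule integral_nonneg[OF integrable_gk_powr[OF that]]) auto

text \<open>The normalisation \<sigma>/p in the definition of \<open>eta\<close> makes the condition
  linear in the p-th moment: taking p-th powers removes the outer exponent 1/p.\<close>

lemma besov_R_iff:
  assumes s: "s > 1/2" and p: "p > 0"
  shows "besov_inf (\<sigma> / p) p (R s) \<longleftrightarrow>
    (\<exists>C. \<forall>k. 2 powr (real k * \<sigma>) * integral {0..1} (\<lambda>x. cmod (gk s k 0 x) powr p) \<le> C)"
proof -
  define I where "I = (\<lambda>k. integral {0..1} (\<lambda>x. cmod (gk s k 0 x) powr p))"
  have I0: "I k \<ge> 0" for k unfolding I_def by (rule gk_Lp_nonneg[OF p])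
  have eq: "2 powr (real k * (\<sigma> / p)) * Lp_norm_T p (LP_block k (R s)) = (2 powr (real k * \<sigma>) * I k) powr (1 / p)" for k
    unfolding Lp_norm_T_def LP_block_R[OF s] using I0[of k] by (simp add: powr_mult powr_powr I_def)
  have "(\<exists>C. \<forall>k. (2 powr (real k * \<sigma>) * I k) powr (1 / p) \<le> C) \<longleftrightarrow> (\<exists>C. \<forall>k. 2 powr (real k * \<sigma>) * I k \<le> C)"
  proof
    assume "\<exists>C. \<forall>k. (2 powr (real k * \<sigma>) * I k) powr (1 / p) \<le> C"
    then obtain C where C: "\<And>k. (2 powr (real k * \<sigma>) * I k) powr (1 / p) \<le> C" by blast
    have "2 powr (real k * \<sigma>) * I k \<le> C powr p" for k
    proof -
      have "2 powr (real k * \<sigma>) * I k = ((2 powr (real k * \<sigma>) * I k) powr (1 / p)) powr p"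
        using p I0 by (simp add: powr_powr)
      also have "\<dots> \<le> C powr p" using C p by (intro powr_mono2) auto
      finally show ?thesis .
    qed
    then show "\<exists>C. \<forall>k. 2 powr (real k * \<sigma>) * I k \<le> C" by blast
  next
    assume "\<exists>C. \<forall>k. 2 powr (real k * \<sigma>) * I k \<le> C"
    then obtain C where C: "\<And>k. 2 powr (real k * \<sigma>) * I k \<le> C" by blast
    have "(2 powr (real k * \<sigma>) * I k) powr (1 / p) \<le> C powr (1 / p)" for k
      using C p I0 by (intro powr_mono2) auto
    then show "\<exists>C. \<forall>k. (2 powr (real k * \<sigma>) * I k) powr (1 / p) \<le> C" by blast
  qed
  then show ?thesis unfolding besov_inf_def eq I_def .
qed

text \<open>The p-th power of |g| is at most the (p-4)-th power of the sup norm times |g|^4. The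
  polynomial factor in k costs an arbitrarily small \<epsilon>, harmless under a supremum.\<close>

lemma eta_ge:
  assumes s: "s > 1/2" and p: "p \<ge> 4"
  shows "eta s p \<ge> ereal (p * (s - 1/2) + 1)"
proof (rule ereal_le_epsilon2)
  fix \<epsilon> :: real assume e: "0 < \<epsilon>"
  define \<sigma> where "\<sigma> = p * (s - 1/2) + 1 - \<epsilon>"
  define A where "A = (2 powr s) powr (p - 4) * (9 * (2 powr s)^4)"
  obtain C where C: "\<And>k. (real k + 3)^2 * 2 powr (- (\<epsilon> * real k)) \<le> C" using poly_exp_bounded[OF e] by blast
  have "2 powr (real k * \<sigma>) * integral {0..1} (\<lambda>x. cmod (gk s k 0 x) powr p) \<le> A * C" for k
  proof -
    define S where "S = 2 powr s * 2 powr (- (real k * (s - 1/2)))"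
    have S: "cmod (gk s k 0 x) \<le> S" for x using norm_gk_le[of s k 0 x] s unfolding S_def by (simp add: algebra_simps)
    have "integral {0..1} (\<lambda>x. cmod (gk s k 0 x) powr p) \<le> integral {0..1} (\<lambda>x. S powr (p - 4) * cmod (gk s k 0 x) ^ 4)"
    proof (rule integral_le[OF integrable_gk_powr])
      show "(\<lambda>x. S powr (p - 4) * cmod (gk s k 0 x) ^ 4) integrable_on {0..1}"
        using integrable_on_cmult_left[OF integrable_gk_power] by simp
      fix x assume "x \<in> {0..1::real}"
      show "cmod (gk s k 0 x) powr p \<le> S powr (p - 4) * cmod (gk s k 0 x) ^ 4"
      proof (cases "gk s k 0 x = 0")
        case False
        have "cmod (gk s k 0 x) powr p = cmod (gk s k 0 x) powr (p - 4) * cmod (gk s k 0 x) powr 4"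
          by (simp only: powr_add[symmetric]) simp
        also have "cmod (gk s k 0 x) powr 4 = cmod (gk s k 0 x) ^ 4" using False by simp
        finally show ?thesis using S[of x] p by (simp add: mult_right_mono powr_mono2)
      qed (use p in simp)
    qed (use p in simp)
    also have "\<dots> = S powr (p - 4) * integral {0..0+1} (\<lambda>x. cmod (gk s k 0 x) ^ 4)" by simp
    also have "\<dots> \<le> S powr (p - 4) * (9 * (2 powr s)^4 * (real k + 3)\<^sup>2 * 2 powr (real k * (1 - 4 * s)))"
      using gk_L4[of s 0 k 0] s by (intro mult_left_mono) auto
    also have "S powr (p - 4) = (2 powr s) powr (p - 4) * 2 powr (- (real k * (s - 1/2) * (p - 4)))"
      unfolding S_def by (simp add: powr_mult powr_powr)
    finally have "2 powr (real k * \<sigma>) * integral {0..1} (\<lambda>x. cmod (gk s k 0 x) powr p)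
       \<le> 2 powr (real k * \<sigma>) * ((2 powr s) powr (p - 4) * 2 powr (- (real k * (s - 1/2) * (p - 4))) * (9 * (2 powr s)^4 * (real k + 3)\<^sup>2 * 2 powr (real k * (1 - 4 * s))))"
      by (intro mult_left_mono) auto
    also have "\<dots> = A * ((real k + 3)\<^sup>2 * (2 powr (real k * \<sigma>) * 2 powr (- (real k * (s - 1/2) * (p - 4))) * 2 powr (real k * (1 - 4 * s))))"
      unfolding A_def by (simp only: mult_ac)
    also have "2 powr (real k * \<sigma>) * 2 powr (- (real k * (s - 1/2) * (p - 4))) * 2 powr (real k * (1 - 4 * s)) = 2 powr (- (\<epsilon> * real k))"
      unfolding \<sigma>_def powr_add[symmetric] by (rule arg_cong[of _ _ "(powr) 2"]) (simp add: field_simps)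
    also have "A * ((real k + 3)\<^sup>2 * 2 powr (- (\<epsilon> * real k))) \<le> A * C"
      using C by (intro mult_left_mono) (auto simp: A_def)
    finally show ?thesis .
  qed
  then have "besov_inf (\<sigma> / p) p (R s)" using besov_R_iff[OF s, of p \<sigma>] p by auto
  then have "ereal \<sigma> \<le> eta s p" unfolding eta_def by (intro Sup_upper) auto
  then have "ereal \<sigma> + ereal \<epsilon> \<le> eta s p + ereal \<epsilon>" by (intro add_mono) auto
  then show "ereal (p * (s - 1/2) + 1) \<le> eta s p + ereal \<epsilon>" by (simp add: \<sigma>_def)
qed

text \<open>Lower bounds on moments exclude large \<sigma>. A factor (k+3)^m with real m, possibly
  negative, is tolerated because below p = 2 the lower bound loses logarithms from the fourth
  moment.\<close>

lemma eta_leI: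
  assumes s: "s > 1/2" and p: "p > 0" and c: "c > 0"
    and le: "\<And>k. k \<ge> 6 \<Longrightarrow> integral {0..1} (\<lambda>x. cmod (gk s k 0 x) powr p) \<ge> c * (real k + 3) powr m * 2 powr (- (real k * \<sigma>0))"
  shows "eta s p \<le> ereal \<sigma>0"
  unfolding eta_def
proof (rule Sup_least, clarify)
  fix \<sigma> assume "besov_inf (\<sigma> / p) p (R s)"
  then obtain C where C: "\<And>k. 2 powr (real k * \<sigma>) * integral {0..1} (\<lambda>x. cmod (gk s k 0 x) powr p) \<le> C"
    using besov_R_iff[OF s p] by blast
  have "\<sigma> - \<sigma>0 \<le> 0"
  proof (rule exp_le_poly_imp[OF c])
    fix k :: nat assume k: "k \<ge> 6"
    have "2 powr (real k * \<sigma>) * (c * (real k + 3) powr m * 2 powr (- (real k * \<sigma>0))) \<le> C"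
      by (rule order_trans[OF mult_left_mono[OF le[OF k]] C]) auto
    moreover have "2 powr (real k * (\<sigma> - \<sigma>0)) = 2 powr (real k * \<sigma>) * 2 powr (- (real k * \<sigma>0))"
      by (simp add: powr_add[symmetric] algebra_simps)
    ultimately have "c * 2 powr (real k * (\<sigma> - \<sigma>0)) * (real k + 3) powr m \<le> C"
      by (simp add: mult_ac)
    then have "c * 2 powr (real k * (\<sigma> - \<sigma>0)) * ((real k + 3) powr m * (real k + 3) powr (- m)) \<le> C * (real k + 3) powr (- m)"
      using mult_right_mono[of _ C "(real k + 3) powr (- m)"] by (simp add: mult_ac)
    also have "(real k + 3) powr m * (real k + 3) powr (- m) = 1" by (simp add: powr_minus)
    finally show "c * 2 powr (real k * (\<sigma> - \<sigma>0)) \<le> C * (real k + 3) powr (- m)" by simp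
  qed
  then show "ereal \<sigma> \<le> ereal \<sigma>0" by simp
qed

lemma eta_le_near_zero:
  assumes s: "s > 1/2" and p: "p > 0"
  shows "eta s p \<le> ereal (p * (s - 1/2) + 1)"
proof (rule eta_leI[OF s p, where c = "(1/6) * (1/16) powr p" and m = 0])
  fix k :: nat assume k: "k \<ge> 6"
  \<comment> \<open>For x <= 2^(-k)/6 every phase of the block lies in [0, pi/3], where the cosine
    is at least 1/2, so nothing cancels. The 16 is this 2 times the 8 of
    \<open>sqblock_card_ge\<close>.\<close>
  define L where "L = 2 powr (- (real k * (s - 1/2))) / 16"
  define d where "d = 2 powr (- real k) / 6"
  have d: "0 < d" "d \<le> 1" unfolding d_def using powr_mono[of "- real k" 0 2] by auto
  have low: "cmod (gk s k 0 x) \<ge> L" if x: "x \<in> {0..d}" for x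
  proof -
    have "L = 2 powr (real k / 2) / 8 * (2 powr (- (real k * s)) * (1/2))"
      unfolding L_def by (simp add: powr_add[symmetric] algebra_simps)
    also have "\<dots> \<le> real (card (sqblock k)) * (2 powr (- (real k * s)) * (1/2))"
      by (intro mult_right_mono sqblock_card_ge k) auto
    also have "\<dots> = (\<Sum>n\<in>sqblock k. 2 powr (- (real k * s)) * (1/2))" by simp
    also have "\<dots> \<le> (\<Sum>n\<in>sqblock k. real n powr (- 2 * s) * cos (2 * pi * real (n\<^sup>2) * x))"
    proof (intro sum_mono mult_mono)
      fix n assume n: "n \<in> sqblock k"
      show "2 powr (- (real k * s)) \<le> real n powr (- 2 * s)" using sqblock_powr_ge[OF n] s by simp
      have "real (n\<^sup>2) * x \<le> 2^k * d" using sqblock_bounds(1)[OF n] x by (intro mult_mono) auto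
      also have "\<dots> = 1/6" by (simp add: d_def powr_minus powr_realpow)
      finally have "2 * pi * (real (n\<^sup>2) * x) \<le> 2 * pi * (1/6)" by (intro mult_left_mono) auto
      then have "2 * pi * real (n\<^sup>2) * x \<le> pi / 3" by (simp add: mult.assoc)
      then have "cos (pi / 3) \<le> cos (2 * pi * real (n\<^sup>2) * x)"
        using x by (intro cos_monotone_0_pi_le) auto
      then show "1/2 \<le> cos (2 * pi * real (n\<^sup>2) * x)" by (simp add: cos_60)
    qed auto
    also have "\<dots> = Re (gk s k 0 x)" by (simp add: gk_def sqsum_def coef_def)
    also have "\<dots> \<le> cmod (gk s k 0 x)" by (rule complex_Re_le_cmod)
    finally show ?thesis .
  qed
  have L0: "L > 0" by (simp add: L_def)
  have "d * L powr p = integral {0..d} (\<lambda>x. L powr p)" using d by simp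
  also have "\<dots> \<le> integral {0..d} (\<lambda>x. cmod (gk s k 0 x) powr p)"
    by (intro integral_le integrable_gk_powr p powr_mono2) (use low L0 p in auto)
  also have "\<dots> \<le> integral {0..1} (\<lambda>x. cmod (gk s k 0 x) powr p)"
    by (intro integral_subset_le integrable_gk_powr p) (use d in auto)
  finally have "d * L powr p \<le> integral {0..1} (\<lambda>x. cmod (gk s k 0 x) powr p)" .
  moreover have "d * L powr p = 1/6 * (1/16) powr p * (real k + 3) powr 0 * 2 powr (- (real k * (p * (s - 1/2) + 1)))"
  proof -
    have "L powr p = 2 powr (- (real k * (s - 1/2)) * p) * (1/16) powr p"
      unfolding L_def using powr_mult[of "2 powr (- (real k * (s - 1/2)))" "1/16" p] by (simp add: powr_powr)
    moreover have "2 powr (- (real k * (p * (s - 1/2) + 1))) = 2 powr (- real k) * 2 powr (- (real k * (s - 1/2)) * p)"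
      by (simp only: powr_add[symmetric]) (simp add: algebra_simps)
    ultimately show ?thesis unfolding d_def by simp
  qed
  ultimately show "1/6 * (1/16) powr p * (real k + 3) powr 0 * 2 powr (- (real k * (p * (s - 1/2) + 1)))
     \<le> integral {0..1} (\<lambda>x. cmod (gk s k 0 x) powr p)" by simp
qed simp

lemma gk_L2_ge:
  assumes s: "s > 0" and k: "k \<ge> 6"
  shows "integral {0..1} (\<lambda>x. (cmod (gk s k 0 x))\<^sup>2) \<ge> 2 powr (real k * (1/2 - 2 * s)) / 8"
proof -
  have "integral {0..0+1} (\<lambda>x. (cmod (gk s k 0 x))\<^sup>2) = (\<Sum>n\<in>sqblock k. (cmod (coef s 0 n))\<^sup>2)"
    unfolding gk_def by (rule integral_unique, rule sqsum_L2) simp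
  also have "\<dots> = (\<Sum>n\<in>sqblock k. (real n powr (- 2 * s))\<^sup>2)" by (simp add: coef_def)
  also have "\<dots> \<ge> (\<Sum>n\<in>sqblock k. (2 powr (- (real k * s)))\<^sup>2)"
    by (intro sum_mono power_mono sqblock_powr_ge s) auto
  also have "(\<Sum>n\<in>sqblock k. (2 powr (- (real k * s)))\<^sup>2) = real (card (sqblock k)) * (2 powr (- (real k * s)))\<^sup>2" by simp
  also have "real (card (sqblock k)) * (2 powr (- (real k * s)))\<^sup>2 \<ge> 2 powr (real k / 2) / 8 * (2 powr (- (real k * s)))\<^sup>2"
    by (intro mult_right_mono sqblock_card_ge k) auto
  also have "2 powr (real k / 2) / 8 * (2 powr (- (real k * s)))\<^sup>2 = 2 powr (real k * (1/2 - 2 * s)) / 8"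
    by (simp add: powr_power powr_add[symmetric] algebra_simps)
  finally show ?thesis by simp
qed

text \<open>For p < 2 a lower bound on the p-th moment must come from above: the fourth moment shows
  that the L^2 mass does not sit on large values, and on the remaining values |g|^2 is controlled by
  |g|^p.\<close>

lemma eta_le_small_p:
  assumes s: "s > 1/2" and p: "p > 0" "p \<le> 2"
  shows "eta s p \<le> ereal (p * (s - 1/4))"
proof -
  define A where "A = 9 * (2 powr s)^4"
  have A: "A > 0" by (simp add: A_def)
  define B where "B = 16 * A"
  have B: "B > 0" using A by (simp add: B_def)
  show ?thesis
  proof (rule eta_leI[OF s p(1), where c = "B powr ((p - 2) / 2) / 16" and m = "p - 2"])
    fix k :: nat assume k: "k \<ge> 6"
    define w where "w = 2 powr (real k * (1/2 - 2 * s))"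
    have w: "w > 0" by (simp add: w_def)
    \<comment> \<open>The cutoff for |g|^2: it makes the fourth moment divided by \<open>l2\<close>
      at most w/16, half of the available L^2 mass w/8.\<close>
    define l2 where "l2 = B * (real k + 3)\<^sup>2 * w"
    have l2: "l2 > 0" using B w by (simp add: l2_def)
    have pw: "u\<^sup>2 \<le> l2 powr ((2 - p) / 2) * u powr p + u^4 / l2" if u: "u \<ge> 0" for u :: real
    proof (cases "u\<^sup>2 \<le> l2")
      case True
      show ?thesis
      proof (cases "u = 0")
        case False
        then have u0: "u > 0" using u by simp
        have "u\<^sup>2 = u powr (2 - p) * u powr p" using u0 by (simp add: powr_add[symmetric])
        also have "u powr (2 - p) = (u\<^sup>2) powr ((2 - p) / 2)" using square_powr_half[OF u0, of "2 - p"] by simp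
        also have "(u\<^sup>2) powr ((2 - p) / 2) * u powr p \<le> l2 powr ((2 - p) / 2) * u powr p"
          using True p by (intro mult_right_mono powr_mono2) auto
        finally show ?thesis using l2 by (simp add: add_increasing2)
      qed (use l2 in simp)
    next
      case False
      have "u\<^sup>2 * l2 \<le> u\<^sup>2 * u\<^sup>2" using False by (intro mult_left_mono) auto
      then have "u\<^sup>2 \<le> u^4 / l2" using l2 by (simp add: field_simps eval_nat_numeral)
      then show ?thesis by (simp add: add_increasing)
    qed
    define I where "I = integral {0..1} (\<lambda>x. cmod (gk s k 0 x) powr p)"
    have "w / 8 \<le> integral {0..1} (\<lambda>x. (cmod (gk s k 0 x))\<^sup>2)"
      unfolding w_def using gk_L2_ge[of s k] s k by simp
    also have "\<dots> \<le> integral {0..1} (\<lambda>x. l2 powr ((2 - p) / 2) * cmod (gk s k 0 x) powr p + cmod (gk s k 0 x) ^ 4 / l2)"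
    proof (rule integral_le[OF integrable_gk_power])
      show "(\<lambda>x. l2 powr ((2 - p) / 2) * cmod (gk s k 0 x) powr p + cmod (gk s k 0 x) ^ 4 / l2) integrable_on {0..1}"
        using p l2 by (intro integrable_continuous_real continuous_intros continuous_on_gk_powr) auto
    qed (use pw in auto)
    also have "\<dots> = l2 powr ((2 - p) / 2) * I + integral {0..1} (\<lambda>x. cmod (gk s k 0 x) ^ 4) / l2"
    proof -
      have "integral {0..1} (\<lambda>x. l2 powr ((2 - p) / 2) * cmod (gk s k 0 x) powr p + cmod (gk s k 0 x) ^ 4 / l2)
        = integral {0..1} (\<lambda>x. l2 powr ((2 - p) / 2) * cmod (gk s k 0 x) powr p) + integral {0..1} (\<lambda>x. cmod (gk s k 0 x) ^ 4 / l2)"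
        by (rule integral_add) (use p l2 in \<open>auto intro!: integrable_continuous_real continuous_intros continuous_on_gk_powr\<close>)
      then show ?thesis unfolding I_def by simp
    qed
    also have "integral {0..1} (\<lambda>x. cmod (gk s k 0 x) ^ 4) / l2 \<le> w / 16"
    proof -
      have "integral {0..1} (\<lambda>x. cmod (gk s k 0 x) ^ 4) \<le> A * (real k + 3)\<^sup>2 * 2 powr (real k * (1 - 4 * s))"
        using gk_L4[of s 0 k 0] s by (simp add: A_def)
      also have "2 powr (real k * (1 - 4 * s)) = w * w"
        unfolding w_def by (simp add: powr_add[symmetric] algebra_simps)
      also have "A * (real k + 3)\<^sup>2 * (w * w) = w / 16 * l2" by (simp add: l2_def B_def)
      finally show ?thesis using l2 by (simp add: divide_le_eq)
    qed
    finally have "w / 16 \<le> l2 powr ((2 - p) / 2) * I" by simp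
    then have "l2 powr ((p - 2) / 2) * (w / 16) \<le> l2 powr ((p - 2) / 2) * (l2 powr ((2 - p) / 2) * I)"
      by (intro mult_left_mono) auto
    also have "\<dots> = I"
    proof -
      have "l2 powr ((p - 2) / 2) * l2 powr ((2 - p) / 2) = l2 powr 0"
        by (simp only: powr_add[symmetric]) (simp add: field_simps)
      then show ?thesis using l2 by (simp add: mult.assoc[symmetric])
    qed
    finally have fin: "l2 powr ((p - 2) / 2) * (w / 16) \<le> I" .
    have sq: "((real k + 3)\<^sup>2) powr ((p - 2) / 2) = (real k + 3) powr (p - 2)"
      by (rule square_powr_half) simp
    have L: "l2 powr ((p - 2) / 2) = B powr ((p - 2) / 2) * (real k + 3) powr (p - 2) * w powr ((p - 2) / 2)"
      unfolding l2_def using B w by (simp add: powr_mult sq)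
    have W: "w powr ((p - 2) / 2) * w = 2 powr (- (real k * (p * (s - 1/4))))"
      unfolding w_def powr_powr powr_add[symmetric] by (rule arg_cong[of _ _ "(powr) 2"]) (simp add: field_simps)
    have "B powr ((p - 2) / 2) / 16 * (real k + 3) powr (p - 2) * 2 powr (- (real k * (p * (s - 1/4)))) = l2 powr ((p - 2) / 2) * (w / 16)"
      unfolding L W[symmetric] by (simp add: mult_ac)
    then show "B powr ((p - 2) / 2) / 16 * (real k + 3) powr (p - 2) * 2 powr (- (real k * (p * (s - 1/4)))) \<le> I"
      using fin by simp
  qed (use B in simp)
qed

lemma eta_le_mid_p:
  assumes s: "s > 1/2" and p: "p \<ge> 2"
  shows "eta s p \<le> ereal (p * (s - 1/4))"
proof (rule eta_leI[OF s, where c = "(1/16) powr (p / 2)" and m = 0])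
  fix k :: nat assume k: "k \<ge> 6"
  \<comment> \<open>Half of the lower bound for the L^2 mass. Values with |g|^2 <= w carry at most
    this half, so the other half is seen by the p-th moment; this is the comparison of L^2 with L^p
    in pointwise form.\<close>
  define w where "w = 2 powr (real k * (1/2 - 2 * s)) / 16"
  have w: "w > 0" by (simp add: w_def)
  have pw: "u\<^sup>2 \<le> w + w powr ((2 - p) / 2) * u powr p" if u: "u \<ge> 0" for u :: real
  proof (cases "u\<^sup>2 \<le> w")
    case True
    then show ?thesis by (simp add: add_increasing2)
  next
    case False
    then have u0: "u > 0" using u w by (cases "u = 0") auto
    have "u\<^sup>2 = u powr (2 - p) * u powr p" using u0 by (simp add: powr_add[symmetric])
    also have "u powr (2 - p) = (u\<^sup>2) powr ((2 - p) / 2)" using square_powr_half[OF u0, of "2 - p"] by simp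
    also have "(u\<^sup>2) powr ((2 - p) / 2) * u powr p \<le> w powr ((2 - p) / 2) * u powr p"
      using False p w by (intro mult_right_mono powr_mono2') auto
    finally show ?thesis using w by simp
  qed
  define I where "I = integral {0..1} (\<lambda>x. cmod (gk s k 0 x) powr p)"
  have "2 * w \<le> integral {0..1} (\<lambda>x. (cmod (gk s k 0 x))\<^sup>2)"
    unfolding w_def using gk_L2_ge[of s k] s k by simp
  also have "\<dots> \<le> integral {0..1} (\<lambda>x. w + w powr ((2 - p) / 2) * cmod (gk s k 0 x) powr p)"
  proof (rule integral_le[OF integrable_gk_power])
    show "(\<lambda>x. w + w powr ((2 - p) / 2) * cmod (gk s k 0 x) powr p) integrable_on {0..1}"
      using p by (intro integrable_continuous_real continuous_intros continuous_on_gk_powr) auto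
  qed (use pw in auto)
  also have "\<dots> = w + w powr ((2 - p) / 2) * I"
  proof -
    have "integral {0..1} (\<lambda>x. w + w powr ((2 - p) / 2) * cmod (gk s k 0 x) powr p)
      = integral {0..1} (\<lambda>x::real. w) + integral {0..1} (\<lambda>x. w powr ((2 - p) / 2) * cmod (gk s k 0 x) powr p)"
      by (rule integral_add) (use p in \<open>auto intro!: integrable_continuous_real continuous_intros continuous_on_gk_powr\<close>)
    then show ?thesis unfolding I_def by simp
  qed
  finally have "w \<le> w powr ((2 - p) / 2) * I" by simp
  then have "w powr ((p - 2) / 2) * w \<le> w powr ((p - 2) / 2) * (w powr ((2 - p) / 2) * I)"
    by (intro mult_left_mono) auto
  also have "\<dots> = I"
  proof -
    have "w powr ((p - 2) / 2) * w powr ((2 - p) / 2) = w powr 0"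
      by (simp only: powr_add[symmetric]) (simp add: field_simps)
    then show ?thesis using w by (simp add: mult.assoc[symmetric])
  qed
  also have "w powr ((p - 2) / 2) * w = w powr (p / 2)"
    using w powr_add[of w "(p - 2) / 2" 1] by (simp add: field_simps)
  finally have "w powr (p / 2) \<le> I" .
  moreover have "w powr (p / 2) = (1/16) powr (p / 2) * 2 powr (- (real k * (p * (s - 1/4))))"
  proof -
    have "w powr (p / 2) = (1/16) powr (p / 2) * 2 powr (real k * (1/2 - 2 * s) * (p / 2))"
      unfolding w_def using powr_mult[of "1/16" "2 powr (real k * (1/2 - 2 * s))" "p/2"] by (simp add: powr_powr)
    also have "real k * (1/2 - 2 * s) * (p / 2) = - (real k * (p * (s - 1/4)))" by (simp add: field_simps)
    finally show ?thesis .
  qed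
  ultimately show "(1/16) powr (p / 2) * (real k + 3) powr 0 * 2 powr (- (real k * (p * (s - 1/4)))) \<le> I" by simp
qed (use p in auto)

text \<open>The bounds for \<eta> make the expression lie above a line of slope \<alpha>-s+1/4 <= 0
  on (0,4] and equal to a line of slope \<alpha>-s+1/2 on [4,\<infinity>). Both give 4\<alpha>-4s+2
  at p = 4, and below s-1/2 the second slope is negative, so letting p grow yields
  -\<infinity>.\<close>

lemma legendre_transform_eta:
  assumes s: "s > 1/2" and a: "\<alpha> \<le> s - 1/4"
  shows "(INF p \<in> {0<..}. ereal (\<alpha> * p) - eta s p + 1) = (if \<alpha> < s - 1/2 then - \<infinity> else ereal (4 * \<alpha> - 4 * s + 2))"
proof -
  have up: "(INF p \<in> {0<..}. ereal (\<alpha> * p) - eta s p + 1) \<le> ereal ((\<alpha> - s + 1/2) * p)" if p: "p \<ge> 4" for p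
  proof -
    have "(INF p \<in> {0<..}. ereal (\<alpha> * p) - eta s p + 1) \<le> ereal (\<alpha> * p) - eta s p + 1"
      by (rule INF_lower) (use p in auto)
    also have "\<dots> \<le> ereal (\<alpha> * p) - ereal (p * (s - 1/2) + 1) + 1"
      by (intro add_mono ereal_minus_mono eta_ge s p) auto
    also have "\<dots> = ereal ((\<alpha> - s + 1/2) * p)" by (simp add: algebra_simps one_ereal_def)
    finally show ?thesis .
  qed
  show ?thesis
  proof (cases "\<alpha> < s - 1/2")
    case True
    have "(INF p \<in> {0<..}. ereal (\<alpha> * p) - eta s p + 1) = - \<infinity>"
    proof (rule ereal_bot)
      fix B :: real
      define d where "d = s - 1/2 - \<alpha>"
      have d: "d > 0" using True by (simp add: d_def)
      define p where "p = max 4 (\<bar>B\<bar> / d)"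
      have "\<bar>B\<bar> / d \<le> p" by (simp add: p_def)
      then have "\<bar>B\<bar> \<le> p * d" using d by (simp add: divide_le_eq)
      then have "(\<alpha> - s + 1/2) * p \<le> B" unfolding d_def by (simp add: algebra_simps)
      then have "ereal ((\<alpha> - s + 1/2) * p) \<le> ereal B" by simp
      then show "(INF p \<in> {0<..}. ereal (\<alpha> * p) - eta s p + 1) \<le> ereal B"
        using order_trans[OF up[of p]] by (simp add: p_def)
    qed
    then show ?thesis using True by simp
  next
    case False
    have "ereal (4 * \<alpha> - 4 * s + 2) \<le> ereal (\<alpha> * p) - eta s p + 1" if p: "p > 0" for p
    proof (cases "p \<le> 4")
      case True
      have "eta s p \<le> ereal (p * (s - 1/4))"
        using eta_le_small_p[OF s p] eta_le_mid_p[OF s, of p] by linarith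
      then have "ereal (\<alpha> * p) - ereal (p * (s - 1/4)) + 1 \<le> ereal (\<alpha> * p) - eta s p + 1"
        by (intro add_mono ereal_minus_mono) auto
      moreover have "(s - 1/4 - \<alpha>) * p \<le> (s - 1/4 - \<alpha>) * 4" using a True by (intro mult_left_mono) auto
      then have "ereal (4 * \<alpha> - 4 * s + 2) \<le> ereal (\<alpha> * p) - ereal (p * (s - 1/4)) + 1"
        by (simp add: one_ereal_def algebra_simps)
      ultimately show ?thesis by (rule order_trans[rotated])
    next
      case p4: False
      have "ereal (\<alpha> * p) - ereal (p * (s - 1/2) + 1) + 1 \<le> ereal (\<alpha> * p) - eta s p + 1"
        by (intro add_mono ereal_minus_mono eta_le_near_zero s p) auto
      moreover have "(\<alpha> - s + 1/2) * 4 \<le> (\<alpha> - s + 1/2) * p" using False p4 by (intro mult_left_mono) auto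
      then have "ereal (4 * \<alpha> - 4 * s + 2) \<le> ereal (\<alpha> * p) - ereal (p * (s - 1/2) + 1) + 1"
        by (simp add: one_ereal_def algebra_simps)
      ultimately show ?thesis by (rule order_trans[rotated])
    qed
    then have "ereal (4 * \<alpha> - 4 * s + 2) \<le> (INF p \<in> {0<..}. ereal (\<alpha> * p) - eta s p + 1)"
      by (intro INF_greatest) auto
    moreover have "(INF p \<in> {0<..}. ereal (\<alpha> * p) - eta s p + 1) \<le> ereal (4 * \<alpha> - 4 * s + 2)"
      using up[of 4] by (simp add: algebra_simps)
    ultimately show ?thesis using False by (simp add: antisym)
  qed
qed

subsection \<open>Regularity from block estimates\<close>

text \<open>The entire extension of \<open>gk\<close>, so that Taylor's theorem for complex
  functions can be applied along a real segment.\<close>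

definition gc :: "real \<Rightarrow> nat \<Rightarrow> nat \<Rightarrow> complex \<Rightarrow> complex" where
  "gc s k i z = (\<Sum>n\<in>sqblock k. coef s i n * exp (2 * pi * \<i> * of_nat (n\<^sup>2) * z))"

lemma gc_of_real: "gc s k i (of_real x) = gk s k i x"
  unfolding gc_def gk_def sqsum_def cis_conv_exp by (simp add: mult_ac)

lemma has_field_derivative_gc: "(gc s k i has_field_derivative gc s k (Suc i) z) (at z within S)"
proof -
  have "((\<lambda>z. \<Sum>n\<in>sqblock k. coef s i n * exp (2 * pi * \<i> * of_nat (n\<^sup>2) * z)) has_field_derivative
     (\<Sum>n\<in>sqblock k. coef s (Suc i) n * exp (2 * pi * \<i> * of_nat (n\<^sup>2) * z))) (at z within S)"
    by (rule DERIV_sum) (auto intro!: derivative_eq_intros simp: coef_def)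
  then show ?thesis unfolding gc_def[abs_def] .
qed

lemma has_vector_derivative_gk: "(gk s k i has_vector_derivative gk s k (Suc i) x) (at x within S)"
  using has_vector_derivative_real_field[OF has_field_derivative_gc[of s k i "of_real x" "UNIV"], of S]
  by (simp add: gc_of_real)

lemma sqblock_cover: "n > 0 \<Longrightarrow> \<exists>k. n \<in> sqblock k"
proof -
  assume n: "n > 0"
  define k where "k = (LEAST k. n\<^sup>2 < 2^k)"
  have ex: "n\<^sup>2 < 2^(n\<^sup>2)" by (rule less_exp)
  have 1: "n\<^sup>2 < 2^k" unfolding k_def by (rule LeastI[of _ "n\<^sup>2"]) (rule ex)
  have "k \<noteq> 0"
  proof
    assume "k = 0"
    then have "n\<^sup>2 < 1" using 1 by simp
    then show False using n by simp
  qed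
  then obtain j where j: "k = Suc j" using not0_implies_Suc by blast
  have "\<not> n\<^sup>2 < 2^j" unfolding not_less
  proof (rule ccontr)
    assume "\<not> 2^j \<le> n\<^sup>2"
    then have "k \<le> j" unfolding k_def by (intro Least_le) auto
    then show False using j by simp
  qed
  then have "n \<in> sqblock k" using 1 j by (simp add: sqblock_def)
  then show ?thesis by blast
qed

lemma sqblock_disjoint: "n \<in> sqblock k \<Longrightarrow> n \<in> sqblock l \<Longrightarrow> k = l"
proof -
  have le: "k \<le> l" if "n \<in> sqblock k" "n \<in> sqblock l" for k l
  proof (rule ccontr)
    assume "\<not> k \<le> l"
    then have "(2::nat)^Suc l \<le> 2^k" by (intro power_increasing) auto
    moreover have "2^k \<le> 2 * n\<^sup>2" "n\<^sup>2 < 2^l" using that by (auto simp: sqblock_def)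
    ultimately show False by simp
  qed
  assume "n \<in> sqblock k" "n \<in> sqblock l"
  then show "k = l" using le by (meson antisym)
qed

text \<open>Absolute convergence permits regrouping, since the blocks partition the positive
  integers.\<close>

lemma R_sums_gk:
  assumes s: "s > 1/2"
  shows "(\<lambda>k. gk s k 0 x) sums R s x"
proof -
  have "((\<lambda>n. rterm s (Suc n) x) has_sum R s x) UNIV"
    by (rule norm_summable_imp_has_sum) (use summable_rterm_norm[OF s] R_sums[OF s] in \<open>auto simp: norm_rterm\<close>)
  then have "((\<lambda>n. rterm s n x) has_sum R s x) (range Suc)"
    by (subst has_sum_reindex) (auto simp: o_def)
  moreover have "range Suc = snd ` Sigma UNIV sqblock"
  proof
    show "range Suc \<subseteq> snd ` Sigma UNIV sqblock"
    proof
      fix n assume "n \<in> range Suc"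
      then have "n > 0" by auto
      then obtain k where "n \<in> sqblock k" using sqblock_cover by blast
      then have "(k, n) \<in> Sigma UNIV sqblock" by auto
      then show "n \<in> snd ` Sigma UNIV sqblock" by force
    qed
    show "snd ` Sigma UNIV sqblock \<subseteq> range Suc"
      using sqblock_pos by (auto simp: image_iff) (metis gr0_conv_Suc)
  qed
  moreover have "inj_on snd (Sigma UNIV sqblock)"
    using sqblock_disjoint by (auto simp: inj_on_def)
  ultimately have "((\<lambda>(k,n). rterm s n x) has_sum R s x) (Sigma UNIV sqblock)"
    by (simp add: has_sum_reindex o_def case_prod_unfold)
  then have "((\<lambda>k. gk s k 0 x) has_sum R s x) UNIV"
  proof (rule has_sum_SigmaD)
    fix k :: nat
    have "(\<Sum>n\<in>sqblock k. rterm s n x) = gk s k 0 x" unfolding gk_def sqsum_def rterm_def coef_def by simp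
    then show "((\<lambda>n. case (k, n) of (k, n) \<Rightarrow> rterm s n x) has_sum gk s k 0 x) (sqblock k)"
      using has_sum_finite[of "sqblock k" "\<lambda>n. rterm s n x"] by simp
  qed
  then show ?thesis by (rule has_sum_imp_sums)
qed

text \<open>The weight is \<rho>^|k-j|: for an increment of size 2^(-j) the blocks near k = j
  dominate and both tails decay geometrically.\<close>

lemma two_sided_geometric:
  fixes \<rho> :: real
  assumes "0 \<le> \<rho>" "\<rho> < 1"
  shows "summable (\<lambda>k. \<rho> ^ (if k < j then j - k else k - j))"
    and "(\<Sum>k. \<rho> ^ (if k < j then j - k else k - j)) \<le> 2 / (1 - \<rho>)"
proof -
  let ?f = "\<lambda>k. \<rho> ^ (if k < j then j - k else k - j)"
  have shift: "(\<lambda>k. ?f (k + j)) = (\<lambda>k. \<rho> ^ k)" by auto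
  have sg: "summable (\<lambda>k. \<rho> ^ k)" using assms by (intro summable_geometric) auto
  show sum: "summable ?f" using sg summable_iff_shift[of ?f j] unfolding shift by blast
  have "(\<Sum>k. ?f k) = (\<Sum>k. ?f (k + j)) + (\<Sum>k<j. ?f k)" by (rule suminf_split_initial_segment[OF sum])
  also have "(\<Sum>k. ?f (k + j)) = 1 / (1 - \<rho>)" unfolding shift using assms by (intro suminf_geometric) auto
  also have "(\<Sum>k<j. ?f k) = (\<Sum>k<j. \<rho> ^ (j - k))" by (intro sum.cong) auto
  also have "\<dots> \<le> (\<Sum>k<j. \<rho> ^ (j - Suc k))" using assms by (intro sum_mono power_decreasing) auto
  also have "\<dots> = (\<Sum>k<j. \<rho> ^ k)" by (rule sum.nat_diff_reindex)
  also have "\<dots> \<le> (\<Sum>k. \<rho> ^ k)" using assms by (intro sum_le_suminf sg) auto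
  also have "\<dots> = 1 / (1 - \<rho>)" using assms by (intro suminf_geometric) auto
  finally show "(\<Sum>k. ?f k) \<le> 2 / (1 - \<rho>)" by simp
qed

lemma dyadic_scale:
  fixes h :: real
  assumes "h \<noteq> 0" "\<bar>h\<bar> < 1"
  obtains j :: nat where "\<bar>h\<bar> \<le> 2 powr (- real j)" "2 powr (- real j) \<le> 2 * \<bar>h\<bar>"
proof -
  define l where "l = - log 2 \<bar>h\<bar>"
  have l: "l > 0" using assms by (simp add: l_def)
  have h: "\<bar>h\<bar> = 2 powr (- l)" using assms by (simp add: l_def)
  define j where "j = nat \<lfloor>l\<rfloor>"
  have j: "real j \<le> l" "l < real j + 1" using l by (auto simp: j_def)
  have 1: "\<bar>h\<bar> \<le> 2 powr (- real j)" unfolding h using j by (intro powr_mono) auto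
  have "2 powr (- real j) \<le> 2 powr (1 - l)" using j by (intro powr_mono) auto
  also have "\<dots> = 2 * \<bar>h\<bar>" unfolding h by (simp add: powr_diff powr_minus divide_inverse)
  finally show ?thesis using 1 that by blast
qed

lemma gk_taylor:
  assumes B: "\<And>y. \<bar>y - x\<bar> \<le> \<bar>h\<bar> \<Longrightarrow> cmod (gk s k m y) \<le> B" and m: "m > 0"
  shows "cmod (gk s k 0 (x + h) - (\<Sum>i<m. gk s k i x * of_real h ^ i / fact i)) \<le> B * \<bar>h\<bar> ^ m"
proof -
  obtain n where n: "m = Suc n" using m gr0_conv_Suc by blast
  have B0: "B \<ge> 0" using B[of x] norm_ge_zero order_trans by (metis abs_ge_zero abs_zero diff_self)
  have "cmod (gc s k 0 (of_real (x + h)) - (\<Sum>i\<le>n. gc s k i (of_real x) * (of_real (x + h) - of_real x) ^ i / fact i))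
     \<le> B * cmod (of_real (x + h) - of_real x) ^ Suc n / fact n"
  proof (rule complex_Taylor[where S = "closed_segment (of_real x) (of_real (x + h))"])
    fix z :: complex assume "z \<in> closed_segment (of_real x) (of_real (x + h))"
    then obtain y where y: "y \<in> closed_segment x (x + h)" "z = of_real y"
      unfolding closed_segment_of_real by auto
    have "\<bar>y - x\<bar> \<le> \<bar>h\<bar>" using segment_bound(1)[OF y(1)] by simp
    then show "cmod (gc s k (Suc n) z) \<le> B" using B y n by (simp only: gc_of_real)
  qed (auto intro: has_field_derivative_gc)
  also have "\<dots> \<le> B * \<bar>h\<bar> ^ m"
  proof -
    have "B * \<bar>h\<bar> ^ m / fact n \<le> B * \<bar>h\<bar> ^ m / 1" using B0
      by (intro divide_left_mono) (auto simp: fact_ge_1)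
    moreover have "complex_of_real (x + h) - of_real x = of_real h" by simp
    ultimately show ?thesis by (simp only: norm_of_real n div_by_1)
  qed
  finally show ?thesis unfolding n lessThan_Suc_atMost by (simp add: gc_of_real del: of_real_add) (simp flip: gc_of_real)
qed

text \<open>For an increment of size 2^(-j), blocks with k < j are expanded by Taylor up to order m,
  which uses the condition at scale k itself; blocks with k >= j are estimated without cancellation,
  at scale j. The condition gives the high blocks no decay in k beyond the scale j, which matches
  the later covering argument with its intervals of size 2^(-j). The missing decay comes from the
  global bound, at the expense of the gap between \<beta> and \<alpha>'.\<close>

lemma holder_at_from_blocks:
  assumes s: "s > 1/2" and b: "0 \<le> \<beta>" "\<beta> < \<alpha>'" and m: "m = Suc (nat \<lfloor>\<beta>\<rfloor>)"
    and cond: "\<And>j k i y. j \<le> k \<Longrightarrow> i \<le> m \<Longrightarrow> \<bar>y - x\<bar> \<le> 2 powr (- real j) \<Longrightarrow>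
       cmod (gk s k i y) \<le> C * 2 powr (real k * real i - real j * \<alpha>')"
  shows "holder_at \<beta> (R s) x"
proof -
  have C0: "C \<ge> 0"
  proof -
    have "0 \<le> cmod (gk s 0 0 x)" by simp
    also have "\<dots> \<le> C" using cond[of 0 0 0 x] by simp
    finally show ?thesis .
  qed
  define B where "B = 2 powr s"
  have glob: "cmod (gk s k 0 y) \<le> B * 2 powr (- (real k * (s - 1/2)))" for k y
    using norm_gk_le[of s k 0 y] s unfolding B_def by (simp add: algebra_simps)
  \<comment> \<open>Interpolation parameter for blocks with k >= j: the (1-\<theta>)-th power of
    2^(-j\<alpha>') is exactly 2^(-j\<beta>), and the \<theta>-th power of the global bound supplies
    decay in k.\<close>
  define \<theta> where "\<theta> = 1 - \<beta> / \<alpha>'"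
  have th: "0 < \<theta>" "\<theta> \<le> 1" "\<alpha>' * (1 - \<theta>) = \<beta>" using b by (auto simp: \<theta>_def)
  have mb: "\<beta> < real m" "real (m - 1) \<le> \<beta>" using b unfolding m by linarith+
  have ib: "real i \<le> \<beta>" if "i < m" for i using that mb(2) m by (simp add: le_nat_iff)
  \<comment> \<open>The decay rate in |k-j| must serve three estimates: the Taylor remainder for k <
    j, the high blocks themselves, and their Taylor polynomials at x.\<close>
  define d where "d = min (real m - \<beta>) (min (\<theta> * (s - 1/2)) (\<alpha>' - \<beta>))"
  have d: "0 < d" "d \<le> real m - \<beta>" "d \<le> \<theta> * (s - 1/2)" "d \<le> \<alpha>' - \<beta>"
    unfolding d_def using mb th s b by auto
  define \<rho> where "\<rho> = 2 powr (- d)"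
  have rho: "0 \<le> \<rho>" "\<rho> < 1" using d(1) powr_less_mono[of "- d" 0 2] by (auto simp: \<rho>_def)
  have rhop: "\<rho> ^ n = 2 powr (- (real n * d))" for n by (simp add: \<rho>_def powr_power mult.commute)
  define T where "T = (\<lambda>k h. \<Sum>i<m. gk s k i x * of_real h ^ i / fact i)"
  have der: "cmod (gk s k i x) \<le> C * 2 powr (real k * (real i - \<alpha>'))" if "i \<le> m" for k i
    using cond[of k k i x] that by (simp add: algebra_simps)
  have summ: "summable (\<lambda>k. gk s k i x)" if i: "i < m" for i
  proof (rule summable_comparison_test[of _ "\<lambda>k. C * \<rho> ^ k"])
    have "cmod (gk s k i x) \<le> C * \<rho> ^ k" for k
    proof -
      have "2 powr (real k * (real i - \<alpha>')) \<le> 2 powr (real k * (- d))"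
        using ib[OF i] d(4) by (intro powr_mono mult_left_mono) auto
      then have "C * 2 powr (real k * (real i - \<alpha>')) \<le> C * 2 powr (real k * (- d))"
        using C0 by (rule mult_left_mono)
      moreover have "cmod (gk s k i x) \<le> C * 2 powr (real k * (real i - \<alpha>'))" using der[of i k] i by simp
      ultimately show ?thesis unfolding rhop by simp
    qed
    then show "\<exists>N. \<forall>k\<ge>N. cmod (gk s k i x) \<le> C * \<rho> ^ k" by blast
    show "summable (\<lambda>k. C * \<rho> ^ k)" using rho by (intro summable_mult summable_geometric) auto
  qed
  define P where "P = (\<Sum>i<m. monom ((\<Sum>k. gk s k i x) / fact i) i)"
  have degP: "real (degree P) \<le> \<beta>"
  proof -
    have "degree P \<le> m - 1" unfolding P_def
      by (rule degree_sum_le) (auto intro: order_trans[OF degree_monom_le])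
    then show ?thesis using mb(2) by linarith
  qed
  have Tsums: "(\<lambda>k. T k h) sums poly P (of_real h)" for h
  proof -
    have "(\<lambda>k. \<Sum>i<m. gk s k i x * (of_real h ^ i / fact i)) sums (\<Sum>i<m. (\<Sum>k. gk s k i x) * (of_real h ^ i / fact i))"
      by (intro sums_sum sums_mult2 summable_sums summ) auto
    then show ?thesis unfolding T_def P_def by (simp add: poly_sum poly_monom)
  qed
  define K where "K = max C B + real m * C + C"
  define M where "M = K * 2 powr \<beta> * (2 / (1 - \<rho>)) + 1"
  have B0: "B > 0" by (simp add: B_def)
  have K0: "K > 0" unfolding K_def using C0 B0 by (simp add: add_pos_nonneg)
  have main: "cmod (R s (x + h) - poly P (of_real h)) \<le> M * \<bar>h\<bar> powr \<beta>" if h: "\<bar>h\<bar> < 1" for h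
  proof (cases "h = 0")
    case True
    \<comment> \<open>Since 0 \<open>powr\<close> \<beta> is 0, even for \<beta> = 0, the estimate
      at h = 0 demands exact equality.\<close>
    have "T k 0 = gk s k 0 x" for k
    proof -
      have "T k 0 = (\<Sum>i<m. if i = 0 then gk s k 0 x else 0)" unfolding T_def by (intro sum.cong) auto
      then show ?thesis using m by simp
    qed
    then have "poly P (of_real h) = R s (x + h)"
      using sums_unique2[OF Tsums[of 0], of "R s x"] R_sums_gk[OF s, of x] True by simp
    then show ?thesis using True by simp
  next
    case False
    obtain j where j: "\<bar>h\<bar> \<le> 2 powr (- real j)" "2 powr (- real j) \<le> 2 * \<bar>h\<bar>"
      using dyadic_scale[OF False h] by blast
    have h0: "\<bar>h\<bar> > 0" using False by simp
    have jb: "2 powr (- (real j * \<beta>)) \<le> 2 powr \<beta> * \<bar>h\<bar> powr \<beta>"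
    proof -
      have "2 powr (- (real j * \<beta>)) = (2 powr (- real j)) powr \<beta>" by (simp add: powr_powr)
      also have "\<dots> \<le> (2 * \<bar>h\<bar>) powr \<beta>" using j(2) b by (intro powr_mono2) auto
      finally show ?thesis by (simp add: powr_mult)
    qed
    let ?w = "\<lambda>k. \<rho> ^ (if k < j then j - k else k - j)"
    have trm: "cmod (gk s k 0 (x + h) - T k h) \<le> K * 2 powr \<beta> * \<bar>h\<bar> powr \<beta> * ?w k" for k
    proof (cases "k < j")
      case True
      have "cmod (gk s k 0 (x + h) - T k h) \<le> (C * 2 powr (real k * (real m - \<alpha>'))) * \<bar>h\<bar> ^ m"
        unfolding T_def
      proof (rule gk_taylor)
        fix y assume y: "\<bar>y - x\<bar> \<le> \<bar>h\<bar>"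
        have "2 powr (- real j) \<le> 2 powr (- real k)" using True by (intro powr_mono) auto
        then have "\<bar>y - x\<bar> \<le> 2 powr (- real k)" using y j(1) by linarith
        then show "cmod (gk s k m y) \<le> C * 2 powr (real k * (real m - \<alpha>'))"
          using cond[of k k m y] by (simp add: algebra_simps)
      qed (simp add: m)
      also have "\<bar>h\<bar> ^ m = \<bar>h\<bar> powr \<beta> * \<bar>h\<bar> powr (real m - \<beta>)"
        using h0 by (simp add: powr_add[symmetric] powr_realpow)
      also have "\<bar>h\<bar> powr (real m - \<beta>) \<le> 2 powr (- (real j * (real m - \<beta>)))"
      proof -
        have "\<bar>h\<bar> powr (real m - \<beta>) \<le> (2 powr (- real j)) powr (real m - \<beta>)"
          using j(1) mb by (intro powr_mono2) auto
        then show ?thesis by (simp add: powr_powr)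
      qed
      finally have "cmod (gk s k 0 (x + h) - T k h) \<le> C * 2 powr (real k * (real m - \<alpha>')) * (\<bar>h\<bar> powr \<beta> * 2 powr (- (real j * (real m - \<beta>))))"
        using C0 by (simp add: mult_left_mono)
      also have "\<dots> = C * \<bar>h\<bar> powr \<beta> * 2 powr (real k * (real m - \<alpha>') - real j * (real m - \<beta>))"
        unfolding diff_conv_add_uminus[of "real k * (real m - \<alpha>')"] powr_add by (simp only: mult_ac)
      also have "\<dots> \<le> C * \<bar>h\<bar> powr \<beta> * 2 powr (- (real (j - k) * d))"
      proof (intro mult_left_mono powr_mono)
        have "real k * (real m - \<alpha>') \<le> real k * (real m - \<beta>)" using b by (intro mult_left_mono) auto
        moreover have "real (j - k) * d \<le> real (j - k) * (real m - \<beta>)" using d(2) by (intro mult_left_mono) auto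
        ultimately show "real k * (real m - \<alpha>') - real j * (real m - \<beta>) \<le> - (real (j - k) * d)"
          using True by (simp add: of_nat_diff algebra_simps)
      qed (use C0 in auto)
      also have "\<dots> = C * \<bar>h\<bar> powr \<beta> * ?w k" using True by (simp add: rhop)
      also have "\<dots> \<le> K * 2 powr \<beta> * \<bar>h\<bar> powr \<beta> * ?w k"
      proof (intro mult_right_mono)
        have "C * 1 \<le> K * 2 powr \<beta>" using C0 B0 b ge_one_powr_ge_zero[of 2 \<beta>]
          by (intro mult_mono) (auto simp: K_def)
        then show "C \<le> K * 2 powr \<beta>" by simp
      qed (use rho in auto)
      finally show ?thesis .
    next
      case False
      then have jk: "j \<le> k" by simp
      have 1: "cmod (gk s k 0 (x + h)) \<le> max C B * 2 powr (- (real j * \<beta>)) * ?w k"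
      proof -
        define X where "X = cmod (gk s k 0 (x + h))"
        have X1: "X \<le> max C B * 2 powr (- (real j * \<alpha>'))"
        proof -
          have "X \<le> C * 2 powr (- (real j * \<alpha>'))" using cond[OF jk, of 0 "x + h"] j(1) by (simp add: X_def)
          also have "\<dots> \<le> max C B * 2 powr (- (real j * \<alpha>'))" by (intro mult_right_mono) auto
          finally show ?thesis .
        qed
        have X2: "X \<le> max C B * 2 powr (- (real k * (s - 1/2)))"
          unfolding X_def by (rule order_trans[OF glob]) (intro mult_right_mono, auto)
        have "X = X powr (1 - \<theta>) * X powr \<theta>" by (simp add: powr_add[symmetric] X_def)
        also have "\<dots> \<le> (max C B * 2 powr (- (real j * \<alpha>'))) powr (1 - \<theta>) * (max C B * 2 powr (- (real k * (s - 1/2)))) powr \<theta>"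
          using X1 X2 th by (intro mult_mono powr_mono2) (auto simp: X_def)
        also have "\<dots> = (max C B powr (1 - \<theta>) * max C B powr \<theta>) * (2 powr (- (real j * \<alpha>') * (1 - \<theta>)) * 2 powr (- (real k * (s - 1/2)) * \<theta>))"
          using B0 by (simp add: powr_mult powr_powr mult_ac)
        also have "max C B powr (1 - \<theta>) * max C B powr \<theta> = max C B" using B0 by (simp add: powr_add[symmetric])
        also have "- (real j * \<alpha>') * (1 - \<theta>) = - (real j * \<beta>)" using th(3) by (simp add: mult.assoc)
        also have "2 powr (- (real k * (s - 1/2)) * \<theta>) \<le> 2 powr (- (real (k - j) * d))"
        proof (intro powr_mono)
          have "real (k - j) * d \<le> real k * (\<theta> * (s - 1/2))" using d(1,3) by (intro mult_mono) auto
          then show "- (real k * (s - 1/2)) * \<theta> \<le> - (real (k - j) * d)" by (simp add: mult_ac)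
        qed auto
        finally have "X \<le> max C B * (2 powr (- (real j * \<beta>)) * 2 powr (- (real (k - j) * d)))"
          using B0 by (simp add: mult_left_mono)
        then show ?thesis unfolding X_def using False by (simp add: rhop mult.assoc)
      qed
      have 2: "cmod (T k h) \<le> real m * C * 2 powr (- (real j * \<beta>)) * ?w k"
      proof -
        have "cmod (T k h) \<le> (\<Sum>i<m. C * 2 powr (- (real j * \<beta>)) * ?w k)"
          unfolding T_def
        proof (rule order_trans[OF norm_sum], rule sum_mono)
          fix i assume "i \<in> {..<m}"
          then have i: "i < m" by simp
          have "cmod (gk s k i x * of_real h ^ i / fact i) = cmod (gk s k i x) * \<bar>h\<bar> ^ i / fact i"
            by (simp add: norm_mult norm_divide norm_power)
          also have "\<dots> \<le> cmod (gk s k i x) * \<bar>h\<bar> ^ i / 1"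
            by (intro divide_left_mono) (auto simp: fact_ge_1)
          also have "\<dots> \<le> C * 2 powr (real k * (real i - \<alpha>')) * (2 powr (- real j)) ^ i / 1"
            using der[of i k] i j(1) C0 by (intro divide_right_mono mult_mono power_mono) auto
          also have "\<dots> = C * 2 powr (real k * (real i - \<alpha>') - real j * real i)"
          proof -
            have "(2 powr (- real j)) ^ i = (2::real) powr (- (real j * real i))" by (simp add: powr_power mult.commute)
            then show ?thesis
              unfolding diff_conv_add_uminus[of "real k * (real i - \<alpha>')"] powr_add by simp
          qed
          also have "\<dots> \<le> C * 2 powr (- (real j * \<beta>) - real (k - j) * d)"
          proof (intro mult_left_mono powr_mono C0)
            have "real (k - j) * d \<le> real (k - j) * (\<alpha>' - real i)" using d(4) ib[OF i] by (intro mult_left_mono) auto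
            moreover have "real j * \<beta> \<le> real j * \<alpha>'" using b by (intro mult_left_mono) auto
            ultimately show "real k * (real i - \<alpha>') - real j * real i \<le> - (real j * \<beta>) - real (k - j) * d"
              using jk by (simp add: of_nat_diff algebra_simps)
          qed auto
          also have "\<dots> = C * 2 powr (- (real j * \<beta>)) * ?w k"
            using False by (simp add: rhop powr_diff powr_minus divide_inverse)
          finally show "cmod (gk s k i x * of_real h ^ i / fact i) \<le> C * 2 powr (- (real j * \<beta>)) * ?w k" .
        qed
        then show ?thesis by simp
      qed
      have "cmod (gk s k 0 (x + h) - T k h) \<le> (max C B + real m * C) * 2 powr (- (real j * \<beta>)) * ?w k"
        using norm_triangle_ineq4[of "gk s k 0 (x + h)" "T k h"] 1 2 by (simp add: algebra_simps)
      also have "\<dots> \<le> K * (2 powr \<beta> * \<bar>h\<bar> powr \<beta>) * ?w k"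
        using jb C0 B0 rho by (intro mult_right_mono mult_mono) (auto simp: K_def)
      finally show ?thesis by (simp only: mult.assoc)
    qed
    have wsum: "summable (\<lambda>k. K * 2 powr \<beta> * \<bar>h\<bar> powr \<beta> * ?w k)"
      by (intro summable_mult two_sided_geometric(1) rho)
    have Dsums: "(\<lambda>k. gk s k 0 (x + h) - T k h) sums (R s (x + h) - poly P (of_real h))"
      by (intro sums_diff R_sums_gk s Tsums)
    have nsum: "summable (\<lambda>k. cmod (gk s k 0 (x + h) - T k h))"
      by (rule summable_comparison_test[OF _ wsum]) (use trm in auto)
    have "cmod (R s (x + h) - poly P (of_real h)) = cmod (\<Sum>k. gk s k 0 (x + h) - T k h)"
      using Dsums by (simp add: sums_iff)
    also have "\<dots> \<le> (\<Sum>k. cmod (gk s k 0 (x + h) - T k h))" by (rule summable_norm[OF nsum])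
    also have "\<dots> \<le> (\<Sum>k. K * 2 powr \<beta> * \<bar>h\<bar> powr \<beta> * ?w k)" by (intro suminf_le trm nsum wsum)
    also have "\<dots> = K * 2 powr \<beta> * \<bar>h\<bar> powr \<beta> * (\<Sum>k. ?w k)"
      by (rule suminf_mult[OF two_sided_geometric(1)[OF rho]])
    also have "\<dots> \<le> K * 2 powr \<beta> * \<bar>h\<bar> powr \<beta> * (2 / (1 - \<rho>))"
      using K0 by (intro mult_left_mono two_sided_geometric(2) rho) auto
    also have "\<dots> \<le> M * \<bar>h\<bar> powr \<beta>" unfolding M_def by (simp add: algebra_simps)
    finally show ?thesis .
  qed
  have M0: "M > 0" unfolding M_def using K0 rho by (simp add: add_nonneg_pos)
  show ?thesis unfolding holder_at_def
    using degP M0 main by (intro exI[of _ P] exI[of _ M] conjI exI[of _ 1]) auto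
qed

subsection \<open>Level sets of low regularity\<close>

lemma holder_exponent_ge:
  assumes s: "s > 1/2"
  shows "holder_exponent (R s) x \<ge> ereal (s - 1/2)"
proof (rule ereal_le_epsilon2)
  fix \<epsilon> :: real assume e: "\<epsilon> > 0"
  \<comment> \<open>The criterion asks for a nonnegative exponent, and \<epsilon> may exceed
    s-1/2.\<close>
  define \<beta> where "\<beta> = max 0 (s - 1/2 - \<epsilon>)"
  have b: "0 \<le> \<beta>" "\<beta> < s - 1/2" using e s by (auto simp: \<beta>_def)
  define m where "m = Suc (nat \<lfloor>\<beta>\<rfloor>)"
  have "holder_at \<beta> (R s) x"
  proof (rule holder_at_from_blocks[OF s b m_def, where C = "(2 * pi)^m * 2 powr s"])
    fix j k i :: nat and y :: real assume jk: "j \<le> k" and i: "i \<le> m"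
    have "cmod (gk s k i y) \<le> (2 * pi)^i * 2 powr s * 2 powr (real k * (real i - (s - 1/2)))"
      using norm_gk_le[of s k i y] s by simp
    also have "\<dots> \<le> (2 * pi)^m * 2 powr s * 2 powr (real k * real i - real j * (s - 1/2))"
    proof (intro mult_mono powr_mono power_increasing i)
      have "2 \<le> pi" using pi_ge_two .
      then show "1 \<le> 2 * pi" by linarith
      have "real j * (s - 1/2) \<le> real k * (s - 1/2)" using jk s by (intro mult_right_mono) auto
      then show "real k * (real i - (s - 1/2)) \<le> real k * real i - real j * (s - 1/2)" by (simp add: algebra_simps)
    qed auto
    finally show "cmod (gk s k i y) \<le> (2 * pi)^m * 2 powr s * 2 powr (real k * real i - real j * (s - 1/2))" .
  qed
  then have "ereal \<beta> \<le> holder_exponent (R s) x" unfolding holder_exponent_def by (intro Sup_upper) auto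
  moreover have "s - 1/2 \<le> \<beta> + \<epsilon>" by (simp add: \<beta>_def)
  then have "ereal (s - 1/2) \<le> ereal \<beta> + ereal \<epsilon>" by simp
  ultimately show "ereal (s - 1/2) \<le> holder_exponent (R s) x + ereal \<epsilon>"
    by (meson add_right_mono order_trans)
qed

text \<open>The constant in the block criterion is free. Enlarged by 2^(J\<alpha>'), it lets the
  trivial bound satisfy the condition at all j <= J, so the violation occurs at an arbitrarily fine
  scale. The same comparison bounds k by a multiple of j, so each j involves finitely many
  blocks.\<close>

lemma low_exponent_large_block:
  assumes s: "s > 1/2" and a: "holder_exponent (R s) x \<le> ereal \<alpha>" and b: "0 \<le> \<beta>" "\<alpha> < \<beta>" "\<beta> < \<alpha>'"
    and m: "m = Suc (nat \<lfloor>\<beta>\<rfloor>)"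
  shows "\<exists>j k i y. J \<le> j \<and> j \<le> k \<and> real k * (s - 1/2) \<le> real j * \<alpha>' \<and> i \<le> m \<and> \<bar>y - x\<bar> \<le> 2 powr (- real j) \<and>
     cmod (gk s k i y) > (2 * pi)^m * 2 powr s * 2 powr (real k * real i - real j * \<alpha>')"
proof -
  define C1 where "C1 = (2 * pi)^m * 2 powr s"
  have C1: "C1 > 0" by (simp add: C1_def)
  define C where "C = C1 * 2 powr (real J * \<alpha>')"
  have a': "\<alpha>' > 0" using b by linarith
  have "\<not> holder_at \<beta> (R s) x"
  proof
    assume "holder_at \<beta> (R s) x"
    then have "ereal \<beta> \<le> holder_exponent (R s) x" unfolding holder_exponent_def by (intro Sup_upper) auto
    then have "ereal \<beta> \<le> ereal \<alpha>" using a by (rule order_trans)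
    then show False using b by simp
  qed
  then obtain j k i y where h: "j \<le> k" "i \<le> m" "\<bar>y - x\<bar> \<le> 2 powr (- real j)"
      "\<not> cmod (gk s k i y) \<le> C * 2 powr (real k * real i - real j * \<alpha>')"
    using holder_at_from_blocks[OF s b(1,3) m, of x C] by blast
  have up: "cmod (gk s k i y) \<le> C1 * 2 powr (real k * (real i - (s - 1/2)))"
  proof -
    have "cmod (gk s k i y) \<le> (2 * pi)^i * 2 powr s * 2 powr (real k * (real i - (s - 1/2)))"
      using norm_gk_le[of s k i y] s by simp
    also have "\<dots> \<le> C1 * 2 powr (real k * (real i - (s - 1/2)))" unfolding C1_def
      using pi_ge_two by (intro mult_right_mono power_increasing h(2)) auto
    finally show ?thesis .
  qed
  have "C1 * 2 powr (real J * \<alpha>' + (real k * real i - real j * \<alpha>')) < C1 * 2 powr (real k * (real i - (s - 1/2)))"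
    using h(4) up by (simp add: C_def powr_add mult.assoc)
  then have lt: "real J * \<alpha>' + (real k * real i - real j * \<alpha>') < real k * (real i - (s - 1/2))"
    using C1 by simp
  have k0: "0 \<le> real k * (s - 1/2)" using s by simp
  have "real J * \<alpha>' < real j * \<alpha>'" using lt k0 by (simp add: algebra_simps)
  then have J: "J \<le> j" using a' by simp
  have J0: "0 \<le> real J * \<alpha>'" using a' by simp
  have kj: "real k * (s - 1/2) \<le> real j * \<alpha>'" using lt J0 by (simp add: algebra_simps)
  have "C1 * 1 \<le> C" unfolding C_def using C1 a' ge_one_powr_ge_zero[of 2 "real J * \<alpha>'"] by (intro mult_left_mono) auto
  then have "C1 * 2 powr (real k * real i - real j * \<alpha>') \<le> C * 2 powr (real k * real i - real j * \<alpha>')"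
    by (intro mult_right_mono) auto
  then have "cmod (gk s k i y) > C1 * 2 powr (real k * real i - real j * \<alpha>')" using h(4) by linarith
  then show ?thesis using h J kj unfolding C1_def by blast
qed

text \<open>The integral of \<open>sobV\<close> over an interval of length \<open>2\<^bsup>-k\<^esup>\<close> dominates the maximum of \<open>\<bar>g\<bar>\<^sup>4\<close> there:
  Young's inequality splits the derivative of \<open>\<bar>g\<bar>\<^sup>4\<close>.\<close>

definition sobV :: "real \<Rightarrow> nat \<Rightarrow> nat \<Rightarrow> real \<Rightarrow> real" where
  "sobV s k i x = 4 * 2^k * cmod (gk s k i x)^4 + cmod (gk s k (Suc i) x)^4 / (2^k)^3"

lemma continuous_on_sobV: "continuous_on S (sobV s k i)"
  unfolding sobV_def by (intro continuous_intros) auto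

lemma sobV_nonneg: "sobV s k i x \<ge> 0" unfolding sobV_def by simp

lemma young4:
  fixes u v c :: real
  assumes "u \<ge> 0" "v \<ge> 0" "c > 0"
  shows "4 * u^3 * v \<le> 3 * c * u^4 + v^4 / c^3"
proof -
  define w where "w = v / c"
  have v: "v = c * w" using assms by (simp add: w_def)
  \<comment> \<open>A certificate for the weighted inequality between arithmetic and geometric mean:
    the product expands to 3u^4 + w^4 - 4u^3 w.\<close>
  have "0 \<le> (u - w)^2 * (2 * u^2 + (u + w)^2)" by (intro mult_nonneg_nonneg add_nonneg_nonneg) auto
  also have "\<dots> = 3 * u^4 + w^4 - 4 * u^3 * w" by (simp add: algebra_simps eval_nat_numeral)
  finally have "4 * u^3 * w \<le> 3 * u^4 + w^4" by simp
  then have "c * (4 * u^3 * w) \<le> c * (3 * u^4 + w^4)" using assms by (intro mult_left_mono) auto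
  moreover have "v^4 / c^3 = c * w^4" unfolding v using assms by (simp add: field_simps eval_nat_numeral)
  ultimately show ?thesis unfolding v by (simp add: algebra_simps)
qed

text \<open>With H = |g|^4, H(y) is at most H(z) plus the total variation of H on the cell;
  averaging over z gives 2^k times the integral of H. Young's inequality with c = 2^k adds 3 * 2^k,
  whence the 4 in \<open>sobV\<close>. As 2^k is the frequency scale of the block, both summands of
  \<open>sobV\<close> have moment bounds of the same order.\<close>

lemma gk_sup_le_integral:
  assumes y: "y \<in> {a..a + 1 / 2^k}"
  shows "cmod (gk s k i y)^4 \<le> integral {a..a + 1 / 2^k} (sobV s k i)"
proof -
  define \<delta> :: real where "\<delta> = 1 / 2^k"
  have d: "\<delta> > 0" by (simp add: \<delta>_def)
  define H where "H = (\<lambda>x. cmod (gk s k i x)^4)"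
  define H' where "H' = (\<lambda>x. 2 * (cmod (gk s k i x))\<^sup>2 * (2 * (Re (gk s k i x) * Re (gk s k (Suc i) x) + Im (gk s k i x) * Im (gk s k (Suc i) x))))"
  define w where "w = (\<lambda>x. 3 * 2^k * cmod (gk s k i x)^4 + cmod (gk s k (Suc i) x)^4 / (2^k)^3)"
  have Hd: "(H has_vector_derivative H' x) (at x within S)" for x S
  proof -
    have r: "((\<lambda>x. Re (gk s k i x)) has_real_derivative Re (gk s k (Suc i) x)) (at x within S)"
      unfolding has_real_derivative_iff_has_vector_derivative
      by (rule bounded_linear.has_vector_derivative[OF bounded_linear_Re has_vector_derivative_gk])
    have im: "((\<lambda>x. Im (gk s k i x)) has_real_derivative Im (gk s k (Suc i) x)) (at x within S)"
      unfolding has_real_derivative_iff_has_vector_derivative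
      by (rule bounded_linear.has_vector_derivative[OF bounded_linear_Im has_vector_derivative_gk])
    have "((\<lambda>x. ((Re (gk s k i x))\<^sup>2 + (Im (gk s k i x))\<^sup>2)\<^sup>2) has_real_derivative
       2 * ((Re (gk s k i x))\<^sup>2 + (Im (gk s k i x))\<^sup>2) * (2 * Re (gk s k i x) * Re (gk s k (Suc i) x) + 2 * Im (gk s k i x) * Im (gk s k (Suc i) x))) (at x within S)"
    proof -
      have "((\<lambda>x. (Re (gk s k i x))\<^sup>2 + (Im (gk s k i x))\<^sup>2) has_real_derivative
          2 * Re (gk s k i x) * Re (gk s k (Suc i) x) + 2 * Im (gk s k i x) * Im (gk s k (Suc i) x)) (at x within S)"
        using DERIV_add[OF DERIV_power[OF r, of 2] DERIV_power[OF im, of 2]] by (simp add: mult_ac)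
      from DERIV_power[OF this, of 2] show ?thesis by (simp add: algebra_simps)
    qed
    moreover have "(\<lambda>x. ((Re (gk s k i x))\<^sup>2 + (Im (gk s k i x))\<^sup>2)\<^sup>2) = H"
      unfolding H_def cmod_power2[symmetric] by auto
    ultimately show ?thesis
      unfolding has_real_derivative_iff_has_vector_derivative[symmetric] H'_def cmod_power2
      by (simp add: algebra_simps)
  qed
  have H'w: "\<bar>H' x\<bar> \<le> w x" for x
  proof -
    have "\<bar>Re (gk s k i x) * Re (gk s k (Suc i) x) + Im (gk s k i x) * Im (gk s k (Suc i) x)\<bar>
       = \<bar>Re (gk s k i x * cnj (gk s k (Suc i) x))\<bar>" by simp
    also have "\<dots> \<le> cmod (gk s k i x * cnj (gk s k (Suc i) x))" by (rule abs_Re_le_cmod)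
    also have "\<dots> = cmod (gk s k i x) * cmod (gk s k (Suc i) x)" by (simp add: norm_mult)
    finally have "\<bar>H' x\<bar> \<le> 2 * (cmod (gk s k i x))\<^sup>2 * (2 * (cmod (gk s k i x) * cmod (gk s k (Suc i) x)))"
      unfolding H'_def abs_mult by (intro mult_mono) auto
    also have "\<dots> = 4 * cmod (gk s k i x)^3 * cmod (gk s k (Suc i) x)" by (simp add: eval_nat_numeral)
    also have "\<dots> \<le> w x" unfolding w_def using young4[of "cmod (gk s k i x)" "cmod (gk s k (Suc i) x)" "2^k"] by simp
    finally show ?thesis .
  qed
  have wc: "continuous_on S w" for S unfolding w_def by (intro continuous_intros) auto
  have H'c: "continuous_on S H'" for S unfolding H'_def by (intro continuous_intros)
  have Hc: "continuous_on S H" for S unfolding H_def by (intro continuous_intros)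
  have w0: "w x \<ge> 0" for x unfolding w_def by simp
  have diff: "H v - H u \<le> integral {a..a+\<delta>} w \<and> H u - H v \<le> integral {a..a+\<delta>} w" if "u \<le> v" "u \<in> {a..a+\<delta>}" "v \<in> {a..a+\<delta>}" for u v
  proof -
    have "(H' has_integral (H v - H u)) {u..v}"
      by (rule fundamental_theorem_of_calculus[OF that(1)]) (rule Hd)
    then have e: "H v - H u = integral {u..v} H'" by (simp add: integral_unique)
    have "\<bar>integral {u..v} H'\<bar> \<le> integral {u..v} w"
      using integral_norm_bound_integral[of H' "{u..v}" w] H'w
      by (simp add: integrable_continuous_real H'c wc)
    also have "\<dots> \<le> integral {a..a+\<delta>} w"
      by (rule integral_subset_le) (use that w0 in \<open>auto intro: integrable_continuous_real wc\<close>)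
    finally have "\<bar>H v - H u\<bar> \<le> integral {a..a+\<delta>} w" using e by simp
    then show ?thesis by (intro conjI; linarith)
  qed
  have pt: "H y \<le> H z + integral {a..a+\<delta>} w" if z: "z \<in> {a..a+\<delta>}" for z
    using diff[of y z] diff[of z y] y z unfolding \<delta>_def[symmetric] by linarith
  have "integral {a..a+\<delta>} (\<lambda>z. H y) \<le> integral {a..a+\<delta>} (\<lambda>z. H z + integral {a..a+\<delta>} w)"
    by (rule integral_le) (use pt in \<open>auto intro!: integrable_continuous_real continuous_intros Hc\<close>)
  also have "\<dots> = integral {a..a+\<delta>} H + integral {a..a+\<delta>} (\<lambda>z. integral {a..a+\<delta>} w)"
    by (rule integral_add) (auto intro!: integrable_continuous_real Hc)
  finally have "\<delta> * H y \<le> integral {a..a+\<delta>} H + \<delta> * integral {a..a+\<delta>} w" using d by simp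
  then have "H y \<le> integral {a..a+\<delta>} H / \<delta> + integral {a..a+\<delta>} w" using d by (simp add: field_simps)
  also have "\<dots> = integral {a..a+\<delta>} (\<lambda>x. 2^k * H x) + integral {a..a+\<delta>} w" by (simp add: \<delta>_def)
  also have "\<dots> = integral {a..a+\<delta>} (\<lambda>x. 2^k * H x + w x)"
    by (rule integral_add[symmetric]) (auto intro!: integrable_continuous_real Hc wc continuous_intros)
  also have "(\<lambda>x. 2^k * H x + w x) = sobV s k i" unfolding H_def w_def sobV_def by (rule ext) simp
  finally show ?thesis unfolding H_def \<delta>_def .
qed

lemma sobV_integral_le:
  assumes s: "s > 0"
  shows "\<exists>A>0. \<forall>k t. integral {t..t+1} (sobV s k i) \<le> A * (real k + 3)\<^sup>2 * 2 powr (real k * (4 * (real i - s) + 2))"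
proof -
  define A0 where "A0 = 9 * ((2 * pi)^i * 2 powr s)^4"
  define A1 where "A1 = 9 * ((2 * pi)^Suc i * 2 powr s)^4"
  have "integral {t..t+1} (sobV s k i) \<le> (4 * A0 + A1) * (real k + 3)\<^sup>2 * 2 powr (real k * (4 * (real i - s) + 2))" for k t
  proof -
    have "integral {t..t+1} (sobV s k i) = integral {t..t+1} (\<lambda>x. 4 * 2^k * cmod (gk s k i x)^4) + integral {t..t+1} (\<lambda>x. cmod (gk s k (Suc i) x)^4 / (2^k)^3)"
      unfolding sobV_def by (rule integral_add) (auto intro!: integrable_continuous_real continuous_intros)
    also have "\<dots> = 4 * 2^k * integral {t..t+1} (\<lambda>x. cmod (gk s k i x)^4) + integral {t..t+1} (\<lambda>x. cmod (gk s k (Suc i) x)^4) / (2^k)^3"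
      by simp
    also have "\<dots> \<le> 4 * 2^k * (A0 * (real k + 3)\<^sup>2 * 2 powr (real k * (4 * (real i - s) + 1)))
         + (A1 * (real k + 3)\<^sup>2 * 2 powr (real k * (4 * (real (Suc i) - s) + 1))) / (2^k)^3"
      unfolding A0_def A1_def by (intro add_mono mult_left_mono divide_right_mono gk_L4 s) auto
    also have "4 * 2^k * (A0 * (real k + 3)\<^sup>2 * 2 powr (real k * (4 * (real i - s) + 1)))
       = 4 * A0 * (real k + 3)\<^sup>2 * 2 powr (real k * (4 * (real i - s) + 2))"
    proof -
      have "2 powr (real k * (4 * (real i - s) + 2)) = 2 powr (real k * (4 * (real i - s) + 1)) * 2 powr real k"
        by (simp only: powr_add[symmetric]) (simp add: algebra_simps)
      then show ?thesis by (simp add: powr_realpow)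
    qed
    also have "(A1 * (real k + 3)\<^sup>2 * 2 powr (real k * (4 * (real (Suc i) - s) + 1))) / (2^k)^3
       = A1 * (real k + 3)\<^sup>2 * 2 powr (real k * (4 * (real i - s) + 2))"
    proof -
      have "2 powr (real k * (4 * (real (Suc i) - s) + 1)) = 2 powr (real k * (4 * (real i - s) + 2)) * 2 powr (real k * 3)"
        by (simp only: powr_add[symmetric]) (simp add: algebra_simps)
      moreover have "2 powr (real k * 3) = ((2::real)^k)^3"
        using powr_realpow[of 2 "k * 3"] by (simp add: power_mult)
      ultimately show ?thesis by simp
    qed
    finally show ?thesis by (simp add: algebra_simps)
  qed
  moreover have "4 * A0 + A1 > 0" unfolding A0_def A1_def by (intro add_pos_pos) auto
  ultimately show ?thesis by blast
qed

section \<open>Counting the dyadic cells on which a block is large\<close>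

lemma integral_sum_cells:
  fixes V :: "real \<Rightarrow> real"
  assumes c: "continuous_on UNIV V" and d: "\<delta> \<ge> 0"
  shows "(\<Sum>l<n. integral {a + real l * \<delta>..a + real l * \<delta> + \<delta>} V) = integral {a..a + real n * \<delta>} V"
proof (induction n)
  case (Suc n)
  have "integral {a..a + real n * \<delta>} V + integral {a + real n * \<delta>..a + real (Suc n) * \<delta>} V = integral {a..a + real (Suc n) * \<delta>} V"
    by (rule Henstock_Kurzweil_Integration.integral_combine) (use d c in \<open>auto intro!: integrable_continuous_real intro: continuous_on_subset simp: algebra_simps\<close>)
  then show ?case using Suc by (simp add: algebra_simps)
qed simp

text \<open>The mesh covers [-1,2] because a point y at which the block is large may be at distance
  1 from the point x of [0,1) under consideration.\<close>

definition bad_cells :: "real \<Rightarrow> real \<Rightarrow> nat \<Rightarrow> nat \<Rightarrow> nat set" where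
  "bad_cells s \<mu> k i = {l. l < 3 * 2^k \<and> (\<exists>y \<in> {-1 + real l * (1 / 2^k)..-1 + real l * (1 / 2^k) + 1 / 2^k}. cmod (gk s k i y) > \<mu>)}"

lemma finite_bad_cells [simp]: "finite (bad_cells s \<mu> k i)"
  unfolding bad_cells_def by auto

lemma bad_cells_card:
  assumes l: "\<mu> \<ge> 0"
  shows "real (card (bad_cells s \<mu> k i)) * \<mu>^4 \<le> integral {-1..2} (sobV s k i)"
proof -
  let ?I = "\<lambda>l. integral {-1 + real l * (1 / 2^k)..-1 + real l * (1 / 2^k) + 1 / 2^k} (sobV s k i)"
  have I0: "?I l \<ge> 0" for l
    by (rule integral_nonneg) (auto intro: integrable_continuous_real continuous_on_sobV sobV_nonneg)
  have "real (card (bad_cells s \<mu> k i)) * \<mu>^4 = (\<Sum>l\<in>bad_cells s \<mu> k i. \<mu>^4)" by simp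
  also have "\<dots> \<le> (\<Sum>l\<in>bad_cells s \<mu> k i. ?I l)"
  proof (rule sum_mono)
    fix j assume "j \<in> bad_cells s \<mu> k i"
    then obtain y where y: "y \<in> {-1 + real j * (1 / 2^k)..-1 + real j * (1 / 2^k) + 1 / 2^k}" "cmod (gk s k i y) > \<mu>"
      unfolding bad_cells_def by blast
    have "\<mu>^4 \<le> cmod (gk s k i y)^4" using y(2) l by (intro power_mono) auto
    also have "\<dots> \<le> ?I j" by (rule gk_sup_le_integral[OF y(1)])
    finally show "\<mu>^4 \<le> ?I j" .
  qed
  also have "\<dots> \<le> (\<Sum>l<3 * 2^k. ?I l)"
    by (rule sum_mono2) (use I0 in \<open>auto simp: bad_cells_def\<close>)
  also have "\<dots> = integral {-1..-1 + real (3 * 2^k) * (1 / 2^k)} (sobV s k i)"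
    by (rule integral_sum_cells) (auto intro: continuous_on_sobV)
  also have "-1 + real (3 * 2^k) * (1 / 2^k) = (2::real)" by simp
  finally show ?thesis .
qed

lemma sobV_integral_3:
  "integral {-1..2} (sobV s k i) = integral {-1..-1+1} (sobV s k i) + integral {0..0+1} (sobV s k i) + integral {1..1+1} (sobV s k i)"
proof -
  have "(\<Sum>l<3. integral {-1 + real l * 1..-1 + real l * 1 + 1} (sobV s k i)) = integral {-1..-1 + real 3 * 1} (sobV s k i)"
    by (rule integral_sum_cells) (auto intro: continuous_on_sobV)
  then show ?thesis by (simp add: eval_nat_numeral)
qed

text \<open>The Borel-Cantelli argument for Hausdorff measure: as the covering property holds from
  every J on, the tails of the convergent series are admissible covering sums. The factor 2^t
  accounts for diameters in place of radii.\<close>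

lemma hausdorff_measure_zeroI:
  fixes Z :: "nat \<Rightarrow> real set" and r a :: "nat \<Rightarrow> real"
  assumes t: "t > 0" and fin: "\<And>j. finite (Z j)" and r0: "\<And>j. r j \<ge> 0" and rlim: "r \<longlonglongrightarrow> 0"
    and a: "\<And>j. real (card (Z j)) * (r j) powr t \<le> a j" and sa: "summable a"
    and cov: "\<And>J. A \<subseteq> (\<Union>j\<in>{J..}. \<Union>z\<in>Z j. cball z (r j))"
  shows "hausdorff_measure t A = 0"
proof -
  have a0: "a j \<ge> 0" for j using order_trans[OF _ a[of j]] by simp
  have "hausdorff_content \<delta> t A = 0" if d: "\<delta> > 0" for \<delta>
  proof -
    have "hausdorff_content \<delta> t A \<le> ennreal \<epsilon>" if e: "\<epsilon> > 0" for \<epsilon>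
    proof -
      have "eventually (\<lambda>j. r j < \<delta> / 2) sequentially" using order_tendstoD(2)[OF rlim, of "\<delta>/2"] d by simp
      then obtain J1 where J1: "\<And>j. j \<ge> J1 \<Longrightarrow> r j < \<delta> / 2" by (auto simp: eventually_sequentially)
      have e2: "\<epsilon> / 2 powr t > 0" using e by simp
      have "\<exists>J2. \<forall>n\<ge>J2. norm (\<Sum>i. a (i + n)) < \<epsilon> / 2 powr t"
        by (rule suminf_exist_split[OF e2 sa])
      then obtain J2 where J2: "\<And>n. n \<ge> J2 \<Longrightarrow> norm (\<Sum>i. a (i + n)) < \<epsilon> / 2 powr t" by blast
      define J where "J = max J1 J2"
      define L where "L = (\<lambda>j. sorted_list_of_set (Z (j + J)))"
      have L: "set (L j) = Z (j + J)" "length (L j) = card (Z (j + J))" for j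
        unfolding L_def using fin by auto
      \<comment> \<open>Each finite family is padded with empty sets, which \<open>hd_term\<close>
        counts as 0, so that the double family can be enumerated as one sequence.\<close>
      define F where "F = (\<lambda>(j,i). if i < length (L j) then cball (L j ! i) (r (j + J)) else {})"
      define C where "C = (\<lambda>n. F (prod_decode n))"
      have cover: "A \<subseteq> (\<Union>n. C n)"
      proof
        fix x assume "x \<in> A"
        then obtain j z where j: "j \<ge> J" "z \<in> Z j" "x \<in> cball z (r j)" using cov[of J] by blast
        then have "z \<in> set (L (j - J))" using L by simp
        then obtain i where i: "i < length (L (j - J))" "L (j - J) ! i = z" by (auto simp: in_set_conv_nth)
        have "x \<in> F (j - J, i)" using i j by (simp add: F_def)
        then have "x \<in> C (prod_encode (j - J, i))" by (simp add: C_def)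
        then show "x \<in> (\<Union>n. C n)" by blast
      qed
      have dF: "bounded (F p) \<and> diameter (F p) \<le> \<delta>" for p
      proof -
        obtain j i where p: "p = (j,i)" by (cases p)
        have "r (j + J) < \<delta> / 2" using J1[of "j + J"] by (simp add: J_def)
        then show ?thesis unfolding F_def p using r0[of "j + J"] d by (auto simp: diameter_cball)
      qed
      have trm: "(\<Sum>i. hd_term (F (j, i)) t) \<le> ennreal (2 powr t * a (j + J))" for j
      proof -
        have "(\<Sum>i. hd_term (F (j, i)) t) = (\<Sum>i<length (L j). hd_term (F (j, i)) t)"
          by (rule suminf_finite) (auto simp: F_def hd_term_def)
        also have "\<dots> \<le> (\<Sum>i<length (L j). ennreal ((2 * r (j + J)) powr t))"
        proof (rule sum_mono)
          fix i assume "i \<in> {..<length (L j)}"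
          then show "hd_term (F (j, i)) t \<le> ennreal ((2 * r (j + J)) powr t)"
            using t r0[of "j + J"] by (auto simp: F_def hd_term_def diameter_cball)
        qed
        also have "\<dots> = of_nat (card (Z (j + J))) * ennreal ((2 * r (j + J)) powr t)" by (simp add: L)
        also have "\<dots> = ennreal (real (card (Z (j + J))) * (2 * r (j + J)) powr t)"
          by (simp add: ennreal_mult ennreal_of_nat_eq_real_of_nat)
        also have "\<dots> \<le> ennreal (2 powr t * a (j + J))"
          using a[of "j + J"] r0[of "j + J"] by (intro ennreal_leI) (simp add: powr_mult mult_left_mono mult.left_commute)
        finally show ?thesis .
      qed
      have sJ: "summable (\<lambda>j. 2 powr t * a (j + J))" using sa by (intro summable_mult) (simp add: summable_iff_shift)
      have "hausdorff_content \<delta> t A \<le> (\<Sum>n. hd_term (C n) t)"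
        unfolding hausdorff_content_def
        by (rule INF_lower) (use cover dF in \<open>auto simp: C_def\<close>)
      also have "\<dots> = (\<Sum>j. \<Sum>i. hd_term (F (j, i)) t)"
        unfolding C_def by (rule suminf_ennreal_2dimen[of _ "\<lambda>p. hd_term (F p) t"]) simp
      also have "\<dots> \<le> (\<Sum>j. ennreal (2 powr t * a (j + J)))" by (intro suminf_le trm) auto
      also have "\<dots> = ennreal (\<Sum>j. 2 powr t * a (j + J))" by (rule suminf_ennreal2) (use a0 sJ in auto)
      also have "\<dots> \<le> ennreal \<epsilon>"
      proof (rule ennreal_leI)
        have "(\<Sum>j. a (j + J)) < \<epsilon> / 2 powr t" using J2[of J] by (simp add: J_def)
        moreover have "(\<Sum>j. 2 powr t * a (j + J)) = 2 powr t * (\<Sum>j. a (j + J))"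
          using sa by (intro suminf_mult) (simp add: summable_iff_shift)
        ultimately show "(\<Sum>j. 2 powr t * a (j + J)) \<le> \<epsilon>" by (simp add: field_simps)
      qed
      finally show ?thesis .
    qed
    then show ?thesis
      by (intro antisym) (auto intro: ennreal_le_epsilon[of 0, simplified] simp: zero_le)
  qed
  then show ?thesis unfolding hausdorff_measure_def by (simp add: SUP_constant)
qed

lemma summable_poly_exp:
  assumes e: "\<epsilon> > 0"
  shows "summable (\<lambda>j::nat. (real j + 3)^m * 2 powr (- (\<epsilon> * real j)))"
proof -
  obtain C where C: "\<And>k::nat. (real k + 3)^m * 2 powr (- (\<epsilon> / 2 * real k)) \<le> C"
    using poly_exp_bounded[of "\<epsilon> / 2" m] e by auto
  have le: "(real j + 3)^m * 2 powr (- (\<epsilon> * real j)) \<le> C * (2 powr (- (\<epsilon> / 2))) ^ j" for j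
  proof -
    have "2 powr (- (\<epsilon> * real j)) = 2 powr (- (\<epsilon> / 2 * real j)) * (2 powr (- (\<epsilon> / 2))) ^ j"
      by (simp add: powr_power powr_add[symmetric] algebra_simps)
    then show ?thesis using mult_right_mono[OF C[of j], of "(2 powr (- (\<epsilon> / 2))) ^ j"] by (simp add: mult.assoc)
  qed
  show ?thesis
  proof (rule summable_comparison_test[OF exI[of _ 0]])
    show "\<forall>n\<ge>0. norm ((real n + 3)^m * 2 powr (- (\<epsilon> * real n))) \<le> C * (2 powr (- (\<epsilon> / 2))) ^ n"
      using le by simp
    have "2 powr (- (\<epsilon> / 2)) < (1::real)" using powr_less_mono[of "- (\<epsilon> / 2)" 0 2] e by simp
    then show "summable (\<lambda>n. C * (2 powr (- (\<epsilon> / 2))) ^ n)" by (intro summable_mult summable_geometric) simp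
  qed
qed

text \<open>Markov's inequality. The order i of the derivative cancels, because threshold and moment
  scale alike in i; what remains decreases in k since 4s > 2, so k = j is the worst case.\<close>

lemma bad_cells_count:
  assumes s: "s > 1/2" and C1: "C1 > 0"
  shows "\<exists>E>0. \<forall>j k i. j \<le> k \<longrightarrow> i \<le> m \<longrightarrow>
    real (card (bad_cells s (C1 * 2 powr (real k * real i - real j * \<alpha>')) k i))
      \<le> E * (real k + 3)\<^sup>2 * 2 powr (real j * (4 * \<alpha>' - 4 * s + 2))"
proof -
  have "\<forall>i. \<exists>A>0. \<forall>k t. integral {t..t+1} (sobV s k i) \<le> A * (real k + 3)\<^sup>2 * 2 powr (real k * (4 * (real i - s) + 2))"
    using sobV_integral_le[of s] s by simp
  then obtain A where A0: "\<And>i. A i > 0"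
    and A: "\<And>i k t. integral {t..t+1} (sobV s k i) \<le> A i * (real k + 3)\<^sup>2 * 2 powr (real k * (4 * (real i - s) + 2))"
    by metis
  define E where "E = 3 * (\<Sum>i\<le>m. A i) / C1^4"
  have E0: "E > 0" unfolding E_def using A0 C1 by (intro divide_pos_pos mult_pos_pos sum_pos) auto
  have "real (card (bad_cells s (C1 * 2 powr (real k * real i - real j * \<alpha>')) k i))
      \<le> E * (real k + 3)\<^sup>2 * 2 powr (real j * (4 * \<alpha>' - 4 * s + 2))" if jk: "j \<le> k" and i: "i \<le> m" for j k i :: nat
  proof -
    define \<mu> where "\<mu> = C1 * 2 powr (real k * real i - real j * \<alpha>')"
    define X where "X = 2 powr (real k * (4 * (real i - s) + 2))"
    have m0: "\<mu> > 0" using C1 by (simp add: \<mu>_def)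
    have Ai: "A i \<le> (\<Sum>i\<le>m. A i)" using i A0 by (intro member_le_sum) (auto intro: less_imp_le)
    have "real (card (bad_cells s \<mu> k i)) * \<mu>^4 \<le> integral {-1..2} (sobV s k i)" using bad_cells_card[of \<mu> s k i] m0 by simp
    also have "\<dots> \<le> 3 * (A i * (real k + 3)\<^sup>2 * X)"
      unfolding sobV_integral_3 X_def using A[of "-1" k i] A[of 0 k i] A[of 1 k i] by linarith
    also have "\<dots> \<le> 3 * ((\<Sum>i\<le>m. A i) * (real k + 3)\<^sup>2 * X)"
      using Ai by (intro mult_left_mono mult_right_mono) (auto simp: X_def)
    also have "\<dots> = E * C1^4 * (real k + 3)\<^sup>2 * X" using C1 by (simp add: E_def)
    finally have "real (card (bad_cells s \<mu> k i)) \<le> E * C1^4 * (real k + 3)\<^sup>2 * X / \<mu>^4"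
      using m0 by (simp add: pos_le_divide_eq)
    also have "\<mu>^4 = C1^4 * 2 powr (4 * (real k * real i - real j * \<alpha>'))"
      unfolding \<mu>_def power_mult_distrib by (simp add: powr_power mult.commute)
    also have "E * C1^4 * (real k + 3)\<^sup>2 * X / (C1^4 * 2 powr (4 * (real k * real i - real j * \<alpha>')))
       = E * (real k + 3)\<^sup>2 * (X / 2 powr (4 * (real k * real i - real j * \<alpha>')))" using C1 by simp
    also have "X / 2 powr (4 * (real k * real i - real j * \<alpha>')) = 2 powr (real k * (2 - 4 * s) + 4 * real j * \<alpha>')"
      unfolding X_def powr_diff[symmetric] by (rule arg_cong[of _ _ "(powr) 2"]) (simp add: algebra_simps)
    also have "\<dots> \<le> 2 powr (real j * (4 * \<alpha>' - 4 * s + 2))"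
    proof (rule powr_mono)
      have "real j * (4 * s - 2) \<le> real k * (4 * s - 2)" using jk s by (intro mult_right_mono) auto
      then show "real k * (2 - 4 * s) + 4 * real j * \<alpha>' \<le> real j * (4 * \<alpha>' - 4 * s + 2)" by (simp add: algebra_simps)
    qed simp
    finally show ?thesis unfolding \<mu>_def using E0 by (simp add: mult_left_mono)
  qed
  then show ?thesis using E0 by blast
qed

lemma hausdorff_null_low_exponent:
  assumes s: "s > 1/2" and t: "t > 0" "t > 4 * \<alpha> - 4 * s + 2"
  shows "hausdorff_measure t {x \<in> {0..<1}. holder_exponent (R s) x \<le> ereal \<alpha>} = 0"
proof -
  \<comment> \<open>The block criterion needs a nonnegative exponent. Raising \<alpha> to 0 is
    harmless, because 2 - 4s < 0 < t.\<close>
  define a1 where "a1 = max \<alpha> 0"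
  have a1: "4 * a1 - 4 * s + 2 < t" "\<alpha> \<le> a1" "0 \<le> a1" using s t by (auto simp: a1_def max_def)
  \<comment> \<open>Passing from \<open>a1\<close> to \<alpha>' raises the counting exponent by 4g,
    half of the gap to t; \<beta> lies strictly between the two.\<close>
  define g where "g = (t - (4 * a1 - 4 * s + 2)) / 8"
  have g: "g > 0" using a1 by (simp add: g_def)
  define \<alpha>' where "\<alpha>' = a1 + g"
  define \<beta> where "\<beta> = a1 + g / 2"
  have b: "0 \<le> \<beta>" "\<alpha> < \<beta>" "\<beta> < \<alpha>'" using a1 g by (auto simp: \<beta>_def \<alpha>'_def)
  define D where "D = 4 * \<alpha>' - 4 * s + 2"
  have D: "D < t" using g unfolding D_def \<alpha>'_def g_def by (simp add: field_simps)
  define m where "m = Suc (nat \<lfloor>\<beta>\<rfloor>)"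
  define C1 where "C1 = (2 * pi)^m * 2 powr s"
  have C1: "C1 > 0" by (simp add: C1_def)
  obtain E where E0: "E > 0" and E: "\<And>j k i. j \<le> k \<Longrightarrow> i \<le> m \<Longrightarrow>
      real (card (bad_cells s (C1 * 2 powr (real k * real i - real j * \<alpha>')) k i)) \<le> E * (real k + 3)\<^sup>2 * 2 powr (real j * D)"
    using bad_cells_count[OF s C1, of m \<alpha>'] unfolding D_def by blast
  define \<kappa> where "\<kappa> = nat \<lceil>\<alpha>' / (s - 1/2)\<rceil>"
  have kap: "k \<le> \<kappa> * j" if "real k * (s - 1/2) \<le> real j * \<alpha>'" for k j :: nat
  proof -
    have "real k \<le> real j * (\<alpha>' / (s - 1/2))" using that s by (simp add: field_simps)
    also have "\<dots> \<le> real j * real \<kappa>" unfolding \<kappa>_def by (intro mult_left_mono) (auto simp: real_nat_ceiling_ge)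
    finally have "real k \<le> real (\<kappa> * j)" by (simp add: mult.commute)
    then show ?thesis by (simp only: of_nat_le_iff)
  qed
  define cell where "cell = (\<lambda>(k::nat) (l::nat). -1 + real l * (1 / 2^k) + (1 / 2^k) / 2 :: real)"
  define Z where "Z = (\<lambda>j. \<Union>(k,i) \<in> {j..\<kappa> * j} \<times> {..m}. cell k ` bad_cells s (C1 * 2 powr (real k * real i - real j * \<alpha>')) k i)"
  \<comment> \<open>2^(-j) for the distance from x to the large value, and 2^(-k) <= 2^(-j) as a
    margin for the distance from there to the centre of its cell.\<close>
  define r where "r = (\<lambda>j::nat. 2 * 2 powr (- real j))"
  define G where "G = (real \<kappa> + 1)^3 * (real m + 1) * E * 2 powr t"
  define \<epsilon> where "\<epsilon> = t - D"
  have eps: "\<epsilon> > 0" using D by (simp add: \<epsilon>_def)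
  define a where "a = (\<lambda>j::nat. G * ((real j + 3)^3 * 2 powr (- (\<epsilon> * real j))))"
  show ?thesis
  proof (rule hausdorff_measure_zeroI[OF t(1), of Z r a])
    show "finite (Z j)" for j unfolding Z_def by auto
    show "r j \<ge> 0" for j by (simp add: r_def)
    show "r \<longlonglongrightarrow> 0" unfolding r_def by real_asymp
    show "summable a" unfolding a_def by (intro summable_mult summable_poly_exp eps)
    show "real (card (Z j)) * r j powr t \<le> a j" for j
    proof -
      have "card (Z j) \<le> (\<Sum>(k,i) \<in> {j..\<kappa> * j} \<times> {..m}. card (cell k ` bad_cells s (C1 * 2 powr (real k * real i - real j * \<alpha>')) k i))"
        unfolding Z_def by (rule order_trans[OF card_UN_le]) (auto simp: case_prod_unfold)
      also have "\<dots> \<le> (\<Sum>(k,i) \<in> {j..\<kappa> * j} \<times> {..m}. card (bad_cells s (C1 * 2 powr (real k * real i - real j * \<alpha>')) k i))"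
        by (rule sum_mono) (auto intro: card_image_le)
      finally have "real (card (Z j)) \<le> real (\<Sum>(k,i) \<in> {j..\<kappa> * j} \<times> {..m}. card (bad_cells s (C1 * 2 powr (real k * real i - real j * \<alpha>')) k i))"
        by (simp only: of_nat_le_iff)
      also have "\<dots> = (\<Sum>(k,i) \<in> {j..\<kappa> * j} \<times> {..m}. real (card (bad_cells s (C1 * 2 powr (real k * real i - real j * \<alpha>')) k i)))"
        by (simp add: case_prod_unfold)
      also have "\<dots> \<le> (\<Sum>(k,i) \<in> {j..\<kappa> * j} \<times> {..m}. E * (real (\<kappa> * j) + 3)\<^sup>2 * 2 powr (real j * D))"
      proof (rule sum_mono)
        fix p assume "p \<in> {j..\<kappa> * j} \<times> {..m}"
        then obtain k i where p: "p = (k, i)" and h: "k \<in> {j..\<kappa> * j}" "i \<in> {..m}" by auto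
        have "real (card (bad_cells s (C1 * 2 powr (real k * real i - real j * \<alpha>')) k i)) \<le> E * (real k + 3)\<^sup>2 * 2 powr (real j * D)"
          using E[of j k i] h by auto
        also have "\<dots> \<le> E * (real (\<kappa> * j) + 3)\<^sup>2 * 2 powr (real j * D)"
        proof -
          have "real k \<le> real (\<kappa> * j)" using h by (simp only: of_nat_le_iff atLeastAtMost_iff)
          then show ?thesis using E0 by (intro mult_right_mono mult_left_mono power_mono) auto
        qed
        finally show "(case p of (k, i) \<Rightarrow> real (card (bad_cells s (C1 * 2 powr (real k * real i - real j * \<alpha>')) k i)))
           \<le> (case p of (k, i) \<Rightarrow> E * (real (\<kappa> * j) + 3)\<^sup>2 * 2 powr (real j * D))" unfolding p by simp
      qed
      also have "\<dots> = real (card ({j..\<kappa> * j} \<times> {..m})) * (E * (real (\<kappa> * j) + 3)\<^sup>2 * 2 powr (real j * D))"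
        by (simp add: case_prod_unfold)
      also have "\<dots> \<le> ((real \<kappa> + 1) * (real j + 3) * (real m + 1)) * (E * ((real \<kappa> + 1) * (real j + 3))\<^sup>2 * 2 powr (real j * D))"
      proof (intro mult_mono)
        have "real (card ({j..\<kappa> * j} \<times> {..m})) = real (Suc (\<kappa> * j) - j) * (real m + 1)"
          by (simp only: card_cartesian_product card_atLeastAtMost card_atMost of_nat_mult of_nat_Suc add.commute)
        also have "\<dots> \<le> (real \<kappa> + 1) * (real j + 3) * (real m + 1)"
        proof (rule mult_right_mono)
          have "real (Suc (\<kappa> * j) - j) \<le> real (Suc (\<kappa> * j))" by (simp only: of_nat_le_iff)
          also have "\<dots> \<le> (real \<kappa> + 1) * (real j + 3)" by (simp add: algebra_simps)
          finally show "real (Suc (\<kappa> * j) - j) \<le> (real \<kappa> + 1) * (real j + 3)" .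
        qed simp
        finally show "real (card ({j..\<kappa> * j} \<times> {..m})) \<le> (real \<kappa> + 1) * (real j + 3) * (real m + 1)" .
        show "(real (\<kappa> * j) + 3)\<^sup>2 \<le> ((real \<kappa> + 1) * (real j + 3))\<^sup>2"
          by (intro power_mono) (auto simp: algebra_simps)
      qed (use E0 in auto)
      finally have "real (card (Z j)) \<le> ((real \<kappa> + 1) * (real j + 3) * (real m + 1)) * (E * ((real \<kappa> + 1) * (real j + 3))\<^sup>2 * 2 powr (real j * D))" .
      then have "real (card (Z j)) * r j powr t \<le> ((real \<kappa> + 1) * (real j + 3) * (real m + 1)) * (E * ((real \<kappa> + 1) * (real j + 3))\<^sup>2 * 2 powr (real j * D)) * r j powr t"
        by (rule mult_right_mono) simp
      also have rj: "r j powr t = 2 powr t * 2 powr (- (real j * t))"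
        unfolding r_def by (simp add: powr_mult powr_powr)
      also have "((real \<kappa> + 1) * (real j + 3) * (real m + 1)) * (E * ((real \<kappa> + 1) * (real j + 3))\<^sup>2 * 2 powr (real j * D)) * (2 powr t * 2 powr (- (real j * t)))
         = G * ((real j + 3)^3 * (2 powr (real j * D) * 2 powr (- (real j * t))))"
        unfolding G_def power3_eq_cube power2_eq_square by (simp only: mult_ac)
      also have "2 powr (real j * D) * 2 powr (- (real j * t)) = 2 powr (- (\<epsilon> * real j))"
        unfolding \<epsilon>_def powr_add[symmetric] by (rule arg_cong[of _ _ "(powr) 2"]) (simp add: algebra_simps)
      finally show ?thesis unfolding a_def rj .
    qed
    show "{x \<in> {0..<1}. holder_exponent (R s) x \<le> ereal \<alpha>} \<subseteq> (\<Union>j\<in>{J..}. \<Union>z\<in>Z j. cball z (r j))" for J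
    proof
      fix x assume "x \<in> {x \<in> {0..<1}. holder_exponent (R s) x \<le> ereal \<alpha>}"
      then have x: "0 \<le> x" "x < 1" "holder_exponent (R s) x \<le> ereal \<alpha>" by auto
      obtain j k i y where h: "J \<le> j" "j \<le> k" "real k * (s - 1/2) \<le> real j * \<alpha>'" "i \<le> m" "\<bar>y - x\<bar> \<le> 2 powr (- real j)"
        "cmod (gk s k i y) > C1 * 2 powr (real k * real i - real j * \<alpha>')"
        using low_exponent_large_block[OF s x(3) b m_def, of J] unfolding C1_def by blast
      have p1: "2 powr (- real j) \<le> (1::real)" using powr_mono[of "- real j" 0 2] by simp
      have y: "-1 \<le> y" "y < 2" using h(5) p1 x by linarith+
      define l where "l = nat \<lfloor>(y + 1) * 2^k\<rfloor>"
      have l0: "0 \<le> (y + 1) * 2^k" using y by simp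
      have l: "real l \<le> (y + 1) * 2^k" "(y + 1) * 2^k < real l + 1" unfolding l_def using l0 by linarith+
      have l1: "real l * (1 / 2^k) \<le> y + 1" "y + 1 \<le> real l * (1 / 2^k) + 1 / 2^k"
        using l by (simp_all add: field_simps)
      have "real l < 3 * 2^k"
      proof -
        have "(y + 1) * 2^k < 3 * 2^k" using y by (intro mult_strict_right_mono) auto
        then show ?thesis using l by linarith
      qed
      then have l3: "l < 3 * 2^k" by (metis of_nat_less_iff of_nat_mult of_nat_numeral of_nat_power)
      have lb: "l \<in> bad_cells s (C1 * 2 powr (real k * real i - real j * \<alpha>')) k i"
        unfolding bad_cells_def using l3 l1 h(6) by (auto intro!: bexI[of _ y])
      have "cell k l \<in> Z j" unfolding Z_def using lb h(2,4) kap[OF h(3)] by force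
      moreover have "x \<in> cball (cell k l) (r j)"
      proof -
        have "\<bar>y - (-1 + A + B / 2)\<bar> \<le> B / 2" if "A \<le> y + 1" "y + 1 \<le> A + B" for A B :: real
          using that by linarith
        from this[OF l1] have "\<bar>y - cell k l\<bar> \<le> (1 / 2^k) / 2" unfolding cell_def .
        also have "\<dots> \<le> 1 / 2^k" by (simp add: field_simps)
        also have "\<dots> = 2 powr (- real k)" by (simp add: powr_minus powr_realpow divide_inverse)
        also have "\<dots> \<le> 2 powr (- real j)" using h(2) by (intro powr_mono) auto
        finally have "\<bar>x - cell k l\<bar> \<le> r j" unfolding r_def using h(5) by linarith
        then show ?thesis by (simp add: dist_real_def abs_minus_commute)
      qed
      ultimately show "x \<in> (\<Union>j\<in>{J..}. \<Union>z\<in>Z j. cball z (r j))" using h(1) by blast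
    qed
  qed
qed

subsection \<open>Sums of smooth weights against periodic sequences\<close>

lemma has_sum_int:
  fixes f :: "int \<Rightarrow> 'a :: banach"
  assumes "summable (\<lambda>n. norm (f (int n)))" "summable (\<lambda>n. norm (f (- int (Suc n))))"
  shows "(f has_sum ((\<Sum>n. f (int n)) + (\<Sum>n. f (- int (Suc n))))) UNIV"
proof -
  have 1: "(f has_sum (\<Sum>n. f (int n))) (range int)"
    using norm_summable_imp_has_sum[OF assms(1)] summable_norm_cancel[OF assms(1)]
    by (subst has_sum_reindex) (auto simp: o_def summable_sums)
  have inj: "inj (\<lambda>n. - int (Suc n))" by (auto simp: inj_def)
  have 2: "(f has_sum (\<Sum>n. f (- int (Suc n)))) (range (\<lambda>n. - int (Suc n)))"
    using norm_summable_imp_has_sum[OF assms(2)] summable_norm_cancel[OF assms(2)]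
    by (subst has_sum_reindex[OF inj]) (auto simp: o_def summable_sums)
  have disj: "range int \<inter> range (\<lambda>n. - int (Suc n)) = {}" by auto
  have un: "range int \<union> range (\<lambda>n. - int (Suc n)) = UNIV"
  proof -
    have "x \<in> range int \<union> range (\<lambda>n. - int (Suc n))" for x
      by (cases x rule: int_cases) auto
    then show ?thesis by blast
  qed
  show ?thesis using has_sum_Un_disjoint[OF 1 2 disj] unfolding un .
qed

text \<open>Quadratic decay keeps the sum over the integers O(1/c) by telescoping, and a translation
  by O(1/c) changes the weight by a bounded factor only, which the averages over translates below
  rely on.\<close>

definition wt :: "real \<Rightarrow> real \<Rightarrow> real" where "wt c u = 1 / (1 + c * \<bar>u\<bar>)\<^sup>2"

lemma wt_pos: "c \<ge> 0 \<Longrightarrow> wt c u > 0"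
proof -
  assume "c \<ge> 0"
  then have "0 \<le> c * \<bar>u\<bar>" by simp
  then show ?thesis unfolding wt_def by (intro divide_pos_pos zero_less_power) linarith+
qed

lemma wt_sum:
  assumes c: "0 < c"
  shows "summable (\<lambda>n. wt c (real (Suc n)))" "(\<Sum>n. wt c (real (Suc n))) \<le> 1 / c"
proof -
  define g where "g = (\<lambda>n::nat. 1 / (c * (1 + c * real n)))"
  have le: "wt c (real (Suc n)) \<le> g n - g (Suc n)" for n
  proof -
    define x where "x = 1 + c * real n"
    have x: "x > 0" using c by (simp add: x_def add_pos_nonneg)
    have xs: "1 + c * real (Suc n) = x + c" by (simp add: x_def algebra_simps)
    have "g n - g (Suc n) = 1 / (x * (x + c))"
      unfolding g_def xs x_def[symmetric] using c x by (simp add: divide_simps)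
    moreover have "wt c (real (Suc n)) = 1 / ((x + c) * (x + c))"
      unfolding wt_def using xs by (simp add: power2_eq_square)
    moreover have "x * (x + c) \<le> (x + c) * (x + c)" using c x by (intro mult_right_mono) auto
    ultimately show ?thesis using x c by (simp add: frac_le)
  qed
  have "g \<longlonglongrightarrow> 0" unfolding g_def using c by real_asymp
  then have tel: "(\<lambda>n. g n - g (Suc n)) sums (g 0 - 0)" by (rule telescope_sums')
  have nn: "wt c (real (Suc n)) \<ge> 0" for n using wt_pos[of c] c by (simp add: less_imp_le)
  show sm: "summable (\<lambda>n. wt c (real (Suc n)))"
    by (rule summable_comparison_test[OF _ sums_summable[OF tel]]) (use le nn in auto)
  have "(\<Sum>n. wt c (real (Suc n))) \<le> (\<Sum>n. g n - g (Suc n))"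
    by (intro suminf_le le sm sums_summable[OF tel])
  also have "\<dots> = 1 / c" using sums_unique[OF tel] by (simp add: g_def)
  finally show "(\<Sum>n. wt c (real (Suc n))) \<le> 1 / c" .
qed

lemma wt_int_sum:
  assumes c: "0 < c" "c \<le> 1"
  shows "(\<lambda>n. wt c (of_int n)) summable_on (UNIV :: int set)" "infsum (\<lambda>n. wt c (of_int n)) (UNIV :: int set) \<le> 3 / c"
proof -
  have w1: "summable (\<lambda>n. norm (wt c (of_int (int n))))"
    using wt_sum(1)[OF c(1)] summable_Suc_iff[of "\<lambda>n. wt c (real n)"] wt_pos[of c] c by (simp add: less_imp_le)
  have w2: "summable (\<lambda>n. norm (wt c (of_int (- int (Suc n)))))"
    using wt_sum(1)[OF c(1)] by (simp add: wt_def add.commute)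
  have hs: "((\<lambda>n. wt c (of_int n)) has_sum ((\<Sum>n. wt c (of_int (int n))) + (\<Sum>n. wt c (of_int (- int (Suc n)))))) UNIV"
    by (rule has_sum_int[OF w1 w2])
  show "(\<lambda>n. wt c (of_int n)) summable_on (UNIV :: int set)" using hs summable_on_def by blast
  have "infsum (\<lambda>n. wt c (of_int n)) UNIV = (\<Sum>n. wt c (real n)) + (\<Sum>n. wt c (real (Suc n)))"
    using infsumI[OF hs] by (simp add: wt_def add.commute)
  also have "(\<Sum>n. wt c (real n)) = (\<Sum>n. wt c (real (Suc n))) + wt c (real 0)"
    using suminf_split_head[of "\<lambda>n. wt c (real n)"] wt_sum(1)[OF c(1)] summable_Suc_iff[of "\<lambda>n. wt c (real n)"] by simp
  also have "wt c (real 0) = 1" by (simp add: wt_def)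
  also have "(\<Sum>n. wt c (real (Suc n))) + 1 + (\<Sum>n. wt c (real (Suc n))) \<le> 1 / c + 1 / c + 1 / c"
    using wt_sum(2)[OF c(1)] c by (simp add: field_simps)
  finally show "infsum (\<lambda>n. wt c (of_int n)) (UNIV :: int set) \<le> 3 / c" by simp
qed

text \<open>An elementary substitute for Poisson summation. Summed against a q-periodic sequence,
  subtracting the mean of q translates of the weight has the effect of subtracting the mean of the
  sequence, while the weight becomes smaller by q times its derivative. For a weight of width 1/c, M
  iterations gain (qc)^M.\<close>

definition avgT :: "nat \<Rightarrow> (real \<Rightarrow> real) \<Rightarrow> real \<Rightarrow> real" where
  "avgT q g u = g u - (\<Sum>r<q. g (u - real r)) / real q"

lemma avgT_deriv:
  assumes "\<And>u. (g has_real_derivative g' u) (at u)"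
  shows "(avgT q g has_real_derivative avgT q g' u) (at u)"
proof -
  have sh: "((\<lambda>u. g (u - real r)) has_real_derivative g' (u - real r)) (at u)" for r
  proof -
    have "((\<lambda>u. u - real r) has_real_derivative 1) (at u)" by (auto intro!: derivative_eq_intros)
    from DERIV_chain2[of g "g' (u - real r)" "\<lambda>u. u - real r" u 1 UNIV, OF assms this] show ?thesis by simp
  qed
  show ?thesis unfolding avgT_def[abs_def]
    by (intro DERIV_diff assms DERIV_cdivide DERIV_sum sh)
qed

lemma avgT_iter_deriv:
  assumes "\<And>i u. (D i has_real_derivative D (Suc i) u) (at u)"
  shows "((avgT q ^^ M) (D i) has_real_derivative (avgT q ^^ M) (D (Suc i)) u) (at u)"
  by (induction M arbitrary: i u) (use assms avgT_deriv in auto)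

lemma avgT_bound:
  assumes q: "q > 0" and d: "\<And>u. (g has_real_derivative g' u) (at u)"
    and B: "\<And>v. u - real q \<le> v \<Longrightarrow> v \<le> u \<Longrightarrow> \<bar>g' v\<bar> \<le> B"
  shows "\<bar>avgT q g u\<bar> \<le> real q * B"
proof -
  have B0: "B \<ge> 0" using B[of u] by (meson abs_ge_zero order_trans le_add_same_cancel1 diff_le_eq of_nat_0_le_iff order_refl)
  have "avgT q g u = (\<Sum>r<q. g u - g (u - real r)) / real q"
    using q unfolding avgT_def by (simp add: sum_subtractf diff_divide_distrib)
  moreover have "\<bar>g u - g (u - real r)\<bar> \<le> real q * B" if r: "r < q" for r
  proof -
    have "norm (g u - g (u - real r)) \<le> B * norm (u - (u - real r))"
    proof (rule field_differentiable_bound[of "{u - real q..u}" g g'])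
      show "(g has_field_derivative g' z) (at z within {u - real q..u})" for z
        using d has_field_derivative_at_within by blast
    qed (use B r in auto)
    also have "\<dots> \<le> B * real q" using r B0 by (intro mult_left_mono) auto
    finally show ?thesis by (simp add: mult.commute)
  qed
  then have "\<bar>\<Sum>r<q. g u - g (u - real r)\<bar> \<le> real q * (real q * B)"
    by (intro order_trans[OF sum_abs] order_trans[OF sum_bounded_above[of _ _ "real q * B"]]) auto
  ultimately show ?thesis using q by (simp add: abs_divide divide_le_eq mult_ac)
qed

lemma avgT_iter_bound:
  assumes q: "q > 0" and d: "\<And>i u. (D i has_real_derivative D (Suc i) u) (at u)"
    and B: "\<And>v. u - real (M * q) \<le> v \<Longrightarrow> v \<le> u \<Longrightarrow> \<bar>D (i + M) v\<bar> \<le> B"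
  shows "\<bar>(avgT q ^^ M) (D i) u\<bar> \<le> real q ^ M * B"
  using B
proof (induction M arbitrary: i u)
  case 0
  then show ?case using "0"[of u] by simp
next
  case (Suc M)
  have "\<bar>avgT q ((avgT q ^^ M) (D i)) u\<bar> \<le> real q * (real q ^ M * B)"
  proof (rule avgT_bound[OF q avgT_iter_deriv[of D, OF d]])
    fix v assume v: "u - real q \<le> v" "v \<le> u"
    show "\<bar>(avgT q ^^ M) (D (Suc i)) v\<bar> \<le> real q ^ M * B"
    proof (rule Suc.IH)
      fix x assume x: "v - real (M * q) \<le> x" "x \<le> v"
      show "\<bar>D (Suc i + M) x\<bar> \<le> B" using Suc.prems[of x] x v by (simp add: algebra_simps)
    qed
  qed
  then show ?case by (simp add: mult.assoc)
qed

lemma periodic_sum_shift: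
  fixes f :: "int \<Rightarrow> complex"
  assumes per: "\<And>n. f (n + int q) = f n"
  shows "(\<Sum>r<q. f (t + int r)) = (\<Sum>r<q. f (int r))"
proof -
  have step: "(\<Sum>r<q. f (t + 1 + int r)) = (\<Sum>r<q. f (t + int r))" for t
  proof -
    have "(\<Sum>r<q. f (t + 1 + int r)) = (\<Sum>r<q. f (t + int (Suc r)))" by (intro sum.cong) (auto simp: algebra_simps)
    also have "\<dots> = (\<Sum>r<Suc q. f (t + int r)) - f t" by (subst sum.lessThan_Suc_shift) simp
    also have "\<dots> = (\<Sum>r<q. f (t + int r))" using per[of t] by simp
    finally show ?thesis .
  qed
  show ?thesis
  proof (induction t rule: int_induct[where k = 0])
    case base then show ?case by simp
  next
    case (step1 i) then show ?case using step[of i] by simp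
  next
    case (step2 i) then show ?case using step[of "i - 1"] by simp
  qed
qed

lemma summable_on_int_shift:
  fixes f :: "int \<Rightarrow> 'a :: {comm_monoid_add, t2_space}"
  shows "(\<lambda>n. f (n + t)) summable_on UNIV \<longleftrightarrow> f summable_on UNIV" "infsum (\<lambda>n. f (n + t)) UNIV = infsum f UNIV"
proof -
  have b: "bij (\<lambda>n::int. n + t)" by (rule bij_plus_right)
  show "(\<lambda>n. f (n + t)) summable_on UNIV \<longleftrightarrow> f summable_on UNIV"
    using summable_on_reindex_bij_betw[OF b, of f] by simp
  show "infsum (\<lambda>n. f (n + t)) UNIV = infsum f UNIV"
    using infsum_reindex_bij_betw[OF b, of f] by simp
qed

lemma has_sum_finite_sum:
  fixes f :: "'i \<Rightarrow> 'b \<Rightarrow> 'a :: {topological_comm_monoid_add, t2_space}"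
  assumes "finite I" "\<And>i. i \<in> I \<Longrightarrow> (f i has_sum S i) A"
  shows "((\<lambda>x. \<Sum>i\<in>I. f i x) has_sum (\<Sum>i\<in>I. S i)) A"
  using assms by (induction I rule: finite_induct) (auto intro: has_sum_add)

text \<open>For q-periodic \<open>\<psi>\<close> this is the contribution of the nonconstant
  characters mod q.\<close>

definition perErr :: "nat \<Rightarrow> (int \<Rightarrow> complex) \<Rightarrow> (real \<Rightarrow> real) \<Rightarrow> complex" where
  "perErr q \<psi> g = infsum (\<lambda>n. of_real (g (of_int n)) * \<psi> n) UNIV
     - (\<Sum>r<q. \<psi> (int r)) / of_nat q * infsum (\<lambda>n. of_real (g (of_int n))) UNIV"

definition absZ :: "(real \<Rightarrow> real) \<Rightarrow> bool" where
  "absZ g \<longleftrightarrow> (\<lambda>n::int. \<bar>g (of_int n)\<bar>) summable_on UNIV"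

lemma absZ_summable:
  assumes "absZ g" "\<And>n. cmod (\<psi> n) \<le> 1"
  shows "(\<lambda>n::int. of_real (g (of_int n)) * \<psi> n) summable_on UNIV"
    "(\<lambda>n::int. complex_of_real (g (of_int n))) summable_on UNIV"
proof -
  have "(\<lambda>n::int. cmod (of_real (g (of_int n)) * \<psi> n)) summable_on UNIV"
  proof (rule summable_on_comparison_test)
    show "(\<lambda>n::int. \<bar>g (of_int n)\<bar>) summable_on UNIV" using assms by (simp add: absZ_def)
    show "cmod (of_real (g (of_int n)) * \<psi> n) \<le> \<bar>g (of_int n)\<bar>" for n :: int
      using mult_left_mono[OF assms(2)[of n], of "\<bar>g (of_int n)\<bar>"] by (simp add: norm_mult)
  qed auto
  then show "(\<lambda>n::int. of_real (g (of_int n)) * \<psi> n) summable_on UNIV" by (rule abs_summable_summable)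
  have "(\<lambda>n::int. cmod (complex_of_real (g (of_int n)))) summable_on UNIV"
    using assms(1) unfolding absZ_def by simp
  then show "(\<lambda>n::int. complex_of_real (g (of_int n))) summable_on UNIV" by (rule abs_summable_summable)
qed

lemma absZ_shift: "absZ g \<Longrightarrow> absZ (\<lambda>u. g (u - real r))"
  unfolding absZ_def using summable_on_int_shift(1)[of "\<lambda>n. \<bar>g (of_int n)\<bar>" "- int r"] by simp

lemma absZ_avgT: assumes "absZ g" shows "absZ (avgT q g)"
proof -
  have "(\<lambda>n::int. \<Sum>r<q. \<bar>g (of_int n - real r)\<bar>) summable_on UNIV"
    unfolding summable_on_def
    by (rule exI, rule has_sum_finite_sum, simp, rule has_sum_infsum) (use absZ_shift[OF assms] in \<open>simp add: absZ_def\<close>)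
  then have "(\<lambda>n::int. \<bar>g (of_int n)\<bar> + (\<Sum>r<q. \<bar>g (of_int n - real r)\<bar>) * inverse (real q)) summable_on UNIV"
    by (intro summable_on_add summable_on_cmult_left) (use assms in \<open>auto simp: absZ_def\<close>)
  then show ?thesis unfolding absZ_def
  proof (rule summable_on_comparison_test)
    fix n :: int
    have "\<bar>avgT q g (of_int n)\<bar> \<le> \<bar>g (of_int n)\<bar> + \<bar>(\<Sum>r<q. g (of_int n - real r)) / real q\<bar>"
      unfolding avgT_def by (rule abs_triangle_ineq4)
    also have "\<bar>(\<Sum>r<q. g (of_int n - real r)) / real q\<bar> \<le> (\<Sum>r<q. \<bar>g (of_int n - real r)\<bar>) / real q"
      unfolding abs_divide by (simp add: divide_right_mono sum_abs)
    finally show "\<bar>avgT q g (of_int n)\<bar> \<le> \<bar>g (of_int n)\<bar> + (\<Sum>r<q. \<bar>g (of_int n - real r)\<bar>) * inverse (real q)"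
      by (simp add: divide_inverse)
  qed auto
qed

text \<open>Moving each translation by r from the weight to the sequence leaves sums of \<psi> over
  complete periods, all equal to q times the mean.\<close>

lemma avgT_sums:
  assumes g: "absZ g" and q: "q > 0" and \<psi>1: "\<And>n. cmod (\<psi> n) \<le> 1" and per: "\<And>n. \<psi> (n + int q) = \<psi> n"
  shows "infsum (\<lambda>n. of_real (avgT q g (of_int n)) * \<psi> n) UNIV = perErr q \<psi> g"
proof -
  let ?G = "\<Sum>r<q. \<psi> (int r)"
  have s1: "(\<lambda>n::int. of_real (g (of_int n)) * \<psi> n) summable_on UNIV" by (rule absZ_summable[OF g \<psi>1])
  have s2: "(\<lambda>n::int. complex_of_real (g (of_int n - real r)) * \<psi> n) summable_on UNIV" for r
    by (rule absZ_summable[OF absZ_shift[OF g] \<psi>1])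
  have s3: "(\<lambda>n::int. of_real (g (of_int n)) * \<psi> (n + int r)) summable_on UNIV" for r
    by (rule absZ_summable[OF g]) (rule \<psi>1)
  let ?S = "infsum (\<lambda>n::int. complex_of_real (g (of_int n))) UNIV"
  have h3: "((\<lambda>n. \<Sum>r<q. complex_of_real (g (of_int n)) * \<psi> (n + int r)) has_sum (\<Sum>r<q. infsum (\<lambda>n. complex_of_real (g (of_int n)) * \<psi> (n + int r)) UNIV)) UNIV"
    by (intro has_sum_finite_sum has_sum_infsum s3) auto
  have h4: "((\<lambda>n. \<Sum>r<q. complex_of_real (g (of_int n)) * \<psi> (n + int r)) has_sum (?S * ?G)) UNIV"
  proof -
    have "((\<lambda>n. complex_of_real (g (of_int n)) * ?G) has_sum (?S * ?G)) UNIV"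
      by (intro has_sum_cmult_left has_sum_infsum absZ_summable(2)[OF g \<psi>1])
    moreover have "(\<Sum>r<q. complex_of_real (g (of_int n)) * \<psi> (n + int r)) = complex_of_real (g (of_int n)) * ?G" for n
      by (simp only: sum_distrib_left[symmetric] periodic_sum_shift[of \<psi> q, OF per])
    ultimately show ?thesis by simp
  qed
  have "((\<lambda>n. \<Sum>r<q. complex_of_real (g (of_int n - real r)) * \<psi> n) has_sum (\<Sum>r<q. infsum (\<lambda>n. complex_of_real (g (of_int n - real r)) * \<psi> n) UNIV)) UNIV"
    by (intro has_sum_finite_sum has_sum_infsum s2) auto
  also have "(\<Sum>r<q. infsum (\<lambda>n. complex_of_real (g (of_int n - real r)) * \<psi> n) UNIV) = (\<Sum>r<q. infsum (\<lambda>n. complex_of_real (g (of_int n)) * \<psi> (n + int r)) UNIV)"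
  proof (rule sum.cong[OF refl])
    fix r
    show "infsum (\<lambda>n::int. of_real (g (of_int n - real r)) * \<psi> n) UNIV = infsum (\<lambda>n::int. of_real (g (of_int n)) * \<psi> (n + int r)) UNIV"
      using summable_on_int_shift(2)[of "\<lambda>n::int. complex_of_real (g (of_int n - real r)) * \<psi> n" "int r"] by simp
  qed
  also have "\<dots> = ?S * ?G" by (rule has_sum_unique[OF h3 h4])
  finally have "((\<lambda>n. - (1 / of_nat q) * (\<Sum>r<q. complex_of_real (g (of_int n - real r)) * \<psi> n)) has_sum (- (1 / of_nat q) * (?S * ?G))) UNIV"
    by (rule has_sum_cmult_right)
  from has_sum_add[OF has_sum_infsum[OF s1] this]
  have "((\<lambda>n. of_real (g (of_int n)) * \<psi> n + - (1 / of_nat q) * (\<Sum>r<q. complex_of_real (g (of_int n - real r)) * \<psi> n)) has_sum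
      (infsum (\<lambda>n. of_real (g (of_int n)) * \<psi> n) UNIV + - (1 / of_nat q) * (?S * ?G))) UNIV" .
  moreover have "of_real (g (of_int n)) * \<psi> n + - (1 / of_nat q) * (\<Sum>r<q. complex_of_real (g (of_int n - real r)) * \<psi> n)
      = of_real (avgT q g (of_int n)) * \<psi> n" for n
    unfolding avgT_def sum_distrib_right[symmetric] by (simp add: field_simps q)
  moreover have "infsum (\<lambda>n. of_real (g (of_int n)) * \<psi> n) UNIV + - (1 / of_nat q) * (?S * ?G) = perErr q \<psi> g"
    unfolding perErr_def by (simp add: mult_ac)
  ultimately show ?thesis by (simp add: infsumI)
qed

lemma avgT_sum_zero:
  assumes g: "absZ g" and q: "q > 0"
  shows "infsum (\<lambda>n::int. complex_of_real (avgT q g (of_int n))) UNIV = 0"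
  using avgT_sums[OF g q, of "\<lambda>_. 1"] q by (simp add: perErr_def)

text \<open>One application makes the total mass of the weight zero and its sum against \<psi> equal
  to the old error, so the new error is the old one.\<close>

lemma perErr_avgT_iter:
  assumes g: "absZ g" and q: "q > 0" and \<psi>1: "\<And>n. cmod (\<psi> n) \<le> 1" and per: "\<And>n. \<psi> (n + int q) = \<psi> n"
  shows "absZ ((avgT q ^^ M) g)" "perErr q \<psi> ((avgT q ^^ M) g) = perErr q \<psi> g"
proof (induction M)
  case (Suc M)
  case 1 show ?case using absZ_avgT[OF Suc(1)] by simp
  case 2
  have "perErr q \<psi> (avgT q ((avgT q ^^ M) g)) = infsum (\<lambda>n. of_real (avgT q ((avgT q ^^ M) g) (of_int n)) * \<psi> n) UNIV"
    unfolding perErr_def[of _ _ "avgT q ((avgT q ^^ M) g)"] using avgT_sum_zero[OF Suc(1) q] by simp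
  also have "\<dots> = perErr q \<psi> g" using avgT_sums[where \<psi> = \<psi>, OF Suc(1) q \<psi>1 per] Suc(2) by simp
  finally show ?case by simp
qed (use g in auto)

lemma perErr_bound:
  assumes g: "absZ g" and q: "q > 0" and \<psi>1: "\<And>n. cmod (\<psi> n) \<le> 1" and per: "\<And>n. \<psi> (n + int q) = \<psi> n" and M: "M > 0"
    and c: "0 < c" "c \<le> 1" and A: "\<And>n::int. \<bar>(avgT q ^^ M) g (of_int n)\<bar> \<le> A * wt c (of_int n)"
  shows "cmod (perErr q \<psi> g) \<le> A * (3 / c)"
proof -
  \<comment> \<open>The last application is set apart: it turns the error into a plain sum that can
    be bounded termwise. This is why M must be positive.\<close>
  obtain M' where M': "M = Suc M'" using M gr0_conv_Suc by blast
  let ?h = "(avgT q ^^ M) g"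
  have A0: "A \<ge> 0"
    using A[of 0] wt_pos[of c 0] c by (smt (verit) abs_ge_zero mult_less_0_iff of_int_0 less_imp_le)
  have h: "absZ ?h" by (rule perErr_avgT_iter(1)[where \<psi> = \<psi>, OF g q \<psi>1 per])
  have "perErr q \<psi> g = infsum (\<lambda>n. of_real (?h (of_int n)) * \<psi> n) UNIV"
  proof -
    have "perErr q \<psi> g = perErr q \<psi> ((avgT q ^^ M') g)" by (rule perErr_avgT_iter(2)[where \<psi> = \<psi>, OF g q \<psi>1 per, symmetric])
    also have "\<dots> = infsum (\<lambda>n. of_real (avgT q ((avgT q ^^ M') g) (of_int n)) * \<psi> n) UNIV"
      by (rule avgT_sums[where \<psi> = \<psi>, OF perErr_avgT_iter(1)[where \<psi> = \<psi>, OF g q \<psi>1 per] q \<psi>1 per, symmetric])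
    finally show ?thesis by (simp add: M')
  qed
  also have "cmod \<dots> \<le> infsum (\<lambda>n. A * wt c (of_int n)) (UNIV :: int set)"
  proof (rule norm_infsum_le)
    show "((\<lambda>n. of_real (?h (of_int n)) * \<psi> n) has_sum infsum (\<lambda>n. of_real (?h (of_int n)) * \<psi> n) UNIV) UNIV"
      by (rule has_sum_infsum, rule absZ_summable[OF h \<psi>1])
    show "((\<lambda>n. A * wt c (of_int n)) has_sum infsum (\<lambda>n. A * wt c (of_int n)) (UNIV :: int set)) UNIV"
      by (intro has_sum_infsum summable_on_cmult_right wt_int_sum c)
    show "cmod (of_real (?h (of_int n)) * \<psi> n) \<le> A * wt c (of_int n)" for n
    proof -
      have "cmod (of_real (?h (of_int n)) * \<psi> n) \<le> \<bar>?h (of_int n)\<bar> * 1"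
        unfolding norm_mult norm_of_real by (intro mult_left_mono \<psi>1) auto
      then show ?thesis using A[of n] by simp
    qed
  qed
  also have "\<dots> = A * infsum (\<lambda>n. wt c (of_int n)) (UNIV :: int set)" by (intro infsum_cmult_right wt_int_sum c)
  also have "\<dots> \<le> A * (3 / c)" using A0 by (intro mult_left_mono wt_int_sum c)
  finally show ?thesis .
qed

subsection \<open>Gauss sums and the theta function at rational points\<close>

text \<open>Hermite polynomials in the physicists' normalisation, up to the sign (-1)^i; the
  recursion is the product rule for p(v) exp(-v^2).\<close>

fun hermp :: "nat \<Rightarrow> real poly" where
  "hermp 0 = 1" | "hermp (Suc i) = pderiv (hermp i) - [:0, 2:] * hermp i"

definition gaussD :: "real \<Rightarrow> nat \<Rightarrow> real \<Rightarrow> real" where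
  "gaussD c i u = c ^ i * (poly (hermp i) (c * u) * exp (- (c * u)\<^sup>2))"

lemma gaussD_deriv: "(gaussD c i has_real_derivative gaussD c (Suc i) u) (at u)"
proof -
  have d: "((\<lambda>u. c ^ i * (poly (hermp i) (c * u) * exp (- (c * u)\<^sup>2))) has_real_derivative
     c ^ i * (poly (pderiv (hermp i)) (c * u) * c * exp (- (c * u)\<^sup>2) + exp (- (c * u)\<^sup>2) * (- (2 * (c * u) * c)) * poly (hermp i) (c * u))) (at u)"
    by (auto intro!: derivative_eq_intros DERIV_chain2[OF poly_DERIV] simp: algebra_simps power2_eq_square)
  have eq: "c ^ i * (poly (pderiv (hermp i)) (c * u) * c * exp (- (c * u)\<^sup>2) + exp (- (c * u)\<^sup>2) * (- (2 * (c * u) * c)) * poly (hermp i) (c * u)) = gaussD c (Suc i) u"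
    by (simp add: gaussD_def algebra_simps)
  have "gaussD c i = (\<lambda>u. c ^ i * (poly (hermp i) (c * u) * exp (- (c * u)\<^sup>2)))" by (rule ext) (simp add: gaussD_def)
  then show ?thesis using d unfolding eq by (simp only:)
qed

lemma poly_growth: "\<exists>A n. A \<ge> 0 \<and> (\<forall>v. \<bar>poly p v\<bar> \<le> A * (1 + \<bar>v\<bar>) ^ n)" for p :: "real poly"
proof (induction p)
  case 0
  then show ?case by (intro exI[of _ 0]) auto
next
  case (pCons a p)
  then obtain A n where A: "A \<ge> 0" "\<And>v. \<bar>poly p v\<bar> \<le> A * (1 + \<bar>v\<bar>) ^ n" by blast
  have "\<bar>poly (pCons a p) v\<bar> \<le> (\<bar>a\<bar> + A) * (1 + \<bar>v\<bar>) ^ Suc n" for v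
  proof -
    have "\<bar>poly (pCons a p) v\<bar> \<le> \<bar>a\<bar> + \<bar>v\<bar> * \<bar>poly p v\<bar>" using abs_triangle_ineq[of a "v * poly p v"] by (simp add: abs_mult)
    also have "\<dots> \<le> \<bar>a\<bar> * (1 + \<bar>v\<bar>) ^ Suc n + (1 + \<bar>v\<bar>) * (A * (1 + \<bar>v\<bar>) ^ n)"
    proof (intro add_mono mult_mono A)
      show "\<bar>a\<bar> \<le> \<bar>a\<bar> * (1 + \<bar>v\<bar>) ^ Suc n"
        using mult_left_mono[OF one_le_power[of "1 + \<bar>v\<bar>" "Suc n"], of "\<bar>a\<bar>"] by simp
    qed auto
    finally show ?thesis by (simp add: algebra_simps)
  qed
  then show ?case using A(1) by (intro exI[of _ "\<bar>a\<bar> + A"] exI[of _ "Suc n"]) auto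
qed

lemma power_gauss_bounded: "(1 + \<bar>v\<bar>) ^ N * exp (- v\<^sup>2) \<le> fact N * exp 2" for v :: real
proof -
  have "(1 + \<bar>v\<bar>) ^ N / fact N \<le> exp (1 + \<bar>v\<bar>)"
  proof -
    have "(\<Sum>n\<in>{N}. inverse (fact n) *\<^sub>R (1 + \<bar>v\<bar>) ^ n) \<le> (\<Sum>n. inverse (fact n) *\<^sub>R (1 + \<bar>v\<bar>) ^ n)"
      by (intro sum_le_suminf summable_exp_generic) auto
    then show ?thesis unfolding exp_def by (simp add: field_simps)
  qed
  then have "(1 + \<bar>v\<bar>) ^ N \<le> fact N * exp (1 + \<bar>v\<bar>)" by (simp add: field_simps)
  then have "(1 + \<bar>v\<bar>) ^ N * exp (- v\<^sup>2) \<le> fact N * exp (1 + \<bar>v\<bar>) * exp (- v\<^sup>2)" by (intro mult_right_mono) auto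
  also have "\<dots> = fact N * exp (1 + \<bar>v\<bar> - v\<^sup>2)" by (simp add: exp_diff exp_minus divide_inverse)
  also have "\<dots> \<le> fact N * exp 2"
  proof -
    have "0 \<le> (\<bar>v\<bar> - 1/2)\<^sup>2" by simp
    then have "\<bar>v\<bar> - v\<^sup>2 \<le> 1/4" by (simp add: power2_eq_square algebra_simps abs_mult_self_eq)
    then show ?thesis by (intro mult_left_mono) auto
  qed
  finally show ?thesis .
qed

lemma gaussD_bound: "\<exists>C\<ge>0. \<forall>c u. c \<ge> 0 \<longrightarrow> \<bar>gaussD c i u\<bar> \<le> C * c ^ i * wt c u"
proof -
  obtain A n where A: "A \<ge> 0" "\<And>v. \<bar>poly (hermp i) v\<bar> \<le> A * (1 + \<bar>v\<bar>) ^ n" using poly_growth by blast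
  have "\<bar>gaussD c i u\<bar> \<le> (A * (fact (n + 2) * exp 2)) * c ^ i * wt c u" if c: "c \<ge> 0" for c u
  proof -
    define v where "v = c * u"
    have av: "\<bar>v\<bar> = c * \<bar>u\<bar>" using c by (simp add: v_def abs_mult)
    have v1: "1 + \<bar>v\<bar> > 0" by linarith
    have "\<bar>poly (hermp i) v * exp (- v\<^sup>2)\<bar> \<le> A * (1 + \<bar>v\<bar>) ^ n * exp (- v\<^sup>2)"
      unfolding abs_mult using A by (intro mult_mono) auto
    also have "\<dots> = A * ((1 + \<bar>v\<bar>) ^ (n + 2) * exp (- v\<^sup>2)) / (1 + \<bar>v\<bar>)\<^sup>2"
    proof -
      have "(1 + \<bar>v\<bar>) ^ (n + 2) = (1 + \<bar>v\<bar>) ^ n * (1 + \<bar>v\<bar>)\<^sup>2" by (rule power_add)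
      then show ?thesis using v1 by (simp only:) simp
    qed
    also have "\<dots> \<le> A * (fact (n + 2) * exp 2) / (1 + \<bar>v\<bar>)\<^sup>2"
      using A(1) by (intro divide_right_mono mult_left_mono power_gauss_bounded) auto
    also have "\<dots> = A * (fact (n + 2) * exp 2) * wt c u" by (simp add: wt_def av)
    finally have "c ^ i * \<bar>poly (hermp i) v * exp (- v\<^sup>2)\<bar> \<le> c ^ i * (A * (fact (n + 2) * exp 2) * wt c u)"
      using c by (intro mult_left_mono) auto
    then show ?thesis unfolding gaussD_def v_def[symmetric] using c by (simp add: abs_mult mult_ac)
  qed
  moreover have "A * (fact (n + 2) * exp 2) \<ge> 0" using A by simp
  ultimately show ?thesis by blast
qed

section \<open>Roots of unity and Gauss sums\<close>

definition rootq :: "nat \<Rightarrow> int \<Rightarrow> complex" where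
  "rootq q k = cis (2 * pi * of_int k / real q)"

lemma rootq_add: "rootq q (k + l) = rootq q k * rootq q l"
  by (simp add: rootq_def cis_mult ring_distribs add_divide_distrib)

lemma rootq_0 [simp]: "rootq q 0 = 1" by (simp add: rootq_def)

lemma rootq_cnj: "cnj (rootq q k) = rootq q (- k)"
  by (simp add: rootq_def cis_cnj)

lemma norm_rootq [simp]: "cmod (rootq q k) = 1" by (simp add: rootq_def)

lemma rootq_power: "rootq q (k * int t) = rootq q k ^ t"
  by (induction t) (auto simp: rootq_add algebra_simps)

lemma rootq_eq_1_iff: assumes "q > 0" shows "rootq q k = 1 \<longleftrightarrow> int q dvd k"
proof -
  have "rootq q k = 1 \<longleftrightarrow> (\<exists>n::int. 2 * pi * of_int k / real q = of_int (2 * n) * pi)"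
    unfolding rootq_def cis_conv_exp exp_eq_1 by simp
  also have "\<dots> \<longleftrightarrow> (\<exists>n::int. real_of_int k = of_int (n * int q))"
    using assms by (intro ex_cong1) (auto simp: field_simps)
  also have "\<dots> \<longleftrightarrow> int q dvd k" unfolding of_int_eq_iff by (auto simp: dvd_def mult.commute)
  finally show ?thesis .
qed

lemma rootq_mult_q: "q > 0 \<Longrightarrow> rootq q (k * int q) = 1"
  by (simp add: rootq_eq_1_iff)

lemma rootq_sum:
  assumes q: "q > 0"
  shows "(\<Sum>t<q. rootq q (k * int t)) = (if int q dvd k then of_nat q else 0)"
proof (cases "int q dvd k")
  case True
  then have "rootq q k = 1" using rootq_eq_1_iff[OF q] by simp
  then show ?thesis using True by (simp add: rootq_power)
next
  case False
  then have ne: "rootq q k \<noteq> 1" using rootq_eq_1_iff[OF q] by simp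
  have "(\<Sum>t<q. rootq q (k * int t)) = (rootq q k ^ q - 1) / (rootq q k - 1)"
    unfolding rootq_power using ne by (rule geometric_sum)
  also have "rootq q k ^ q = 1" using rootq_power[of q k q] rootq_mult_q[OF q] by simp
  finally show ?thesis using False by simp
qed

definition quadchar :: "nat \<Rightarrow> int \<Rightarrow> int \<Rightarrow> complex" where
  "quadchar q p n = rootq q (n\<^sup>2 * p)"

lemma quadchar_periodic: "q > 0 \<Longrightarrow> quadchar q p (n + int q) = quadchar q p n"
proof -
  assume q: "q > 0"
  have "(n + int q)\<^sup>2 * p = n\<^sup>2 * p + ((2 * n + int q) * p) * int q" by (simp add: power2_eq_square algebra_simps)
  then show ?thesis unfolding quadchar_def by (simp only: rootq_add rootq_mult_q[OF q]) simp
qed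

text \<open>In the squared modulus put r = t + d. The inner sum over t is geometric and vanishes
  unless q divides 2dp; q odd and prime to p leaves d = 0 alone.\<close>

lemma gauss_sum_norm:
  assumes q: "q > 0" "odd q" and cop: "coprime p (int q)"
  shows "cmod (\<Sum>r<q. quadchar q p (int r)) = sqrt (real q)"
proof -
  let ?G = "\<Sum>r<q. quadchar q p (int r)"
  have "?G * cnj ?G = (\<Sum>t<q. (\<Sum>r<q. quadchar q p (int r)) * cnj (quadchar q p (int t)))"
    by (simp add: sum_distrib_left)
  also have "\<dots> = (\<Sum>t<q. \<Sum>d<q. quadchar q p (int t + int d) * cnj (quadchar q p (int t)))"
    by (simp only: sum_distrib_right[symmetric] periodic_sum_shift[of "quadchar q p" q, OF quadchar_periodic[OF q(1)]])
  also have "\<dots> = (\<Sum>t<q. \<Sum>d<q. quadchar q p (int d) * rootq q ((2 * int d * p) * int t))"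
  proof (intro sum.cong refl)
    fix t d
    have "(int t + int d)\<^sup>2 * p + - ((int t)\<^sup>2 * p) = (int d)\<^sup>2 * p + (2 * int d * p) * int t"
      by (simp add: power2_eq_square algebra_simps)
    then show "quadchar q p (int t + int d) * cnj (quadchar q p (int t)) = quadchar q p (int d) * rootq q ((2 * int d * p) * int t)"
      unfolding quadchar_def rootq_cnj by (metis rootq_add)
  qed
  also have "\<dots> = (\<Sum>d<q. quadchar q p (int d) * (\<Sum>t<q. rootq q ((2 * int d * p) * int t)))"
    by (subst sum.swap) (simp only: sum_distrib_left)
  also have "\<dots> = (\<Sum>d<q. if d = 0 then of_nat q else 0)"
  proof (intro sum.cong refl)
    fix d assume d: "d \<in> {..<q}"
    have "int q dvd 2 * int d * p \<longleftrightarrow> d = 0"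
    proof
      assume "int q dvd 2 * int d * p"
      then have "int q dvd 2 * int d" using cop by (simp add: coprime_dvd_mult_left_iff coprime_commute)
      moreover have "coprime (int q) 2" using q(2) by simp
      ultimately have "int q dvd int d" by (simp add: coprime_dvd_mult_right_iff)
      then have "q dvd d" by simp
      then show "d = 0" using d dvd_imp_le by fastforce
    qed simp
    then show "quadchar q p (int d) * (\<Sum>t<q. rootq q ((2 * int d * p) * int t)) = (if d = 0 then of_nat q else 0)"
      unfolding rootq_sum[OF q(1)] by (simp add: quadchar_def)
  qed
  also have "\<dots> = of_nat q" using q by simp
  finally have "complex_of_real ((cmod ?G)\<^sup>2) = of_real (real q)" by (simp only: complex_norm_square of_real_of_nat_eq)
  then have "(cmod ?G)\<^sup>2 = real q" by (simp only: of_real_eq_iff)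
  then show ?thesis by (metis norm_ge_zero real_sqrt_abs abs_of_nonneg)
qed

text \<open>Over all integers the sum is the mean of the quadratic character, of modulus 1/sqrt q,
  times the mass of the Gaussian, of order 1/c, up to the error for periodic sequences. Evenness and
  the value 1 at n = 0 give 1 + 2 \<theta>, which explains the -1 and the final halving. The
  parameter M stays free so that qc may be only slightly below 1.\<close>

lemma theta_lower_bound:
  assumes M: "M > 0"
  shows "\<exists>C\<ge>0. \<forall>q p c. q > 0 \<longrightarrow> odd q \<longrightarrow> coprime p (int q) \<longrightarrow> 0 < c \<longrightarrow> c \<le> 1 \<longrightarrow> real q * c \<le> 1 \<longrightarrow>
     summable (\<lambda>n. exp (- (c * real (Suc n))\<^sup>2)) \<and>
     cmod (\<Sum>n. of_real (exp (- (c * real (Suc n))\<^sup>2)) * quadchar q p (int (Suc n)))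
       \<ge> (exp (-1) / (c * sqrt (real q)) - C * (real q * c) ^ M / c - 1) / 2"
proof -
  obtain C where C0: "C \<ge> 0" and C: "\<And>c u. c \<ge> 0 \<Longrightarrow> \<bar>gaussD c M u\<bar> \<le> C * c ^ M * wt c u" using gaussD_bound[of M] by blast
  obtain B where B0: "B \<ge> 0" and B: "\<And>c u. c \<ge> 0 \<Longrightarrow> \<bar>gaussD c 0 u\<bar> \<le> B * c ^ 0 * wt c u" using gaussD_bound[of 0] by blast
  define C' where "C' = 3 * C * (1 + real M)\<^sup>2"
  have "summable (\<lambda>n. exp (- (c * real (Suc n))\<^sup>2)) \<and> cmod (\<Sum>n. of_real (exp (- (c * real (Suc n))\<^sup>2)) * quadchar q p (int (Suc n)))
       \<ge> (exp (-1) / (c * sqrt (real q)) - C' * (real q * c) ^ M / c - 1) / 2"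
    if q: "q > 0" "odd q" and cop: "coprime p (int q)" and c: "0 < c" "c \<le> 1" "real q * c \<le> 1" for q p c
  proof -
    let ?F = "gaussD c 0" and ?\<psi> = "quadchar q p"
    have F: "?F u = exp (- (c * u)\<^sup>2)" for u by (simp add: gaussD_def)
    have F0: "?F u > 0" for u by (simp add: F)
    have Fle: "?F u \<le> B * wt c u" for u using B[of c u] c F0[of u] by simp
    have \<psi>1: "cmod (?\<psi> n) \<le> 1" for n by (simp add: quadchar_def)
    note per = quadchar_periodic[OF q(1), of p]
    have sW: "(\<lambda>n::int. B * wt c (of_int n)) summable_on UNIV" by (intro summable_on_cmult_right wt_int_sum c)
    have absF: "absZ ?F" unfolding absZ_def
      by (rule summable_on_comparison_test[OF sW]) (use Fle less_imp_le[OF F0] in auto)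
    have s1: "summable (\<lambda>n. ?F (real (Suc n)))"
      by (rule summable_comparison_test[of _ "\<lambda>n. B * wt c (real (Suc n))"])
         (use Fle less_imp_le[OF F0] wt_sum(1)[OF c(1)] in \<open>auto intro!: summable_mult exI[of _ 0]\<close>)
    have s0: "summable (\<lambda>n. ?F (real n))" using s1 summable_Suc_iff[of "\<lambda>n. ?F (real n)"] by blast
    define th where "th = (\<Sum>n. of_real (?F (real (Suc n))) * ?\<psi> (int (Suc n)))"
    have nrm: "cmod (of_real (?F u) * ?\<psi> n) = ?F u" for u n using less_imp_le[OF F0[of u]] by (simp add: norm_mult quadchar_def)
    have even: "?\<psi> (- n) = ?\<psi> n" "?F (- u) = ?F u" for n u by (simp_all add: quadchar_def F)
    have sth: "summable (\<lambda>n. of_real (?F (real (Suc n))) * ?\<psi> (int (Suc n)))"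
      by (rule summable_norm_cancel) (simp only: nrm s1)
    have tot: "infsum (\<lambda>n. of_real (?F (of_int n)) * ?\<psi> n) UNIV = 1 + 2 * th"
    proof -
      have "((\<lambda>n. of_real (?F (of_int n)) * ?\<psi> n) has_sum ((\<Sum>n. of_real (?F (of_int (int n))) * ?\<psi> (int n)) + (\<Sum>n. of_real (?F (of_int (- int (Suc n)))) * ?\<psi> (- int (Suc n))))) UNIV"
        by (rule has_sum_int) (simp_all only: nrm of_int_of_nat_eq of_int_minus even s0 s1)
      then have "infsum (\<lambda>n. of_real (?F (of_int n)) * ?\<psi> n) UNIV = (\<Sum>n. of_real (?F (real n)) * ?\<psi> (int n)) + th"
        unfolding th_def by (simp only: infsumI of_int_of_nat_eq of_int_minus even)
      also have "(\<Sum>n. of_real (?F (real n)) * ?\<psi> (int n)) = th + of_real (?F (real 0)) * ?\<psi> (int 0)"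
        unfolding th_def using suminf_split_head[of "\<lambda>n. of_real (?F (real n)) * ?\<psi> (int n)"] sth
          summable_Suc_iff[of "\<lambda>n. of_real (?F (real n)) * ?\<psi> (int n)"] by (simp only: diff_add_cancel)
      also have "of_real (?F (real 0)) * ?\<psi> (int 0) = 1" by (simp add: F quadchar_def)
      finally show ?thesis by simp
    qed
    define S where "S = infsum (\<lambda>n::int. ?F (of_int n)) UNIV"
    have sF: "(\<lambda>n::int. ?F (of_int n)) summable_on UNIV" using absF less_imp_le[OF F0] unfolding absZ_def by simp
    have SC: "infsum (\<lambda>n::int. complex_of_real (?F (of_int n))) UNIV = of_real S"
      unfolding S_def using infsumI[OF has_sum_of_real[OF has_sum_infsum[OF sF]]] by simp
    have S: "S \<ge> exp (-1) / c"
    proof -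
      \<comment> \<open>Only the terms 0 <= n <= 1/c are kept; each is at least exp(-1).\<close>
      define N where "N = nat \<lfloor>1 / c\<rfloor>"
      have N: "real N \<le> 1 / c" "1 / c \<le> real N + 1" unfolding N_def using c by (auto simp: less_imp_le)
      have "exp (-1) / c \<le> (real N + 1) * exp (-1)" using mult_right_mono[OF N(2), of "exp (-1)"] by simp
      also have "\<dots> = (\<Sum>n\<in>{0..int N}. exp (-1))" by simp
      also have "\<dots> \<le> (\<Sum>n\<in>{0..int N}. ?F (of_int n))"
      proof (rule sum_mono)
        fix n assume n: "n \<in> {0..int N}"
        have "real_of_int n \<le> 1 / c" using n N(1) by (simp add: le_trans)
        then have "c * of_int n \<le> 1" using c by (simp add: field_simps)
        then have "(c * of_int n)\<^sup>2 \<le> 1" using n c by (intro power_le_one) auto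
        then show "exp (-1) \<le> ?F (of_int n)" by (simp add: F)
      qed
      also have "\<dots> \<le> S" unfolding S_def
        by (rule finite_sum_le_infsum[OF sF]) (use F0 in \<open>auto intro: less_imp_le\<close>)
      finally show ?thesis .
    qed
    have err: "cmod (perErr q ?\<psi> ?F) \<le> (C * (1 + real M)\<^sup>2 * (real q * c) ^ M) * (3 / c)"
    proof (rule perErr_bound[where \<psi> = ?\<psi> and M = M, OF absF q(1) \<psi>1 per M c(1,2)])
      fix n :: int
      have "\<bar>(avgT q ^^ M) (gaussD c 0) (of_int n)\<bar> \<le> real q ^ M * (C * c ^ M * ((1 + real M)\<^sup>2 * wt c (of_int n)))"
      proof (rule avgT_iter_bound[where D = "gaussD c", OF q(1) gaussD_deriv])
        fix v :: real assume v: "of_int n - real (M * q) \<le> v" "v \<le> of_int n"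
        have "\<bar>gaussD c (0 + M) v\<bar> \<le> C * c ^ M * wt c v" using C[of c v] c by simp
        also have "wt c v \<le> (1 + real M)\<^sup>2 * wt c (of_int n)"
        proof -
          \<comment> \<open>The M averages look back by at most Mq, that is by M/c as qc <= 1, which
            costs the factor (1+M)^2 in the weight.\<close>
          have "\<bar>of_int n\<bar> \<le> \<bar>v\<bar> + real M * real q" using v by simp
          then have "c * \<bar>of_int n\<bar> \<le> c * \<bar>v\<bar> + real M * (real q * c)"
            using mult_left_mono[of "\<bar>of_int n\<bar>" "\<bar>v\<bar> + real M * real q" c] c by (simp add: algebra_simps)
          also have "real M * (real q * c) \<le> real M * 1" using c by (intro mult_left_mono) auto
          finally have "1 + c * \<bar>of_int n\<bar> \<le> 1 + c * \<bar>v\<bar> + real M" by simp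
          also have "\<dots> \<le> (1 + real M) * (1 + c * \<bar>v\<bar>)" using c by (simp add: algebra_simps)
          finally have le: "1 + c * \<bar>of_int n\<bar> \<le> (1 + real M) * (1 + c * \<bar>v\<bar>)" .
          have p1: "0 < 1 + c * \<bar>of_int n\<bar>" "0 < 1 + c * \<bar>v\<bar>" using c by (auto intro: add_pos_nonneg)
          have "(1 + c * \<bar>of_int n\<bar>)\<^sup>2 \<le> ((1 + real M) * (1 + c * \<bar>v\<bar>))\<^sup>2" using le p1 by (intro power_mono) auto
          then have "1 / (1 + c * \<bar>v\<bar>)\<^sup>2 \<le> (1 + real M)\<^sup>2 / (1 + c * \<bar>of_int n\<bar>)\<^sup>2"
            using p1 by (simp add: divide_simps power_mult_distrib mult_ac)
          then show ?thesis by (simp add: wt_def)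
        qed
        finally show "\<bar>gaussD c (0 + M) v\<bar> \<le> C * c ^ M * ((1 + real M)\<^sup>2 * wt c (of_int n))"
          using C0 c by (simp add: mult_left_mono)
      qed
      then show "\<bar>(avgT q ^^ M) (gaussD c 0) (of_int n)\<bar> \<le> C * (1 + real M)\<^sup>2 * (real q * c) ^ M * wt c (of_int n)"
        by (simp add: power_mult_distrib mult_ac)
    qed
    have main: "cmod ((\<Sum>r<q. ?\<psi> (int r)) / of_nat q * of_real S) \<ge> exp (-1) / (c * sqrt (real q))"
    proof -
      have "cmod ((\<Sum>r<q. ?\<psi> (int r)) / of_nat q * of_real S) = sqrt (real q) / real q * \<bar>S\<bar>"
        by (simp add: norm_mult norm_divide gauss_sum_norm[OF q cop])
      also have "sqrt (real q) / real q = 1 / sqrt (real q)" using q by (simp add: real_div_sqrt field_simps)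
      also have "1 / sqrt (real q) * \<bar>S\<bar> \<ge> 1 / sqrt (real q) * (exp (-1) / c)" using S by (intro mult_left_mono) auto
      finally show ?thesis by (simp add: mult.commute)
    qed
    have "1 + 2 * th = perErr q ?\<psi> ?F + (\<Sum>r<q. ?\<psi> (int r)) / of_nat q * of_real S"
      unfolding perErr_def tot SC by simp
    then have "(\<Sum>r<q. ?\<psi> (int r)) / of_nat q * of_real S = 1 + 2 * th - perErr q ?\<psi> ?F" by simp
    then have "cmod ((\<Sum>r<q. ?\<psi> (int r)) / of_nat q * of_real S) \<le> cmod (1 + 2 * th) + cmod (perErr q ?\<psi> ?F)"
      using norm_triangle_ineq4 by metis
    also have "cmod (1 + 2 * th) \<le> 1 + 2 * cmod th" using norm_triangle_ineq[of 1 "2 * th"] by (simp add: norm_mult)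
    finally have "exp (-1) / (c * sqrt (real q)) \<le> 1 + 2 * cmod th + C * (1 + real M)\<^sup>2 * (real q * c) ^ M * (3 / c)"
      using main err by linarith
    moreover have "C * (1 + real M)\<^sup>2 * (real q * c) ^ M * (3 / c) = C' * (real q * c) ^ M / c" by (simp add: C'_def)
    ultimately have "exp (-1) / (c * sqrt (real q)) \<le> 1 + 2 * cmod th + C' * (real q * c) ^ M / c" by (simp only:)
    then have "cmod th \<ge> (exp (-1) / (c * sqrt (real q)) - C' * (real q * c) ^ M / c - 1) / 2" by simp
    then show ?thesis unfolding th_def using s1 by (simp add: F)
  qed
  moreover have "C' \<ge> 0" unfolding C'_def using C0 by simp
  ultimately show ?thesis by blast
qed

subsection \<open>A kernel of fractional differentiation\<close>

text \<open>The k-th Taylor coefficient of (1-z)^(-(s+1)), which grows like a constant times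
  k^s.\<close>

definition kap :: "real \<Rightarrow> nat \<Rightarrow> real" where
  "kap s k = pochhammer (s + 1) k / fact k"

lemma kap_pos: "s > 0 \<Longrightarrow> kap s k > 0"
  unfolding kap_def by (intro divide_pos_pos pochhammer_pos) auto

lemma kap_Suc: "kap s (Suc k) = kap s k * (1 + s / real (Suc k))"
  unfolding kap_def by (simp add: pochhammer_Suc field_simps)

lemma kap_gbinomial: "(complex_of_real (- (s + 1)) gchoose k) * (- z) ^ k = of_real (kap s k) * z ^ k"
proof -
  have "(complex_of_real (- (s + 1)) gchoose k) = (-1) ^ k * pochhammer (complex_of_real (s + 1)) k / fact k"
    by (simp add: gbinomial_pochhammer add.commute)
  also have "pochhammer (complex_of_real (s + 1)) k = of_real (pochhammer (s + 1) k)"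
    by (simp only: pochhammer_of_real)
  finally show ?thesis
    unfolding kap_def by (simp add: power_mult_distrib[symmetric] mult_ac)
qed

lemma kap_sums:
  assumes "cmod z < 1"
  shows "(\<lambda>k. of_real (kap s k) * z ^ k) sums ((1 - z) powr (of_real (- (s + 1))))"
  using gen_binomial_complex[of "- z" "of_real (- (s + 1))"] assms unfolding kap_gbinomial by simp

lemma kap_summable:
  assumes "0 \<le> r" "r < 1"
  shows "summable (\<lambda>k. kap s k * r ^ k)"
proof -
  have "summable (\<lambda>k. complex_of_real (kap s k * r ^ k))"
    using kap_sums[of "of_real r" s] assms by (auto simp: sums_iff)
  then show ?thesis by (simp only: summable_of_real_iff)
qed

definition kz :: "real \<Rightarrow> real \<Rightarrow> complex" where
  "kz a t = of_real (exp (- a)) * cis (- (2 * pi * t))"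

text \<open>Expanded in powers of z = exp(-a) e(-t), the kernel has the frequencies -k with k >= 1
  only. Integration against e(lt) thus multiplies a frequency l >= 1 by about l^s, with Abel damping
  exp(-al), and annihilates l <= 0; subtracting 1 takes care of l = 0.\<close>

definition kern :: "real \<Rightarrow> real \<Rightarrow> real \<Rightarrow> complex" where
  "kern s a t = (1 - kz a t) powr (of_real (- (s + 1))) - 1"

lemma kz_power: "kz a t ^ k = of_real (exp (- a) ^ k) * cis (- (2 * pi * real k * t))"
  unfolding kz_def power_mult_distrib Complex.DeMoivre by (simp add: mult_ac)

lemma kern_sums:
  assumes a: "a > 0"
  shows "(\<lambda>k. of_real (kap s (Suc k) * exp (- a) ^ Suc k) * cis (- (2 * pi * real (Suc k) * t))) sums kern s a t"
proof -
  have "cmod (kz a t) < 1" using a by (simp add: kz_def norm_mult)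
  from kap_sums[OF this, of s] have "(\<lambda>k. of_real (kap s k) * kz a t ^ k) sums ((1 - kz a t) powr (of_real (- (s + 1))))" .
  then have "(\<lambda>k. of_real (kap s (Suc k)) * kz a t ^ Suc k) sums ((1 - kz a t) powr (of_real (- (s + 1))) - of_real (kap s 0) * kz a t ^ 0)"
    by (subst sums_Suc_iff) simp
  moreover have "of_real (kap s (Suc k)) * kz a t ^ Suc k = of_real (kap s (Suc k) * exp (- a) ^ Suc k) * cis (- (2 * pi * real (Suc k) * t))" for k
    unfolding kz_power by simp
  moreover have "of_real (kap s 0) * kz a t ^ 0 = 1" by (simp add: kap_def)
  ultimately show ?thesis unfolding kern_def by (simp only:)
qed

lemma kern_term_bound:
  assumes s: "s > 0"
  shows "cmod (of_real (kap s k * exp (- a) ^ k) * cis x) = kap s k * exp (- a) ^ k"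
  unfolding norm_mult norm_cis norm_of_real using kap_pos[OF s, of k] by simp

lemma kern_summable: "a > 0 \<Longrightarrow> summable (\<lambda>k. kap s (Suc k) * exp (- a) ^ Suc k)"
  using kap_summable[of "exp (- a)" s] by (subst summable_Suc_iff) auto

lemma continuous_on_kern:
  assumes a: "a > 0" and s: "s > 0"
  shows "continuous_on {u..v} (kern s a)"
proof -
  have "continuous_on {u..v} (\<lambda>t. \<Sum>k. of_real (kap s (Suc k) * exp (- a) ^ Suc k) * cis (- (2 * pi * real (Suc k) * t)))"
    by (rule integral_suminf_uniform(2)[OF _ _ kern_summable[OF a, of s]])
       (auto intro!: continuous_intros simp only: kern_term_bound[OF s] order_refl)
  moreover have "(\<Sum>k. of_real (kap s (Suc k) * exp (- a) ^ Suc k) * cis (- (2 * pi * real (Suc k) * t))) = kern s a t" for t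
    using kern_sums[OF a] by (simp only: sums_iff)
  ultimately show ?thesis by simp
qed

lemma kern_fourier:
  fixes l :: int
  assumes a: "a > 0" and s: "s > 0"
  shows "integral {-1/2..1/2} (\<lambda>t. cis (2 * pi * of_int l * t) * kern s a t)
     = (if l \<ge> 1 then of_real (kap s (nat l) * exp (- a) ^ nat l) else 0)"
proof -
  define h where "h = (\<lambda>k t. cis (2 * pi * of_int l * t) * (of_real (kap s (Suc k) * exp (- a) ^ Suc k) * cis (- (2 * pi * real (Suc k) * t))))"
  have "(\<lambda>k. integral {-1/2..1/2} (h k)) sums integral {-1/2..1/2} (\<lambda>t. \<Sum>k. h k t)"
  proof (rule integral_suminf_uniform(1))
    show "continuous_on {-1/2..1/2} (h k)" for k unfolding h_def by (intro continuous_intros)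
    show "cmod (h k t) \<le> kap s (Suc k) * exp (- a) ^ Suc k" for k t
      unfolding h_def norm_mult[of "cis _"] kern_term_bound[OF s] by simp
    show "summable (\<lambda>k. kap s (Suc k) * exp (- a) ^ Suc k)" by (rule kern_summable[OF a])
  qed
  moreover have "(\<Sum>k. h k t) = cis (2 * pi * of_int l * t) * kern s a t" for t
    unfolding h_def using sums_mult[OF kern_sums[OF a, of s t], of "cis (2 * pi * of_int l * t)"] by (simp only: sums_iff)
  moreover have "integral {-1/2..1/2} (h k) = (if k = nat (l - 1) then (if l \<ge> 1 then of_real (kap s (nat l) * exp (- a) ^ nat l) else 0) else 0)" for k
  proof -
    have "h k = (\<lambda>t. of_real (kap s (Suc k) * exp (- a) ^ Suc k) * cis (2 * pi * of_int (l - int (Suc k)) * t))"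
    proof
      fix t
      have "cis (2 * pi * of_int l * t) * cis (- (2 * pi * real (Suc k) * t)) = cis (2 * pi * of_int (l - int (Suc k)) * t)"
        by (simp add: cis_mult algebra_simps)
      then show "h k t = of_real (kap s (Suc k) * exp (- a) ^ Suc k) * cis (2 * pi * of_int (l - int (Suc k)) * t)"
        unfolding h_def mult.left_commute[of "cis (2 * pi * of_int l * t)"] by (simp only:)
    qed
    then have "(h k has_integral of_real (kap s (Suc k) * exp (- a) ^ Suc k) * (if l - int (Suc k) = 0 then 1 else 0)) {-1/2..-1/2+1}"
      by (simp only:) (intro has_integral_mult_right cis_integral_unit)
    then have "integral {-1/2..1/2} (h k) = of_real (kap s (Suc k) * exp (- a) ^ Suc k) * (if l - int (Suc k) = 0 then 1 else 0)"
      by (simp add: integral_unique)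
    moreover have iff: "l - int (Suc k) = 0 \<longleftrightarrow> k = nat (l - 1) \<and> l \<ge> 1" by auto
    ultimately show ?thesis
    proof (cases "k = nat (l - 1) \<and> l \<ge> 1")
      case True
      then have "Suc k = nat l" by auto
      then show ?thesis using True iff \<open>integral {-1/2..1/2} (h k) = _\<close> by (simp only: if_True mult_1_right simp_thms)
    qed auto
  qed
  ultimately have "(\<lambda>k. if k = nat (l - 1) then (if l \<ge> 1 then complex_of_real (kap s (nat l) * exp (- a) ^ nat l) else 0) else 0) sums integral {-1/2..1/2} (\<lambda>t. cis (2 * pi * of_int l * t) * kern s a t)"
    by simp
  moreover have "(\<lambda>k. if k = nat (l - 1) then (if l \<ge> 1 then complex_of_real (kap s (nat l) * exp (- a) ^ nat l) else 0) else 0) sums (if l \<ge> 1 then complex_of_real (kap s (nat l) * exp (- a) ^ nat l) else 0)"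
    using sums_single[of "nat (l - 1)" "\<lambda>_. (if l \<ge> 1 then complex_of_real (kap s (nat l) * exp (- a) ^ nat l) else 0)"] by simp
  ultimately show ?thesis by (rule sums_unique2)
qed

text \<open>At frequency n^2 the multiplier nearly cancels n^(-2s), so what is left is to leading
  order a theta series with damping exp(-a n^2).\<close>

lemma transform_R:
  assumes s: "s > 1/2" and a: "a > 0"
  shows "(\<lambda>n. of_real (real (Suc n) powr (- 2 * s) * kap s ((Suc n)\<^sup>2) * exp (- a) ^ ((Suc n)\<^sup>2)) * cis (2 * pi * real ((Suc n)\<^sup>2) * b))
     sums integral {-1/2..1/2} (\<lambda>t. R s (b + t) * kern s a t)"
proof -
  have s0: "s > 0" using s by simp
  define B where "B = (\<Sum>k. kap s (Suc k) * exp (- a) ^ Suc k)"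
  have KB: "cmod (kern s a t) \<le> B" for t
  proof -
    have "cmod (kern s a t) = cmod (\<Sum>k. of_real (kap s (Suc k) * exp (- a) ^ Suc k) * cis (- (2 * pi * real (Suc k) * t)))"
      using kern_sums[OF a, of s t] by (simp only: sums_iff)
    also have "\<dots> \<le> (\<Sum>k. cmod (of_real (kap s (Suc k) * exp (- a) ^ Suc k) * cis (- (2 * pi * real (Suc k) * t))))"
      by (rule summable_norm) (simp only: kern_term_bound[OF s0] kern_summable[OF a])
    finally show ?thesis by (simp only: kern_term_bound[OF s0] B_def)
  qed
  define h where "h = (\<lambda>n t. rterm s (Suc n) (b + t) * kern s a t)"
  have "(\<lambda>n. integral {-1/2..1/2} (h n)) sums integral {-1/2..1/2} (\<lambda>t. \<Sum>n. h n t)"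
  proof (rule integral_suminf_uniform(1))
    show "continuous_on {-1/2..1/2} (h n)" for n
      unfolding h_def rterm_def by (intro continuous_intros continuous_on_kern a s0)
    show "cmod (h n t) \<le> real (Suc n) powr (- 2 * s) * B" for n t
      unfolding h_def norm_mult norm_rterm by (intro mult_left_mono KB) auto
    show "summable (\<lambda>n. real (Suc n) powr (- 2 * s) * B)" by (intro summable_mult2 summable_rterm_norm s)
  qed
  moreover have "(\<Sum>n. h n t) = R s (b + t) * kern s a t" for t
    unfolding h_def R_eq by (rule suminf_mult2[symmetric]) (use R_sums[OF s] in \<open>auto simp: sums_iff\<close>)
  moreover have "integral {-1/2..1/2} (h n) = of_real (real (Suc n) powr (- 2 * s) * kap s ((Suc n)\<^sup>2) * exp (- a) ^ ((Suc n)\<^sup>2)) * cis (2 * pi * real ((Suc n)\<^sup>2) * b)" for n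
  proof -
    let ?l = "int ((Suc n)\<^sup>2)"
    have "h n = (\<lambda>t. (of_real (real (Suc n) powr (- 2 * s)) * cis (2 * pi * real ((Suc n)\<^sup>2) * b)) * (cis (2 * pi * of_int ?l * t) * kern s a t))"
    proof
      fix t
      have "cis (2 * pi * real ((Suc n)\<^sup>2) * (b + t)) = cis (2 * pi * real ((Suc n)\<^sup>2) * b) * cis (2 * pi * of_int ?l * t)"
        unfolding of_int_of_nat_eq cis_mult by (simp only: distrib_left)
      then show "h n t = (of_real (real (Suc n) powr (- 2 * s)) * cis (2 * pi * real ((Suc n)\<^sup>2) * b)) * (cis (2 * pi * of_int ?l * t) * kern s a t)"
        unfolding h_def rterm_def by (simp only: mult.assoc)
    qed
    then have "integral {-1/2..1/2} (h n) = (of_real (real (Suc n) powr (- 2 * s)) * cis (2 * pi * real ((Suc n)\<^sup>2) * b)) * integral {-1/2..1/2} (\<lambda>t. cis (2 * pi * of_int ?l * t) * kern s a t)"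
      by (simp only: integral_mult_right)
    also have "integral {-1/2..1/2} (\<lambda>t. cis (2 * pi * of_int ?l * t) * kern s a t) = of_real (kap s ((Suc n)\<^sup>2) * exp (- a) ^ ((Suc n)\<^sup>2))"
    proof -
      have "int 1 \<le> ?l" unfolding of_nat_le_iff by simp
      then have "?l \<ge> 1" by (simp only: of_nat_1)
      then show ?thesis unfolding kern_fourier[OF a s0] by (simp only: if_True nat_int)
    qed
    finally show ?thesis by (simp only: of_real_mult mult_ac)
  qed
  ultimately show ?thesis by (simp only:)
qed

section \<open>Size of the kernel\<close>

lemma sin_ge_half: assumes "0 \<le> x" "x \<le> pi / 2" shows "x / 2 \<le> sin x"
proof (cases "x \<le> pi / 3")
  case True
  have "sin 0 - 0 / 2 \<le> sin x - x / 2"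
  proof (rule DERIV_nonneg_imp_nondecreasing[OF assms(1)])
    fix y assume y: "0 \<le> y" "y \<le> x"
    have "cos (pi / 3) \<le> cos y" using y True by (intro cos_monotone_0_pi_le) auto
    then have "1/2 \<le> cos y" by (simp add: cos_60)
    moreover have "((\<lambda>x. sin x - x / 2) has_real_derivative cos y - 1 / 2) (at y)" by (auto intro!: derivative_eq_intros)
    ultimately show "\<exists>d. ((\<lambda>x. sin x - x / 2) has_real_derivative d) (at y) \<and> 0 \<le> d" by force
  qed
  then show ?thesis by simp
next
  case False
  \<comment> \<open>Here sin x >= sqrt 3 / 2 >= 17/20, while x/2 <= pi/4 <= 17/20.\<close>
  have "sin (pi / 3) \<le> sin x" using False assms by (intro sin_monotone_2pi_le) auto
  moreover have "sin (pi / 3) = sqrt 3 / 2" by (rule sin_60)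
  moreover have "sqrt 3 \<ge> 17/10" by (rule real_le_rsqrt) (simp add: power2_eq_square)
  moreover have "pi \<le> 17/5" using pi_approx by simp
  ultimately show ?thesis using assms by linarith
qed

text \<open>With r = exp(-a) the squared distance is (1-r)^2 + 4r sin^2(pi t). Its first term sees a
  and its second sees t, and r >= 1/4 keeps the latter from degenerating.\<close>

lemma kz_dist:
  assumes a: "0 < a" "a \<le> 1" and t: "\<bar>t\<bar> \<le> 1/2"
  shows "cmod (1 - kz a t) \<ge> (a + \<bar>t\<bar>) / 4"
proof -
  define r where "r = exp (- a)"
  define S where "S = sin (pi * t)"
  have r1: "1 - r \<ge> a / 2"
  proof -
    have "exp (- a) \<le> 1 / (1 + a)" using exp_ge_add_one_self[of a] a by (simp add: exp_minus field_simps)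
    also have "\<dots> \<le> 1 - a / 2" using a by (simp add: field_simps)
    finally show ?thesis by (simp add: r_def)
  qed
  have r2: "r \<ge> 1/4"
  proof -
    have "exp a \<le> exp 1" using a by simp
    also have "exp 1 \<le> (4::real)" using exp_le by linarith
    finally show ?thesis unfolding r_def by (simp add: exp_minus field_simps)
  qed
  have Sb: "\<bar>S\<bar> \<ge> \<bar>t\<bar>"
  proof -
    have "pi * \<bar>t\<bar> / 2 \<le> sin (pi * \<bar>t\<bar>)" using t by (intro sin_ge_half) auto
    moreover have "\<bar>t\<bar> * 2 \<le> \<bar>t\<bar> * pi" using pi_ge_two by (intro mult_left_mono) auto
    moreover have "sin (pi * \<bar>t\<bar>) = \<bar>S\<bar>"
    proof -
      have "pi * \<bar>t\<bar> \<le> pi * 1" using t by (intro mult_left_mono) auto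
      then have "sin (pi * \<bar>t\<bar>) \<ge> 0" by (intro sin_ge_zero) auto
      then show ?thesis by (cases "t \<ge> 0") (auto simp: S_def)
    qed
    ultimately show ?thesis by (simp add: mult.commute)
  qed
  have "(cmod (1 - kz a t))\<^sup>2 = (1 - r * cos (2 * pi * t))\<^sup>2 + (r * sin (2 * pi * t))\<^sup>2"
    unfolding cmod_power2 kz_def r_def by simp
  also have "\<dots> = 1 - 2 * r * cos (2 * pi * t) + r\<^sup>2 * ((cos (2 * pi * t))\<^sup>2 + (sin (2 * pi * t))\<^sup>2)"
    by algebra
  also have "(cos (2 * pi * t))\<^sup>2 + (sin (2 * pi * t))\<^sup>2 = 1" by (rule sin_cos_squared_add2)
  also have "cos (2 * pi * t) = 1 - 2 * S\<^sup>2" unfolding S_def using cos_double_sin[of "pi * t"] by (simp add: mult.assoc)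
  finally have eq: "(cmod (1 - kz a t))\<^sup>2 = (1 - r)\<^sup>2 + 4 * r * S\<^sup>2"
    by (simp add: power2_diff algebra_simps)
  have "((a + \<bar>t\<bar>) / 4)\<^sup>2 \<le> (a / 2)\<^sup>2 + t\<^sup>2"
  proof -
    have "0 \<le> (a - \<bar>t\<bar>)\<^sup>2" by simp
    moreover have "\<bar>t\<bar>\<^sup>2 = t\<^sup>2" by simp
    ultimately have "(a + \<bar>t\<bar>)\<^sup>2 \<le> 2 * a\<^sup>2 + 2 * t\<^sup>2" by (simp add: power2_sum power2_diff)
    then show ?thesis by (simp add: power_divide) (use zero_le_power2[of a] zero_le_power2[of t] in linarith)
  qed
  also have "\<dots> \<le> (1 - r)\<^sup>2 + 4 * r * S\<^sup>2"
  proof (intro add_mono)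
    show "(a / 2)\<^sup>2 \<le> (1 - r)\<^sup>2" using r1 a by (intro power_mono) auto
    have "t\<^sup>2 \<le> S\<^sup>2" using Sb by (simp add: abs_le_square_iff)
    also have "\<dots> \<le> 4 * r * S\<^sup>2" using mult_right_mono[of 1 "4 * r" "S\<^sup>2"] r2 by simp
    finally show "t\<^sup>2 \<le> 4 * r * S\<^sup>2" .
  qed
  finally show ?thesis unfolding eq[symmetric] by (rule power2_le_imp_le) simp
qed

lemma kern_bound:
  assumes s: "s > 0"
  shows "\<exists>C>0. \<forall>a t. 0 < a \<longrightarrow> a \<le> 1 \<longrightarrow> \<bar>t\<bar> \<le> 1/2 \<longrightarrow> cmod (kern s a t) \<le> C * (a + \<bar>t\<bar>) powr (- (s + 1))"
proof -
  define C where "C = 4 powr (s + 1) + 2 powr (s + 1)"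
  have "cmod (kern s a t) \<le> C * (a + \<bar>t\<bar>) powr (- (s + 1))" if a: "0 < a" "a \<le> 1" and t: "\<bar>t\<bar> \<le> 1/2" for a t
  proof -
    have p: "0 < a + \<bar>t\<bar>" "a + \<bar>t\<bar> \<le> 2" using a t by linarith+
    have "cmod (kern s a t) \<le> cmod ((1 - kz a t) powr (of_real (- (s + 1)))) + 1"
      unfolding kern_def by (rule order_trans[OF norm_triangle_ineq4]) simp
    also have "cmod ((1 - kz a t) powr (of_real (- (s + 1)))) = cmod (1 - kz a t) powr (- (s + 1))"
      by (subst norm_powr_real_powr') auto
    also have "\<dots> \<le> ((a + \<bar>t\<bar>) / 4) powr (- (s + 1))"
      using p s kz_dist[OF a t] by (intro powr_mono2') auto
    also have "\<dots> = 4 powr (s + 1) * (a + \<bar>t\<bar>) powr (- (s + 1))"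
    proof -
      have "((a + \<bar>t\<bar>) / 4) powr (- (s + 1)) = (a + \<bar>t\<bar>) powr (- (s + 1)) / 4 powr (- (s + 1))" using p by (simp only: powr_divide)
      also have "4 powr (- (s + 1)) = inverse (4 powr (s + 1))" by (rule powr_minus)
      finally show ?thesis by (simp only: divide_inverse inverse_inverse_eq mult.commute)
    qed
    finally have A: "cmod (kern s a t) \<le> 4 powr (s + 1) * (a + \<bar>t\<bar>) powr (- (s + 1)) + 1" by simp
    \<comment> \<open>Absorbs the subtracted 1 of the kernel: a + |t| <= 2 bounds the negative power
      from below.\<close>
    have one: "1 \<le> 2 powr (s + 1) * (a + \<bar>t\<bar>) powr (- (s + 1))"
    proof -
      have "2 powr (- (s + 1)) \<le> (a + \<bar>t\<bar>) powr (- (s + 1))" using p s by (intro powr_mono2') auto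
      then have "2 powr (s + 1) * 2 powr (- (s + 1)) \<le> 2 powr (s + 1) * (a + \<bar>t\<bar>) powr (- (s + 1))" by (intro mult_left_mono) auto
      then show ?thesis by (simp add: powr_add[symmetric])
    qed
    show ?thesis unfolding C_def distrib_right using A one by linarith
  qed
  moreover have "C > 0" unfolding C_def by (simp add: add_pos_pos)
  ultimately show ?thesis by blast
qed

subsection \<open>Hoelder regularity bounds the transform\<close>

lemma poly_lipschitz:
  fixes P :: "complex poly"
  shows "\<exists>L\<ge>0. \<forall>x y. cmod x \<le> B \<longrightarrow> cmod y \<le> B \<longrightarrow> cmod (poly P x - poly P y) \<le> L * cmod (x - y)"
proof (induction P)
  case 0
  then show ?case by (intro exI[of _ 0]) auto
next
  case (pCons c P)
  then obtain L where L: "L \<ge> 0" "\<And>x y. cmod x \<le> B \<Longrightarrow> cmod y \<le> B \<Longrightarrow> cmod (poly P x - poly P y) \<le> L * cmod (x - y)"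
    by blast
  have "compact (cball (0::complex) B)" by simp
  then have "compact (poly P ` cball 0 B)" by (rule compact_continuous_image[rotated]) (intro continuous_intros)
  then obtain M where M: "\<And>y. cmod y \<le> B \<Longrightarrow> cmod (poly P y) \<le> M"
    using compact_imp_bounded bounded_iff by (metis (no_types, lifting) dist_0_norm image_eqI mem_cball)
  define L' where "L' = \<bar>B\<bar> * L + \<bar>M\<bar>"
  have "cmod (poly (pCons c P) x - poly (pCons c P) y) \<le> L' * cmod (x - y)" if xy: "cmod x \<le> B" "cmod y \<le> B" for x y
  proof -
    have "poly (pCons c P) x - poly (pCons c P) y = x * (poly P x - poly P y) + (x - y) * poly P y" by (simp add: algebra_simps)
    also have "cmod \<dots> \<le> cmod x * cmod (poly P x - poly P y) + cmod (x - y) * cmod (poly P y)"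
      by (rule order_trans[OF norm_triangle_ineq]) (simp add: norm_mult)
    also have "\<dots> \<le> \<bar>B\<bar> * (L * cmod (x - y)) + cmod (x - y) * \<bar>M\<bar>"
      using L(2)[OF xy] M[OF xy(2)] xy by (intro add_mono mult_mono) auto
    finally show ?thesis by (simp add: L'_def algebra_simps)
  qed
  moreover have "L' \<ge> 0" using L(1) by (simp add: L'_def)
  ultimately show ?case by blast
qed

text \<open>The truncated logarithm: on \<open>u = e(-h) - 1\<close> it agrees with \<open>h\<close> to order \<open>m + 1\<close>, because the
  derivative of the difference telescopes to \<open>(-u)\<^sup>m\<close>.\<close>

definition logpoly :: "nat \<Rightarrow> complex poly" where
  "logpoly m = (\<Sum>j<m. monom ((-1) ^ Suc j / (2 * pi * \<i> * of_nat (Suc j))) (Suc j))"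

lemma logpoly_approx:
  fixes h :: real
  shows "cmod (of_real h - poly (logpoly m) (cis (- (2 * pi * h)) - 1)) \<le> (2 * pi) ^ m * \<bar>h\<bar> ^ Suc m"
proof -
  define u where "u = (\<lambda>z::complex. exp (- (2 * pi * \<i>) * z) - 1)"
  define E where "E = (\<lambda>z. z - poly (logpoly m) (u z))"
  have du: "(u has_field_derivative - (2 * pi * \<i>) * (1 + u z)) (at z within S)" for z S
    unfolding u_def by (auto intro!: derivative_eq_intros)
  have pd: "poly (pderiv (logpoly m)) w * (- (2 * pi * \<i>) * (1 + w)) = 1 - (- w) ^ m" for w
  proof -
    have "poly (pderiv (logpoly m)) w = (\<Sum>j<m. (-1) ^ Suc j / (2 * pi * \<i>) * w ^ j)"
    proof (induction m)
      case (Suc m)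
      have "logpoly (Suc m) = logpoly m + monom ((-1) ^ Suc m / (2 * pi * \<i> * of_nat (Suc m))) (Suc m)" by (simp add: logpoly_def)
      then have "poly (pderiv (logpoly (Suc m))) w = poly (pderiv (logpoly m)) w + poly (pderiv (monom ((-1) ^ Suc m / (2 * pi * \<i> * of_nat (Suc m))) (Suc m))) w"
        by (simp only: pderiv_add poly_add)
      also have "poly (pderiv (monom ((-1) ^ Suc m / (2 * pi * \<i> * of_nat (Suc m))) (Suc m))) w = (-1) ^ Suc m / (2 * pi * \<i>) * w ^ m"
        by (simp add: pderiv_monom poly_monom del: power_Suc of_nat_Suc)
      finally show ?case using Suc by (simp only: sum.lessThan_Suc)
    qed (simp add: logpoly_def)
    also have "\<dots> = (- 1 / (2 * pi * \<i>)) * (\<Sum>j<m. (- w) ^ j)"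
      unfolding sum_distrib_left by (intro sum.cong refl) (simp add: power_minus[of w])
    finally have eq: "poly (pderiv (logpoly m)) w = (- 1 / (2 * pi * \<i>)) * (\<Sum>j<m. (- w) ^ j)" .
    have ident: "(- 1 / c * S) * (- c * (1 + w)) = (1 - (- w)) * S" if "c \<noteq> 0" for c S :: complex
      using that by simp
    have "poly (pderiv (logpoly m)) w * (- (2 * pi * \<i>) * (1 + w)) = (1 - (- w)) * (\<Sum>j<m. (- w) ^ j)"
      unfolding eq by (rule ident) simp
    also have "\<dots> = 1 - (- w) ^ m" by (rule one_diff_power_eq[symmetric])
    finally show ?thesis .
  qed
  have dE: "(E has_field_derivative (- u z) ^ m) (at z within S)" for z S
  proof -
    have "(E has_field_derivative 1 - poly (pderiv (logpoly m)) (u z) * (- (2 * pi * \<i>) * (1 + u z))) (at z within S)"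
      unfolding E_def by (intro DERIV_diff DERIV_ident DERIV_chain2[OF poly_DERIV du])
    then show ?thesis unfolding pd by simp
  qed
  have seg: "cmod (w) \<le> cmod z" if "w \<in> closed_segment 0 z" for w z :: complex
    using segment_bound(1)[OF that] by simp
  have re: "\<exists>y. w = of_real y" if w: "w \<in> closed_segment 0 (of_real h)" for w :: complex
    using w unfolding closed_segment_of_real[of 0 h, simplified] by auto
  have ub: "cmod (u z) \<le> 2 * pi * cmod z" if z: "z \<in> closed_segment 0 (of_real h)" for z
  proof -
    have "cmod (u z - u 0) \<le> 2 * pi * cmod (z - 0)"
    proof (rule field_differentiable_bound[of "closed_segment 0 (of_real h)" u "\<lambda>z. - (2 * pi * \<i>) * (1 + u z)"])
      fix w :: complex assume w: "w \<in> closed_segment 0 (of_real h)"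
      obtain y where y: "w = of_real y" using re[OF w] by blast
      have "cmod (1 + u w) = 1" unfolding u_def y by (simp add: norm_exp_eq_Re)
      then show "cmod (- (2 * pi * \<i>) * (1 + u w)) \<le> 2 * pi" by (simp add: norm_mult)
    qed (use z du in auto)
    then show ?thesis by (simp add: u_def)
  qed
  have "cmod (E (of_real h) - E 0) \<le> (2 * pi * \<bar>h\<bar>) ^ m * cmod (of_real h - 0)"
  proof (rule field_differentiable_bound[of "closed_segment 0 (of_real h)" E "\<lambda>z. (- u z) ^ m"])
    fix w :: complex assume w: "w \<in> closed_segment 0 (of_real h)"
    have "cmod (u w) \<le> 2 * pi * \<bar>h\<bar>"
      by (rule order_trans[OF ub[OF w]], intro mult_left_mono) (use seg[OF w] in auto)
    then show "cmod ((- u w) ^ m) \<le> (2 * pi * \<bar>h\<bar>) ^ m" unfolding norm_power norm_minus_cancel by (intro power_mono) auto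
  qed (use dE in auto)
  moreover have "E 0 = 0" unfolding E_def u_def logpoly_def by (simp add: poly_sum poly_monom)
  moreover have "u (of_real h) = cis (- (2 * pi * h)) - 1" unfolding u_def cis_conv_exp by (simp add: mult_ac)
  ultimately show ?thesis unfolding E_def by (simp add: power_mult_distrib mult_ac)
qed

text \<open>The kernel annihilates e(-ih) for i >= 0 but not powers of h. Substituting the truncated
  logarithm of e(-h) for h gives a polynomial in e(-h) alone; P is Lipschitz on a fixed ball, so the
  error of the logarithm carries over.\<close>

lemma poly_to_trig:
  fixes P :: "complex poly"
  shows "\<exists>Q::complex poly. \<exists>C\<ge>0. \<forall>h. \<bar>h\<bar> \<le> 1 \<longrightarrow> cmod (poly P (of_real h) - poly Q (cis (- (2 * pi * h)))) \<le> C * \<bar>h\<bar> ^ Suc m"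
proof -
  define B where "B = 1 + (2 * pi) ^ m"
  obtain L where L: "L \<ge> 0" "\<And>x y. cmod x \<le> B \<Longrightarrow> cmod y \<le> B \<Longrightarrow> cmod (poly P x - poly P y) \<le> L * cmod (x - y)"
    using poly_lipschitz[of B P] by blast
  define Q where "Q = pcompose P (pcompose (logpoly m) [:-1, 1:])"
  have "cmod (poly P (of_real h) - poly Q (cis (- (2 * pi * h)))) \<le> L * (2 * pi) ^ m * \<bar>h\<bar> ^ Suc m" if h: "\<bar>h\<bar> \<le> 1" for h
  proof -
    define y where "y = poly (logpoly m) (cis (- (2 * pi * h)) - 1)"
    have Q: "poly Q (cis (- (2 * pi * h))) = poly P y" unfolding Q_def y_def by (simp add: poly_pcompose)
    have d: "cmod (of_real h - y) \<le> (2 * pi) ^ m * \<bar>h\<bar> ^ Suc m" unfolding y_def by (rule logpoly_approx)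
    also have "\<dots> \<le> (2 * pi) ^ m * 1" using h by (intro mult_left_mono power_le_one) auto
    finally have "cmod y \<le> B" unfolding B_def using h norm_triangle_ineq4[of "of_real h" "of_real h - y"] by simp
    moreover have "cmod (of_real h) \<le> B" using h by (simp add: B_def add_increasing2)
    ultimately have "cmod (poly P (of_real h) - poly P y) \<le> L * cmod (of_real h - y)" by (intro L(2))
    also have "\<dots> \<le> L * ((2 * pi) ^ m * \<bar>h\<bar> ^ Suc m)" using d L(1) by (intro mult_left_mono)
    finally show ?thesis unfolding Q by (simp add: mult.assoc)
  qed
  moreover have "L * (2 * pi) ^ m \<ge> 0" using L(1) by simp
  ultimately show ?thesis by blast
qed

lemma kern_kills_trig:
  fixes Q :: "complex poly"
  assumes a: "a > 0" and s: "s > 0"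
  shows "integral {-1/2..1/2} (\<lambda>t. poly Q (cis (- (2 * pi * (d + t)))) * kern s a t) = 0"
proof -
  have pe: "poly Q (cis (- (2 * pi * (d + t)))) * kern s a t
     = (\<Sum>i\<le>degree Q. (coeff Q i * cis (- (2 * pi * real i * d))) * (cis (2 * pi * of_int (- int i) * t) * kern s a t))" for t
  proof -
    have "cis (- (2 * pi * (d + t))) ^ i = cis (- (2 * pi * real i * d)) * cis (2 * pi * of_int (- int i) * t)" for i
      unfolding Complex.DeMoivre cis_mult by (simp add: algebra_simps)
    then show ?thesis unfolding poly_altdef sum_distrib_right by (simp only: mult.assoc)
  qed
  have "integral {-1/2..1/2} (\<lambda>t. poly Q (cis (- (2 * pi * (d + t)))) * kern s a t)
     = (\<Sum>i\<le>degree Q. integral {-1/2..1/2} (\<lambda>t. (coeff Q i * cis (- (2 * pi * real i * d))) * (cis (2 * pi * of_int (- int i) * t) * kern s a t)))"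
    unfolding pe by (rule integral_sum) (auto intro!: integrable_continuous_real continuous_intros continuous_on_kern a s)
  also have "\<dots> = (\<Sum>i\<le>degree Q. 0)"
  proof (rule sum.cong[OF refl])
    fix i
    have "integral {-1/2..1/2} (\<lambda>t. cis (2 * pi * of_int (- int i) * t) * kern s a t) = 0"
      unfolding kern_fourier[OF a s] by simp
    then show "integral {-1/2..1/2} (\<lambda>t. (coeff Q i * cis (- (2 * pi * real i * d))) * (cis (2 * pi * of_int (- int i) * t) * kern s a t)) = 0"
      by (simp only: integral_mult_right) simp
  qed
  finally show ?thesis by simp
qed

lemma power_kernel_integral:
  fixes a \<epsilon> :: real
  assumes a: "a > 0" and e: "\<epsilon> > 0"
  shows "(\<lambda>t. (a + \<bar>t\<bar>) powr (- \<epsilon> - 1)) integrable_on {-1/2..1/2}"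
    "integral {-1/2..1/2} (\<lambda>t. (a + \<bar>t\<bar>) powr (- \<epsilon> - 1)) \<le> 2 / \<epsilon> * a powr (- \<epsilon>)"
proof -
  let ?f = "\<lambda>t. (a + \<bar>t\<bar>) powr (- \<epsilon> - 1)"
  have ne: "a + \<bar>t\<bar> \<noteq> 0" for t using a abs_ge_zero[of t] by linarith
  have c: "continuous_on S ?f" for S by (intro continuous_intros ballI ne)
  then show i: "?f integrable_on {-1/2..1/2}" by (rule integrable_continuous_real)
  define F where "F = (\<lambda>t. - ((a + t) powr (- \<epsilon>)) / \<epsilon>)"
  have Fd: "(F has_real_derivative (a + t) powr (- \<epsilon> - 1)) (at t within S)" if "t \<ge> 0" for t S
    unfolding F_def using that a e by (auto intro!: derivative_eq_intros)
  have 1: "(?f has_integral (F (1/2) - F 0)) {0..1/2}"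
  proof (rule fundamental_theorem_of_calculus)
    fix t :: real assume t: "t \<in> {0..1/2}"
    show "(F has_vector_derivative ?f t) (at t within {0..1/2})"
      using Fd[of t] t by (simp add: has_real_derivative_iff_has_vector_derivative)
  qed simp
  have 2: "(?f has_integral (F (1/2) - F 0)) {-1/2..0}"
    using has_integral_reflect_real[of ?f "F (1/2) - F 0" "1/2" 0] 1 by simp
  have "(?f has_integral (F (1/2) - F 0) + (F (1/2) - F 0)) {-1/2..1/2}"
    by (rule has_integral_combine[OF _ _ 2 1]) auto
  then have "integral {-1/2..1/2} ?f = 2 * (F (1/2) - F 0)" by (simp add: integral_unique)
  also have "F (1/2) \<le> 0" unfolding F_def using e by simp
  also have "F 0 = - (a powr (- \<epsilon>)) / \<epsilon>" by (simp add: F_def)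
  finally show "integral {-1/2..1/2} ?f \<le> 2 / \<epsilon> * a powr (- \<epsilon>)" by simp
qed

text \<open>The kernel is integrated over a whole period, so a local estimate is not enough. For |h|
  >= \<delta> both functions are bounded and the third summand of C takes over.\<close>

lemma holder_trig_approx:
  assumes s: "s > 1/2" and b: "0 \<le> \<beta>" and H: "holder_at \<beta> (R s) x"
  shows "\<exists>Q::complex poly. \<exists>C>0. \<forall>h. \<bar>h\<bar> \<le> 1 \<longrightarrow> cmod (R s (x + h) - poly Q (cis (- (2 * pi * h)))) \<le> C * \<bar>h\<bar> powr \<beta>"
proof -
  obtain P C1 \<delta> where P: "C1 > 0" "\<delta> > 0" "\<And>h. \<bar>h\<bar> < \<delta> \<Longrightarrow> cmod (R s (x + h) - poly P (of_real h)) \<le> C1 * \<bar>h\<bar> powr \<beta>"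
    using H unfolding holder_at_def by blast
  define m where "m = nat \<lfloor>\<beta>\<rfloor>"
  have m: "\<beta> \<le> real (Suc m)" using b unfolding m_def by linarith
  obtain Q C2 where Q: "C2 \<ge> 0" "\<And>h. \<bar>h\<bar> \<le> 1 \<Longrightarrow> cmod (poly P (of_real h) - poly Q (cis (- (2 * pi * h)))) \<le> C2 * \<bar>h\<bar> ^ Suc m"
    using poly_to_trig[of P m] by blast
  define B where "B = (\<Sum>n. real (Suc n) powr (- 2 * s))"
  have B: "cmod (R s y) \<le> B" for y unfolding B_def by (rule norm_R_bound[OF s])
  have "compact (poly Q ` cball 0 1)" by (intro compact_continuous_image continuous_intros) simp
  then obtain M where M: "\<And>y. cmod y \<le> 1 \<Longrightarrow> cmod (poly Q y) \<le> M"
    using compact_imp_bounded bounded_iff by (metis (no_types, lifting) dist_0_norm image_eqI mem_cball)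
  have BM: "0 \<le> B" "0 \<le> M" using order_trans[OF norm_ge_zero B] order_trans[OF norm_ge_zero M[of 0]] by auto
  define C where "C = C1 + C2 + (B + M) / \<delta> powr \<beta>"
  have C: "C > 0" unfolding C_def using P Q BM by (intro add_pos_nonneg) auto
  have "cmod (R s (x + h) - poly Q (cis (- (2 * pi * h)))) \<le> C * \<bar>h\<bar> powr \<beta>" if h: "\<bar>h\<bar> \<le> 1" for h
  proof (cases "\<bar>h\<bar> < \<delta>")
    case True
    have hp: "\<bar>h\<bar> ^ Suc m \<le> \<bar>h\<bar> powr \<beta>"
    proof (cases "h = 0")
      case False
      then have "\<bar>h\<bar> ^ Suc m = \<bar>h\<bar> powr real (Suc m)" by (subst powr_realpow) auto
      also have "\<dots> \<le> \<bar>h\<bar> powr \<beta>" using h m by (intro powr_mono') auto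
      finally show ?thesis .
    qed simp
    have "cmod (R s (x + h) - poly Q (cis (- (2 * pi * h)))) \<le> cmod (R s (x + h) - poly P (of_real h)) + cmod (poly P (of_real h) - poly Q (cis (- (2 * pi * h))))"
      by (rule order_trans[OF _ norm_triangle_ineq]) simp
    also have "\<dots> \<le> C1 * \<bar>h\<bar> powr \<beta> + C2 * \<bar>h\<bar> powr \<beta>"
      using P(3)[OF True] Q(2)[OF h] mult_left_mono[OF hp Q(1)] by linarith
    also have "\<dots> = (C1 + C2) * \<bar>h\<bar> powr \<beta>" by (simp add: algebra_simps)
    also have "\<dots> \<le> C * \<bar>h\<bar> powr \<beta>" using BM unfolding C_def by (intro mult_right_mono) auto
    finally show ?thesis .
  next
    case False
    have "cmod (R s (x + h) - poly Q (cis (- (2 * pi * h)))) \<le> B + M"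
      by (rule order_trans[OF norm_triangle_ineq4]) (intro add_mono B M, simp)
    also have "\<dots> \<le> (B + M) / \<delta> powr \<beta> * \<bar>h\<bar> powr \<beta>"
    proof -
      have "\<delta> powr \<beta> \<le> \<bar>h\<bar> powr \<beta>" using False P(2) b by (intro powr_mono2) auto
      then have "(B + M) / \<delta> powr \<beta> * \<delta> powr \<beta> \<le> (B + M) / \<delta> powr \<beta> * \<bar>h\<bar> powr \<beta>" using BM by (intro mult_left_mono) auto
      then show ?thesis using P(2) by simp
    qed
    also have "\<dots> \<le> C * \<bar>h\<bar> powr \<beta>" using P(1) Q(1) unfolding C_def by (intro mult_right_mono) auto
    finally show ?thesis .
  qed
  then show ?thesis using C by blast
qed

text \<open>The trigonometric polynomial is invisible to the kernel, so only the remainder counts,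
  of size at most (\<rho>+|t|)^\<beta> up to a constant. Since \<rho> >= a, this is at most
  (\<rho>/a)^\<beta> (a+|t|)^\<beta>; integrated against (a+|t|)^(-s-1) it gives \<rho>^\<beta>
  a^(-s). The integral is dominated by |t| of order a only if \<beta> < s, hence the reduction from
  \<alpha> to \<beta>.\<close>

lemma transform_upper_bound:
  assumes s: "s > 1/2" and b: "0 \<le> \<beta>" "\<beta> < s" "\<beta> \<le> \<alpha>" and H: "holder_at \<alpha> (R s) x"
  shows "\<exists>C>0. \<forall>a \<rho> b. 0 < a \<longrightarrow> a \<le> \<rho> \<longrightarrow> \<rho> \<le> 1/2 \<longrightarrow> \<bar>b - x\<bar> \<le> \<rho> \<longrightarrow>
     cmod (integral {-1/2..1/2} (\<lambda>t. R s (b + t) * kern s a t)) \<le> C * \<rho> powr \<beta> * a powr (- s)"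
proof -
  have s0: "s > 0" using s by simp
  obtain Q C where C: "C > 0" and Q: "\<And>h. \<bar>h\<bar> \<le> 1 \<Longrightarrow> cmod (R s (x + h) - poly Q (cis (- (2 * pi * h)))) \<le> C * \<bar>h\<bar> powr \<beta>"
  proof -
    obtain Q C where C: "C > 0" and Q: "\<And>h. \<bar>h\<bar> \<le> 1 \<Longrightarrow> cmod (R s (x + h) - poly Q (cis (- (2 * pi * h)))) \<le> C * \<bar>h\<bar> powr \<alpha>"
      using holder_trig_approx[OF s _ H] b by force
    have "cmod (R s (x + h) - poly Q (cis (- (2 * pi * h)))) \<le> C * \<bar>h\<bar> powr \<beta>" if h: "\<bar>h\<bar> \<le> 1" for h
    proof -
      have "\<bar>h\<bar> powr \<alpha> \<le> \<bar>h\<bar> powr \<beta>" using h b by (intro powr_mono') auto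
      then show ?thesis using Q[OF h] mult_left_mono[of "\<bar>h\<bar> powr \<alpha>" "\<bar>h\<bar> powr \<beta>" C] C by linarith
    qed
    then show ?thesis using that C by blast
  qed
  obtain K where K0: "K > 0" and K: "\<And>a t. 0 < a \<Longrightarrow> a \<le> 1 \<Longrightarrow> \<bar>t\<bar> \<le> 1/2 \<Longrightarrow> cmod (kern s a t) \<le> K * (a + \<bar>t\<bar>) powr (- (s + 1))"
    using kern_bound[OF s0] by blast
  define C' where "C' = C * K * (2 / (s - \<beta>))"
  have "cmod (integral {-1/2..1/2} (\<lambda>t. R s (y + t) * kern s a t)) \<le> C' * \<rho> powr \<beta> * a powr (- s)"
    if a: "0 < a" "a \<le> \<rho>" and r: "\<rho> \<le> 1/2" "\<bar>y - x\<bar> \<le> \<rho>" for a \<rho> y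
  proof -
    let ?q = "\<lambda>t. poly Q (cis (- (2 * pi * ((y - x) + t))))"
    have cR: "continuous_on {-1/2..1/2} (\<lambda>t. R s (y + t))"
      by (rule continuous_on_compose2[OF continuous_on_R[OF s, of "y - 1/2" "y + 1/2"]]) (auto intro!: continuous_intros)
    have cq: "continuous_on {-1/2..1/2} ?q" by (intro continuous_intros)
    note cK = continuous_on_kern[OF a(1) s0, of "-1/2" "1/2"]
    have "integral {-1/2..1/2} (\<lambda>t. R s (y + t) * kern s a t) = integral {-1/2..1/2} (\<lambda>t. R s (y + t) * kern s a t) - integral {-1/2..1/2} (\<lambda>t. ?q t * kern s a t)"
      unfolding kern_kills_trig[OF a(1) s0] by simp
    also have "\<dots> = integral {-1/2..1/2} (\<lambda>t. R s (y + t) * kern s a t - ?q t * kern s a t)"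
      by (rule integral_diff[symmetric]) (intro integrable_continuous_real continuous_intros cR cq cK)+
    finally have e1: "integral {-1/2..1/2} (\<lambda>t. R s (y + t) * kern s a t) = integral {-1/2..1/2} (\<lambda>t. R s (y + t) * kern s a t - ?q t * kern s a t)" .
    have "cmod (integral {-1/2..1/2} (\<lambda>t. R s (y + t) * kern s a t)) \<le> integral {-1/2..1/2} (\<lambda>t. C * K * (\<rho> / a) powr \<beta> * (a + \<bar>t\<bar>) powr (- (s - \<beta>) - 1))"
      unfolding e1
    proof (rule integral_norm_bound_integral)
      show "(\<lambda>t. R s (y + t) * kern s a t - ?q t * kern s a t) integrable_on {-1/2..1/2}"
        by (intro integrable_continuous_real continuous_intros cR cq cK)
      show "(\<lambda>t. C * K * (\<rho> / a) powr \<beta> * (a + \<bar>t\<bar>) powr (- (s - \<beta>) - 1)) integrable_on {-1/2..1/2}"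
        using integrable_on_cmult_left[OF power_kernel_integral(1)[OF a(1), of "s - \<beta>"]] b by simp
      fix t :: real assume t: "t \<in> {-1/2..1/2}"
      then have t': "\<bar>t\<bar> \<le> 1/2" by auto
      have p: "0 < a + \<bar>t\<bar>" using a by linarith
      have "cmod (R s (y + t) * kern s a t - ?q t * kern s a t) = cmod (R s (x + ((y - x) + t)) - ?q t) * cmod (kern s a t)"
        by (simp add: norm_mult[symmetric] algebra_simps)
      also have "\<dots> \<le> (C * \<bar>(y - x) + t\<bar> powr \<beta>) * (K * (a + \<bar>t\<bar>) powr (- (s + 1)))"
        using t' r a C by (intro mult_mono Q K) auto
      also have "\<dots> \<le> (C * ((\<rho> / a) powr \<beta> * (a + \<bar>t\<bar>) powr \<beta>)) * (K * (a + \<bar>t\<bar>) powr (- (s + 1)))"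
      proof (intro mult_right_mono mult_left_mono)
        have "\<bar>(y - x) + t\<bar> \<le> \<rho> + \<bar>t\<bar>" using r by linarith
        also have "\<dots> \<le> \<rho> / a * (a + \<bar>t\<bar>)"
        proof -
          have "1 * \<bar>t\<bar> \<le> \<rho> / a * \<bar>t\<bar>" using a by (intro mult_right_mono) auto
          then show ?thesis using a by (simp add: distrib_left)
        qed
        finally have "\<bar>(y - x) + t\<bar> powr \<beta> \<le> (\<rho> / a * (a + \<bar>t\<bar>)) powr \<beta>" using b by (intro powr_mono2) auto
        also have "\<dots> = (\<rho> / a) powr \<beta> * (a + \<bar>t\<bar>) powr \<beta>" using a p by (intro powr_mult) 
        finally show "\<bar>(y - x) + t\<bar> powr \<beta> \<le> (\<rho> / a) powr \<beta> * (a + \<bar>t\<bar>) powr \<beta>" .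
      qed (use C K0 in auto)
      also have "\<dots> = C * K * (\<rho> / a) powr \<beta> * ((a + \<bar>t\<bar>) powr \<beta> * (a + \<bar>t\<bar>) powr (- (s + 1)))" by (simp only: mult_ac)
      also have "(a + \<bar>t\<bar>) powr \<beta> * (a + \<bar>t\<bar>) powr (- (s + 1)) = (a + \<bar>t\<bar>) powr (- (s - \<beta>) - 1)"
        unfolding powr_add[symmetric] by (rule arg_cong[of _ _ "\<lambda>e. (a + \<bar>t\<bar>) powr e"]) simp
      finally show "cmod (R s (y + t) * kern s a t - ?q t * kern s a t) \<le> C * K * (\<rho> / a) powr \<beta> * (a + \<bar>t\<bar>) powr (- (s - \<beta>) - 1)" .
    qed
    also have "\<dots> = C * K * (\<rho> / a) powr \<beta> * integral {-1/2..1/2} (\<lambda>t. (a + \<bar>t\<bar>) powr (- (s - \<beta>) - 1))"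
      by (rule integral_mult_right)
    also have "\<dots> \<le> C * K * (\<rho> / a) powr \<beta> * (2 / (s - \<beta>) * a powr (- (s - \<beta>)))"
      using C K0 b by (intro mult_left_mono power_kernel_integral(2) a) auto
    also have "\<dots> = C' * ((\<rho> / a) powr \<beta> * a powr (\<beta> - s))"
      by (simp only: C'_def minus_diff_eq mult_ac)
    also have "(\<rho> / a) powr \<beta> * a powr (\<beta> - s) = \<rho> powr \<beta> * a powr (- s)"
    proof -
      have "(\<rho> / a) powr \<beta> = \<rho> powr \<beta> / a powr \<beta>" using a by (simp add: powr_divide)
      moreover have "a powr (\<beta> - s) = a powr \<beta> * a powr (- s)" by (simp only: powr_add[symmetric]) simp
      ultimately show ?thesis using a by simp
    qed
    finally show ?thesis by (simp only: mult.assoc)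
  qed
  moreover have "C' > 0" unfolding C'_def using C K0 b by simp
  ultimately show ?thesis by blast
qed

subsection \<open>Irregularity at well approximable points\<close>

lemma abs_exp_minus_one_le: "\<bar>exp d - 1\<bar> \<le> \<bar>d\<bar> * exp \<bar>d\<bar>" for d :: real
proof (cases "d \<ge> 0")
  case True
  have "1 - d \<le> exp (- d)" using exp_ge_add_one_self[of "- d"] by simp
  then have "(1 - d) * exp d \<le> exp (- d) * exp d" by (intro mult_right_mono) auto
  then have "exp d - 1 \<le> d * exp d" by (simp add: exp_minus algebra_simps)
  then show ?thesis using True by simp
next
  case False
  have "1 - exp d \<le> - d" using exp_ge_add_one_self[of d] by linarith
  also have "- d = \<bar>d\<bar> * 1" using False by simp
  also have "\<dots> \<le> \<bar>d\<bar> * exp \<bar>d\<bar>" by (intro mult_left_mono) auto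
  finally show ?thesis using False by simp
qed

lemma ln_one_plus_bound: "0 \<le> y \<Longrightarrow> \<bar>ln (1 + y) - y\<bar> \<le> y\<^sup>2" for y :: real
proof (cases "y \<le> 1")
  case True
  assume "0 \<le> y"
  then show ?thesis using abs_ln_one_plus_x_minus_x_bound_nonneg[of y] True by simp
next
  case False
  assume "0 \<le> y"
  have "ln (1 + y) \<le> y" using ln_add_one_self_le_self[of y] \<open>0 \<le> y\<close> by simp
  moreover have "0 \<le> ln (1 + y)" using False by simp
  moreover have "y * 1 \<le> y * y" using False by (intro mult_left_mono) auto
  ultimately show ?thesis by (simp add: power2_eq_square)
qed

text \<open>The logarithm of k^(-s) \<open>kap s k\<close> has increments of order 1/k^2. The rate
  1/k matters: at k = n^2 it leaves a summable error.\<close>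

lemma kap_asymp:
  assumes s: "s > 0"
  shows "\<exists>c>0. \<exists>C\<ge>0. \<forall>k\<ge>1. \<bar>real k powr (- s) * kap s k - c\<bar> \<le> C / real k"
proof -
  define L where "L = (\<lambda>k. ln (kap s k) - s * ln (real k))"
  define B where "B = s\<^sup>2 + 2 * s"
  have B0: "B > 0" using s by (simp add: B_def add_pos_pos)
  have step: "\<bar>L (Suc k) - L k\<bar> \<le> B * (1 / real k - 1 / real (Suc k))" if k: "k \<ge> 1" for k
  proof -
    define y where "y = 1 / real (Suc k)"
    have y: "0 < y" "y \<le> 1/2" using k by (auto simp: y_def field_simps)
    have "ln (kap s (Suc k)) = ln (kap s k) + ln (1 + s * y)"
      unfolding kap_Suc using kap_pos[OF s, of k] s y by (subst ln_mult_pos) (auto simp: y_def add_pos_nonneg)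
    moreover have "ln (real k) - ln (real (Suc k)) = ln (1 + (- y))"
    proof -
      have "1 + (- y) = real k / real (Suc k)" by (simp add: y_def field_simps)
      then show ?thesis using k ln_divide_pos[of "real k" "real (Suc k)"] by simp
    qed
    ultimately have "L (Suc k) - L k = (ln (1 + s * y) - s * y) + s * (ln (1 + (- y)) - (- y))"
      unfolding L_def by (simp add: algebra_simps)
    also have "\<bar>\<dots>\<bar> \<le> (s * y)\<^sup>2 + s * (2 * (- y)\<^sup>2)"
    proof (rule order_trans[OF abs_triangle_ineq], intro add_mono)
      show "\<bar>ln (1 + s * y) - s * y\<bar> \<le> (s * y)\<^sup>2" using s y by (intro ln_one_plus_bound) auto
      have "\<bar>ln (1 + (- y)) - (- y)\<bar> \<le> 2 * (- y)\<^sup>2" using y by (intro abs_ln_one_plus_x_minus_x_bound) auto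
      then show "\<bar>s * (ln (1 + (- y)) - (- y))\<bar> \<le> s * (2 * (- y)\<^sup>2)" unfolding abs_mult using s by (intro mult_mono) auto
    qed
    also have "\<dots> = B * y\<^sup>2" by (simp add: B_def power_mult_distrib algebra_simps)
    also have "\<dots> \<le> B * (1 / real k - 1 / real (Suc k))"
    proof (intro mult_left_mono)
      have "1 / real k - 1 / real (Suc k) = 1 / (real k * real (Suc k))" using k by (simp add: field_simps)
      moreover have "y\<^sup>2 = 1 / (real (Suc k) * real (Suc k))" by (simp add: y_def power2_eq_square)
      moreover have "real k * real (Suc k) \<le> real (Suc k) * real (Suc k)" by (intro mult_right_mono) auto
      ultimately show "y\<^sup>2 \<le> 1 / real k - 1 / real (Suc k)" using k by (simp only: frac_le) (intro frac_le, auto)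
    qed (use B0 in auto)
    finally show ?thesis .
  qed
  \<comment> \<open>The increments are dominated by those of B/k, so subtracting or adding B/k makes
    the sequence monotone; the two squeeze a common limit and give the rate.\<close>
  define U where "U = (\<lambda>k. L (Suc k) - B / real (Suc k))"
  define V where "V = (\<lambda>k. L (Suc k) + B / real (Suc k))"
  have Uinc: "incseq U"
  proof (rule incseq_SucI)
    fix k
    have "L (Suc k) - L (Suc (Suc k)) \<le> B * (1 / real (Suc k) - 1 / real (Suc (Suc k)))" using step[of "Suc k"] by simp
    then show "U k \<le> U (Suc k)" unfolding U_def by (simp add: algebra_simps del: of_nat_Suc)
  qed
  have Vdec: "decseq V"
  proof (rule decseq_SucI)
    fix k
    have "L (Suc (Suc k)) - L (Suc k) \<le> B * (1 / real (Suc k) - 1 / real (Suc (Suc k)))" using step[of "Suc k"] by simp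
    then show "V (Suc k) \<le> V k" unfolding V_def by (simp add: algebra_simps del: of_nat_Suc)
  qed
  have UV: "U k \<le> V 0" for k
  proof -
    have "U k \<le> V k" using B0 by (simp add: U_def V_def)
    also have "V k \<le> V 0" using Vdec by (simp add: decseqD)
    finally show ?thesis .
  qed
  obtain l where l: "U \<longlonglongrightarrow> l" "\<And>k. U k \<le> l" using incseq_convergent[OF Uinc, of "V 0"] UV by blast
  have "(\<lambda>k. 2 * B / real (Suc k)) \<longlonglongrightarrow> 0" by real_asymp
  from tendsto_add[OF l(1) this] have "(\<lambda>k. U k + 2 * B / real (Suc k)) \<longlonglongrightarrow> l" by simp
  moreover have "(\<lambda>k. U k + 2 * B / real (Suc k)) = V" by (rule ext) (simp add: U_def V_def)
  ultimately have "V \<longlonglongrightarrow> l" by simp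
  then have lV: "l \<le> V k" for k using decseq_ge[OF Vdec] by simp
  have Ll: "\<bar>L k - l\<bar> \<le> B / real k" if k: "k \<ge> 1" for k
  proof -
    obtain j where j: "k = Suc j" using k by (cases k) auto
    show ?thesis using l(2)[of j] lV[of j] unfolding U_def V_def j by linarith
  qed
  have "\<bar>real k powr (- s) * kap s k - exp l\<bar> \<le> (exp l * exp B * B) / real k" if k: "k \<ge> 1" for k
  proof -
    define d where "d = L k - l"
    have d: "\<bar>d\<bar> \<le> B / real k" "\<bar>d\<bar> \<le> B"
    proof -
      show 1: "\<bar>d\<bar> \<le> B / real k" using Ll[OF k] by (simp add: d_def)
      have "B / real k \<le> B / 1" using k B0 by (intro divide_left_mono) auto
      then show "\<bar>d\<bar> \<le> B" using 1 by simp
    qed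
    have "real k powr (- s) * kap s k = exp (L k)"
      unfolding L_def exp_diff using k kap_pos[OF s, of k] by (simp add: powr_def exp_minus divide_inverse mult.commute)
    also have "\<dots> = exp l * exp d" by (simp add: d_def exp_add[symmetric])
    finally have "\<bar>real k powr (- s) * kap s k - exp l\<bar> = exp l * \<bar>exp d - 1\<bar>"
      using abs_mult[of "exp l" "exp d - 1"] by (simp add: right_diff_distrib)
    also have "\<dots> \<le> exp l * (\<bar>d\<bar> * exp \<bar>d\<bar>)" by (intro mult_left_mono abs_exp_minus_one_le) auto
    also have "\<dots> \<le> exp l * (B / real k * exp B)" using d B0 by (intro mult_left_mono mult_mono) auto
    finally show ?thesis by (simp add: mult_ac)
  qed
  moreover have "exp l * exp B * B \<ge> 0" using B0 by simp
  ultimately show ?thesis by (meson exp_gt_zero)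
qed

text \<open>Replacing the multiplier by its limit changes each term by O(1/n^2), hence the sum by a
  constant independent of q, p and c.\<close>

lemma transform_lower_bound:
  assumes s: "s > 1/2"
  shows "\<exists>c0>0. \<exists>C\<ge>0. \<forall>q p c. q > 0 \<longrightarrow> 0 < c \<longrightarrow> summable (\<lambda>n. exp (- (c * real (Suc n))\<^sup>2)) \<longrightarrow>
    cmod (integral {-1/2..1/2} (\<lambda>t. R s (of_int p / real q + t) * kern s (c\<^sup>2) t))
      \<ge> c0 * cmod (\<Sum>n. of_real (exp (- (c * real (Suc n))\<^sup>2)) * quadchar q p (int (Suc n))) - C"
proof -
  have s0: "s > 0" using s by simp
  obtain c0 A where c0: "c0 > 0" and A0: "A \<ge> 0" and A: "\<And>k. k \<ge> 1 \<Longrightarrow> \<bar>real k powr (- s) * kap s k - c0\<bar> \<le> A / real k"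
    using kap_asymp[OF s0] by blast
  define C where "C = (\<Sum>n. A * (1 / (real (Suc n))\<^sup>2))"
  have sC: "summable (\<lambda>n. A * (1 / (real (Suc n))\<^sup>2))"
    using summable_Suc_iff[of "\<lambda>n. 1 / real n ^ 2"] inverse_power_summable[of 2, where 'a = real]
    by (intro summable_mult) (simp add: inverse_eq_divide)
  have C0: "C \<ge> 0" unfolding C_def using A0 by (intro suminf_nonneg sC) auto
  have "cmod (integral {-1/2..1/2} (\<lambda>t. R s (of_int p / real q + t) * kern s (c\<^sup>2) t))
      \<ge> c0 * cmod (\<Sum>n. of_real (exp (- (c * real (Suc n))\<^sup>2)) * quadchar q p (int (Suc n))) - C"
    if q: "q > 0" and c: "0 < c" and sE: "summable (\<lambda>n. exp (- (c * real (Suc n))\<^sup>2))" for q p c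
  proof -
    define E where "E = (\<lambda>n. exp (- (c * real (Suc n))\<^sup>2))"
    define X where "X = (\<lambda>n. quadchar q p (int (Suc n)))"
    define \<rho> where "\<rho> = (\<lambda>n. real (Suc n) powr (- 2 * s) * kap s ((Suc n)\<^sup>2))"
    have X1: "cmod (X n) = 1" for n by (simp add: X_def quadchar_def)
    have E1: "0 < E n" "E n \<le> 1" for n by (auto simp: E_def)
    have rho: "\<bar>\<rho> n - c0\<bar> \<le> A * (1 / (real (Suc n))\<^sup>2)" for n
    proof -
      have "real (Suc n) powr (- 2 * s) = ((real (Suc n))\<^sup>2) powr (- s)" using square_powr[of "real (Suc n)" "- s"] by (simp del: of_nat_Suc)
      then have "\<rho> n = real ((Suc n)\<^sup>2) powr (- s) * kap s ((Suc n)\<^sup>2)" unfolding \<rho>_def by (simp only: of_nat_power)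
      moreover have "\<bar>real ((Suc n)\<^sup>2) powr (- s) * kap s ((Suc n)\<^sup>2) - c0\<bar> \<le> A / real ((Suc n)\<^sup>2)" by (rule A) simp
      ultimately show ?thesis by (simp only: of_nat_power times_divide_eq_right mult_1_right)
    qed
    have tr: "(\<lambda>n. of_real (\<rho> n * E n) * X n) sums integral {-1/2..1/2} (\<lambda>t. R s (of_int p / real q + t) * kern s (c\<^sup>2) t)"
    proof -
      have "exp (- (c\<^sup>2)) ^ ((Suc n)\<^sup>2) = E n" for n
        unfolding E_def exp_of_nat_mult[symmetric] by (simp add: power_mult_distrib mult.commute del: of_nat_Suc)
      moreover have "cis (2 * pi * real ((Suc n)\<^sup>2) * (of_int p / real q)) = X n" for n
        unfolding X_def quadchar_def rootq_def by (rule arg_cong[of _ _ cis]) (simp del: of_nat_Suc)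
      ultimately show ?thesis using transform_R[OF s, of "c\<^sup>2" "of_int p / real q"] c unfolding \<rho>_def by (simp only: zero_less_power)
    qed
    have sEX: "summable (\<lambda>n. of_real (E n) * X n)"
      by (rule summable_norm_cancel) (use sE E1 X1 in \<open>simp add: norm_mult E_def\<close>)
    have dn: "cmod (of_real ((\<rho> n - c0) * E n) * X n) \<le> A * (1 / (real (Suc n))\<^sup>2)" for n
    proof -
      have "cmod (of_real ((\<rho> n - c0) * E n) * X n) = \<bar>\<rho> n - c0\<bar> * E n"
        using E1(1)[of n] by (simp only: norm_mult norm_of_real X1 abs_mult mult_1_right abs_of_pos)
      also have "\<dots> \<le> (A * (1 / (real (Suc n))\<^sup>2)) * 1"
        using rho[of n] E1(1)[of n] E1(2)[of n] by (intro mult_mono) (auto intro: order_trans[OF abs_ge_zero])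
      finally show ?thesis by simp
    qed
    have sd: "summable (\<lambda>n. cmod (of_real ((\<rho> n - c0) * E n) * X n))"
      by (rule summable_comparison_test[OF _ sC]) (use dn in auto)
    have "(\<lambda>n. of_real (\<rho> n * E n) * X n) sums (of_real c0 * (\<Sum>n. of_real (E n) * X n) + (\<Sum>n. of_real ((\<rho> n - c0) * E n) * X n))"
    proof -
      have "(\<lambda>n. of_real c0 * (of_real (E n) * X n) + of_real ((\<rho> n - c0) * E n) * X n) sums (of_real c0 * (\<Sum>n. of_real (E n) * X n) + (\<Sum>n. of_real ((\<rho> n - c0) * E n) * X n))"
        by (intro sums_add sums_mult summable_sums sEX summable_norm_cancel[OF sd])
      then show ?thesis by (simp add: algebra_simps)
    qed
    with tr have I: "integral {-1/2..1/2} (\<lambda>t. R s (of_int p / real q + t) * kern s (c\<^sup>2) t) = of_real c0 * (\<Sum>n. of_real (E n) * X n) + (\<Sum>n. of_real ((\<rho> n - c0) * E n) * X n)"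
      by (rule sums_unique2)
    have n1: "cmod (\<Sum>n. of_real ((\<rho> n - c0) * E n) * X n) \<le> C"
    proof -
      have "cmod (\<Sum>n. of_real ((\<rho> n - c0) * E n) * X n) \<le> (\<Sum>n. cmod (of_real ((\<rho> n - c0) * E n) * X n))" by (rule summable_norm[OF sd])
      also have "\<dots> \<le> C" unfolding C_def by (intro suminf_le dn sd sC)
      finally show ?thesis .
    qed
    have n2: "cmod (of_real c0 * (\<Sum>n. of_real (E n) * X n)) = c0 * cmod (\<Sum>n. of_real (E n) * X n)" using c0 by (simp add: norm_mult)
    have "cmod (integral {-1/2..1/2} (\<lambda>t. R s (of_int p / real q + t) * kern s (c\<^sup>2) t)) \<ge> c0 * cmod (\<Sum>n. of_real (E n) * X n) - C"
      unfolding I using n1 n2 norm_diff_ineq[of "of_real c0 * (\<Sum>n. of_real (E n) * X n)" "\<Sum>n. of_real ((\<rho> n - c0) * E n) * X n"]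
      by linarith
    then show ?thesis unfolding E_def X_def .
  qed
  then show ?thesis using c0 C0 by blast
qed

text \<open>The transform is tested at p/q with \<rho> = Q^(-\<tau>) and c^2 =
  Q^(-\<tau>-\<epsilon>). The theta sum makes it at least of order 1/(c sqrt Q), regularity \<beta>
  makes it at most of order \<rho>^\<beta> c^(-2s). As \<epsilon> tends to 0, comparing powers of Q
  gives \<tau>\<beta> <= \<tau>(s-1/2) + 1/2. The condition \<tau> >= 2 keeps qc below 1.\<close>

lemma holder_exponent_le_approximable:
  assumes s: "s > 1/2" and \<tau>: "\<tau> \<ge> 2"
    and app: "\<And>Q0::nat. \<exists>Q q p. Q0 \<le> Q \<and> 0 < q \<and> q \<le> Q \<and> odd q \<and> coprime p (int q) \<and> \<bar>of_int p / real q - x\<bar> \<le> real Q powr (- \<tau>)"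
  shows "holder_exponent (R s) x \<le> ereal (s - 1/2 + 1 / (2 * \<tau>))"
  unfolding holder_exponent_def
proof (rule Sup_least, clarify)
  fix \<alpha> assume H: "holder_at \<alpha> (R s) x"
  define e0 where "e0 = s - 1/2 + 1 / (2 * \<tau>)"
  have "1 / (2 * \<tau>) \<le> 1 / (2 * 2)" using \<tau> by (intro divide_left_mono) auto
  then have e0: "e0 \<le> s - 1/4" by (simp add: e0_def)
  have e0p: "e0 > 0" unfolding e0_def using s \<tau> by (intro add_pos_pos) auto
  have "\<alpha> \<le> e0"
  proof (rule ccontr)
    assume "\<not> \<alpha> \<le> e0"
    then have ae: "\<alpha> > e0" by simp
    \<comment> \<open>The upper bound for the transform requires \<beta> < s; as e0 <= s-1/4, the
      cap s-1/8 still leaves \<beta> > e0.\<close>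
    define \<beta> where "\<beta> = min \<alpha> (s - 1/8)"
    have b: "0 \<le> \<beta>" "\<beta> < s" "\<beta> \<le> \<alpha>" "\<beta> > e0" using ae e0 e0p by (auto simp: \<beta>_def)
    \<comment> \<open>Small enough that the net exponent \<gamma> of the final comparison stays
      positive: \<epsilon>s is half of \<tau>(\<beta>-e0).\<close>
    define \<epsilon> where "\<epsilon> = \<tau> * (\<beta> - e0) / (2 * s)"
    have eps: "\<epsilon> > 0" unfolding \<epsilon>_def using b \<tau> s by simp
    define \<gamma> where "\<gamma> = \<tau> * \<beta> - 1/2 - (\<tau> + \<epsilon>) * (s - 1/2)"
    have g: "\<gamma> > 0"
    proof -
      have e1: "\<epsilon> * s = \<tau> * (\<beta> - e0) / 2" unfolding \<epsilon>_def using s by simp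
      have e2: "\<tau> * e0 = \<tau> * (s - 1/2) + 1/2" unfolding e0_def using \<tau> by (simp add: field_simps)
      have "\<gamma> = \<tau> * (\<beta> - e0) - \<epsilon> * s + \<epsilon> / 2"
        unfolding \<gamma>_def right_diff_distrib[of \<tau> \<beta>] e2 by (simp add: algebra_simps)
      then have "\<gamma> = \<tau> * (\<beta> - e0) / 2 + \<epsilon> / 2" unfolding e1 by simp
      moreover have "\<tau> * (\<beta> - e0) > 0" using \<tau> b by simp
      ultimately show ?thesis using eps by simp
    qed
    \<comment> \<open>Since qc <= Q^(-\<epsilon>/2), this many averagings bring the theta error down
      to 1/Q.\<close>
    define M where "M = Suc (nat \<lceil>2 / \<epsilon>\<rceil>)"
    have M: "M > 0" "2 / \<epsilon> \<le> real M" unfolding M_def by (simp, linarith)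
    have M2: "1 \<le> \<epsilon> / 2 * real M" using M(2) eps by (simp add: field_simps)
    obtain C1 where C1: "C1 \<ge> 0" and th: "\<And>q p c. q > 0 \<Longrightarrow> odd q \<Longrightarrow> coprime p (int q) \<Longrightarrow> 0 < c \<Longrightarrow> c \<le> 1 \<Longrightarrow> real q * c \<le> 1 \<Longrightarrow>
       summable (\<lambda>n. exp (- (c * real (Suc n))\<^sup>2)) \<and>
       cmod (\<Sum>n. of_real (exp (- (c * real (Suc n))\<^sup>2)) * quadchar q p (int (Suc n))) \<ge> (exp (-1) / (c * sqrt (real q)) - C1 * (real q * c) ^ M / c - 1) / 2"
      using theta_lower_bound[OF M(1)] by blast
    obtain c0 C2 where c0: "c0 > 0" and C2: "C2 \<ge> 0" and lo: "\<And>q p c. q > 0 \<Longrightarrow> 0 < c \<Longrightarrow> summable (\<lambda>n. exp (- (c * real (Suc n))\<^sup>2)) \<Longrightarrow>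
       cmod (integral {-1/2..1/2} (\<lambda>t. R s (of_int p / real q + t) * kern s (c\<^sup>2) t))
        \<ge> c0 * cmod (\<Sum>n. of_real (exp (- (c * real (Suc n))\<^sup>2)) * quadchar q p (int (Suc n))) - C2"
      using transform_lower_bound[OF s] by blast
    obtain C3 where C3: "C3 > 0" and hi: "\<And>a \<rho> y. 0 < a \<Longrightarrow> a \<le> \<rho> \<Longrightarrow> \<rho> \<le> 1/2 \<Longrightarrow> \<bar>y - x\<bar> \<le> \<rho> \<Longrightarrow>
       cmod (integral {-1/2..1/2} (\<lambda>t. R s (y + t) * kern s a t)) \<le> C3 * \<rho> powr \<beta> * a powr (- s)"
      using transform_upper_bound[OF s b(1-3) H] by blast
    \<comment> \<open>One factor 1/2 comes from the theta bound; the other leaves room for the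
      errors, which are smaller than the main term by Q^(-1/2).\<close>
    define \<kappa> where "\<kappa> = c0 * exp (-1) / 4"
    have k0: "\<kappa> > 0" using c0 by (simp add: \<kappa>_def)
    define K where "K = c0 * (C1 + 1) / 2 + C2"
    have K0: "K \<ge> 0" using c0 C1 C2 by (simp add: K_def)
    have "(\<lambda>Q::nat. K * real Q powr (-1/2)) \<longlonglongrightarrow> 0" by real_asymp
    then have ev1: "eventually (\<lambda>Q::nat. K * real Q powr (-1/2) < \<kappa>) sequentially" using k0 by (rule order_tendstoD(2))
    have "(\<lambda>Q::nat. C3 * real Q powr (- \<gamma>)) \<longlonglongrightarrow> 0" using g by real_asymp
    then have ev2: "eventually (\<lambda>Q::nat. C3 * real Q powr (- \<gamma>) < \<kappa>) sequentially" using k0 by (rule order_tendstoD(2))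
    obtain Q0 where Q0: "\<And>Q. Q \<ge> Q0 \<Longrightarrow> K * real Q powr (-1/2) < \<kappa> \<and> C3 * real Q powr (- \<gamma>) < \<kappa>"
      using eventually_conj[OF ev1 ev2] unfolding eventually_sequentially by blast
    obtain Q q p where Q: "max Q0 2 \<le> Q" and q: "0 < q" "q \<le> Q" "odd q" "coprime p (int q)" and px: "\<bar>of_int p / real q - x\<bar> \<le> real Q powr (- \<tau>)"
      using app[of "max Q0 2"] by blast
    have Q2: "real Q \<ge> 2" "real Q > 0" "real Q \<ge> 1" using Q by auto
    define c where "c = real Q powr (- ((\<tau> + \<epsilon>) / 2))"
    define \<rho> where "\<rho> = real Q powr (- \<tau>)"
    have c: "0 < c" using Q2 by (simp add: c_def)
    have cc: "c\<^sup>2 = real Q powr (- (\<tau> + \<epsilon>))" unfolding c_def power2_eq_square powr_add[symmetric]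
      by (rule arg_cong[of _ _ "(powr) (real Q)"]) simp
    have cQ: "c \<le> real Q powr (-1)" unfolding c_def using Q2 \<tau> eps by (intro powr_mono) auto
    have Qm1: "real Q powr (-1) \<le> 1" using Q2 powr_mono[of "-1" 0 "real Q"] by simp
    have c1: "c \<le> 1" using cQ Qm1 by linarith
    have qc: "real q * c \<le> real Q powr (- (\<epsilon> / 2))"
    proof -
      have "real q * c \<le> real Q powr 1 * c" using q Q2 c by (intro mult_right_mono) auto
      also have "\<dots> = real Q powr (1 - (\<tau> + \<epsilon>) / 2)" unfolding c_def powr_add[symmetric] by simp
      also have "\<dots> \<le> real Q powr (- (\<epsilon> / 2))" using Q2 \<tau> by (intro powr_mono) (auto simp: field_simps)
      finally show ?thesis .
    qed
    have qc1: "real q * c \<le> 1" using qc powr_mono[of "- (\<epsilon>/2)" 0 "real Q"] eps Q2 by simp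
    have qcM: "(real q * c) ^ M \<le> real Q powr (-1)"
    proof -
      have "(real q * c) ^ M \<le> (real Q powr (- (\<epsilon> / 2))) ^ M" using qc c by (intro power_mono) auto
      also have "\<dots> = real Q powr (- (\<epsilon> / 2 * real M))" using Q2 by (simp add: powr_power mult.commute)
      also have "\<dots> \<le> real Q powr (-1)" using Q2 M2 by (intro powr_mono) auto
      finally show ?thesis .
    qed
    \<comment> \<open>Multiplied by c, the main term of the lower bound has order w and every error
      order w^2.\<close>
    define w where "w = real Q powr (-1/2)"
    have w: "w > 0" using Q2 by (simp add: w_def)
    have ww: "real Q powr (-1) = w * w" unfolding w_def powr_add[symmetric] by simp
    define W where "W = cmod (integral {-1/2..1/2} (\<lambda>t. R s (of_int p / real q + t) * kern s (c\<^sup>2) t))"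
    define \<Theta> where "\<Theta> = cmod (\<Sum>n. of_real (exp (- (c * real (Suc n))\<^sup>2)) * quadchar q p (int (Suc n)))"
    have T1: "summable (\<lambda>n. exp (- (c * real (Suc n))\<^sup>2))" and T2: "\<Theta> \<ge> (exp (-1) / (c * sqrt (real q)) - C1 * (real q * c) ^ M / c - 1) / 2"
      unfolding \<Theta>_def using th[OF q(1,3,4) c c1 qc1] by auto
    have W1: "W \<ge> c0 * \<Theta> - C2" unfolding W_def \<Theta>_def by (rule lo[OF q(1) c T1])
    have T3: "c * \<Theta> \<ge> (exp (-1) * w - (C1 + 1) * (w * w)) / 2"
    proof -
      have A: "c * \<Theta> \<ge> c * ((exp (-1) / (c * sqrt (real q)) - C1 * (real q * c) ^ M / c - 1) / 2)" using T2 c by (intro mult_left_mono) auto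
      have B: "c * ((exp (-1) / (c * sqrt (real q)) - C1 * (real q * c) ^ M / c - 1) / 2) = (exp (-1) / sqrt (real q) - C1 * (real q * c) ^ M - c) / 2"
      proof -
        have "k * ((a / (k * z) - b / k - 1) / 2) = (a / z - b - k) / 2" if "k \<noteq> 0" for a b z k :: real
          using that by (simp add: right_diff_distrib)
        from this[of c] show ?thesis using c by simp
      qed
      have "exp (-1) / sqrt (real q) \<ge> exp (-1) * w"
      proof -
        have "w = inverse (real Q powr (1/2))" unfolding w_def powr_minus[symmetric] by simp
        also have "real Q powr (1/2) = sqrt (real Q)" using Q2 by (intro powr_half_sqrt) auto
        finally have "w = 1 / sqrt (real Q)" by (simp only: inverse_eq_divide)
        also have "\<dots> \<le> 1 / sqrt (real q)" using q by (intro divide_left_mono) auto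
        finally have "exp (-1) * w \<le> exp (-1) * (1 / sqrt (real q))" by (intro mult_left_mono) auto
        then show ?thesis by simp
      qed
      moreover have "C1 * (real q * c) ^ M \<le> C1 * (w * w)" using qcM ww C1 by (intro mult_left_mono) auto
      moreover have "c \<le> w * w" using cQ ww by simp
      moreover have "(C1 + 1) * (w * w) = C1 * (w * w) + w * w" by (simp add: distrib_right)
      ultimately have "exp (-1) * w - (C1 + 1) * (w * w) \<le> exp (-1) / sqrt (real q) - C1 * (real q * c) ^ M - c" by linarith
      then have "(exp (-1) * w - (C1 + 1) * (w * w)) / 2 \<le> (exp (-1) / sqrt (real q) - C1 * (real q * c) ^ M - c) / 2"
        by (rule divide_right_mono) simp
      then show ?thesis using A[unfolded B] by (rule order_trans)
    qed
    have "c * W \<ge> c0 * (c * \<Theta>) - C2 * c" using mult_left_mono[OF W1, of c] c by (simp add: algebra_simps)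
    moreover have "c0 * (c * \<Theta>) \<ge> c0 * ((exp (-1) * w - (C1 + 1) * (w * w)) / 2)" using T3 c0 by (intro mult_left_mono) auto
    moreover have "C2 * c \<le> C2 * (w * w)" using cQ ww C2 by (intro mult_left_mono) auto
    ultimately have "c * W \<ge> c0 * ((exp (-1) * w - (C1 + 1) * (w * w)) / 2) - C2 * (w * w)" by linarith
    also have "c0 * ((exp (-1) * w - (C1 + 1) * (w * w)) / 2) - C2 * (w * w) = w * (2 * \<kappa> - K * w)"
      unfolding \<kappa>_def K_def by (simp add: field_simps)
    finally have cW: "c * W \<ge> w * (2 * \<kappa> - K * w)" .
    have "K * w < \<kappa>" using Q0[of Q] Q by (simp add: w_def)
    then have "w * (2 * \<kappa> - K * w) > w * \<kappa>" using w by (intro mult_strict_left_mono) auto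
    then have low: "c * W > w * \<kappa>" using cW by linarith
    have "W \<le> C3 * \<rho> powr \<beta> * (c\<^sup>2) powr (- s)" unfolding W_def
    proof (rule hi)
      show "0 < c\<^sup>2" using c by simp
      show "c\<^sup>2 \<le> \<rho>" unfolding cc \<rho>_def using Q2 eps by (intro powr_mono) auto
      have "\<rho> \<le> real Q powr (-2)" unfolding \<rho>_def using Q2 \<tau> by (intro powr_mono) auto
      also have "\<dots> \<le> 2 powr (-2)" using Q2 by (intro powr_mono2') auto
      also have "\<dots> \<le> 1/2" by (simp add: powr_minus)
      finally show "\<rho> \<le> 1/2" .
      show "\<bar>of_int p / real q - x\<bar> \<le> \<rho>" unfolding \<rho>_def by (rule px)
    qed
    then have "c * W \<le> c * (C3 * \<rho> powr \<beta> * (c\<^sup>2) powr (- s))" using c by (intro mult_left_mono) auto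
    also have "\<dots> = C3 * (c * (\<rho> powr \<beta> * (c\<^sup>2) powr (- s)))" by (simp only: mult_ac)
    also have "c * (\<rho> powr \<beta> * (c\<^sup>2) powr (- s)) = w * real Q powr (- \<gamma>)"
      unfolding cc unfolding \<rho>_def c_def w_def powr_powr powr_add[symmetric]
      by (rule arg_cong[of _ _ "(powr) (real Q)"]) (simp add: \<gamma>_def field_simps)
    finally have "w * \<kappa> < w * (C3 * real Q powr (- \<gamma>))" using low by (simp add: mult_ac)
    then have "\<kappa> < C3 * real Q powr (- \<gamma>)" using w by simp
    then show False using Q0[of Q] Q by simp
  qed
  then show "ereal \<alpha> \<le> ereal (s - 1/2 + 1 / (2 * \<tau>))" by (simp add: e0_def)
qed

subsection \<open>Counting fractions with odd denominators\<close>

definition nums :: "real \<Rightarrow> real \<Rightarrow> nat \<Rightarrow> int set" where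
  "nums c \<rho> q = {p. \<bar>of_int p / real q - c\<bar> \<le> \<rho>}"

lemma nums_eq: "q > 0 \<Longrightarrow> nums c \<rho> q = {\<lceil>real q * (c - \<rho>)\<rceil>..\<lfloor>real q * (c + \<rho>)\<rfloor>}"
proof -
  assume q: "q > 0"
  have "\<bar>of_int p / real q - c\<bar> \<le> \<rho> \<longleftrightarrow> real q * (c - \<rho>) \<le> of_int p \<and> of_int p \<le> real q * (c + \<rho>)" for p :: int
  proof -
    have "\<bar>of_int p / real q - c\<bar> \<le> \<rho> \<longleftrightarrow> c - \<rho> \<le> of_int p / real q \<and> of_int p / real q \<le> c + \<rho>" by (rule abs_diff_le_iff)
    moreover have "c - \<rho> \<le> of_int p / real q \<longleftrightarrow> (c - \<rho>) * real q \<le> of_int p" by (rule pos_le_divide_eq) (use q in simp)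
    moreover have "of_int p / real q \<le> c + \<rho> \<longleftrightarrow> of_int p \<le> (c + \<rho>) * real q" by (rule pos_divide_le_eq) (use q in simp)
    ultimately show ?thesis by (simp only: mult.commute[of "real q"])
  qed
  then show ?thesis unfolding nums_def set_eq_iff by (simp only: mem_Collect_eq atLeastAtMost_iff ceiling_le_iff le_floor_iff simp_thms)
qed

lemma nums_card:
  assumes q: "q > 0" and r: "\<rho> \<ge> 0"
  shows "finite (nums c \<rho> q)" "real (card (nums c \<rho> q)) \<le> 2 * \<rho> * real q + 1" "2 * \<rho> * real q - 1 \<le> real (card (nums c \<rho> q))"
proof -
  define A where "A = real q * (c - \<rho>)"
  define B where "B = real q * (c + \<rho>)"
  have AB: "B - A = 2 * \<rho> * real q" by (simp add: A_def B_def algebra_simps)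
  have e: "nums c \<rho> q = {\<lceil>A\<rceil>..\<lfloor>B\<rfloor>}" unfolding A_def B_def by (rule nums_eq[OF q])
  show "finite (nums c \<rho> q)" unfolding e by simp
  have BA: "A \<le> B" using AB r by (metis diff_ge_0_iff_ge mult_nonneg_nonneg of_nat_0_le_iff zero_le_numeral)
  have card: "real (card (nums c \<rho> q)) = real (nat (\<lfloor>B\<rfloor> - \<lceil>A\<rceil> + 1))" unfolding e by (simp add: algebra_simps)
  have "\<lceil>A\<rceil> \<le> \<lfloor>B\<rfloor> + 1" using BA by linarith
  then have card': "real (card (nums c \<rho> q)) = of_int \<lfloor>B\<rfloor> - of_int \<lceil>A\<rceil> + 1" unfolding card by simp
  show "real (card (nums c \<rho> q)) \<le> 2 * \<rho> * real q + 1" unfolding card' AB[symmetric] by linarith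
  show "2 * \<rho> * real q - 1 \<le> real (card (nums c \<rho> q))" unfolding card' AB[symmetric] by linarith
qed

text \<open>Fractions are kept unreduced here, because for each denominator the numerators are
  simply the integers in an interval; non-reduced pairs are removed afterwards.\<close>

definition oddpairs :: "real \<Rightarrow> real \<Rightarrow> nat \<Rightarrow> (int \<times> nat) set" where
  "oddpairs c \<rho> X = {(p,q). odd q \<and> q \<le> X \<and> p \<in> nums c \<rho> q}"

lemma oddpairs_eq: "oddpairs c \<rho> X = (\<lambda>(i,p). (p, 2 * i + 1)) ` Sigma {..<(X + 1) div 2} (\<lambda>i. nums c \<rho> (2 * i + 1))"
proof (intro set_eqI iffI)
  fix x assume "x \<in> oddpairs c \<rho> X"
  then obtain p q where x: "x = (p,q)" "odd q" "q \<le> X" "p \<in> nums c \<rho> q" by (auto simp: oddpairs_def)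
  then obtain i where i: "q = 2 * i + 1" by (elim oddE)
  then have "i < (X + 1) div 2" using x by linarith
  then have "(i, p) \<in> Sigma {..<(X + 1) div 2} (\<lambda>i. nums c \<rho> (2 * i + 1))" using x i by auto
  then show "x \<in> (\<lambda>(i,p). (p, 2 * i + 1)) ` Sigma {..<(X + 1) div 2} (\<lambda>i. nums c \<rho> (2 * i + 1))"
    using x i by (auto simp: image_iff intro!: bexI[of _ "(i,p)"])
next
  fix x assume "x \<in> (\<lambda>(i,p). (p, 2 * i + 1)) ` Sigma {..<(X + 1) div 2} (\<lambda>i. nums c \<rho> (2 * i + 1))"
  then obtain i p where h: "i < (X + 1) div 2" "p \<in> nums c \<rho> (2 * i + 1)" "x = (p, 2 * i + 1)" by auto
  have "2 * i + 1 \<le> X" using h(1) by linarith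
  then show "x \<in> oddpairs c \<rho> X" using h by (simp add: oddpairs_def)
qed

lemma sum_odds: "(\<Sum>i<n. real (2 * i + 1)) = (real n)\<^sup>2"
  by (induction n) (auto simp: power2_eq_square algebra_simps)

lemma oddpairs_card:
  assumes r: "\<rho> \<ge> 0"
  shows "finite (oddpairs c \<rho> X)"
    "real (card (oddpairs c \<rho> X)) \<le> \<rho> * (real X + 1)\<^sup>2 / 2 + (real X + 1) / 2"
    "\<rho> * (real X)\<^sup>2 / 2 - (real X + 1) / 2 \<le> real (card (oddpairs c \<rho> X))"
proof -
  define n where "n = (X + 1) div 2"
  have n: "real X / 2 \<le> real n" "real n \<le> (real X + 1) / 2"
  proof -
    have "X \<le> 2 * n" "2 * n \<le> X + 1" unfolding n_def by linarith+
    then have "real X \<le> real (2 * n)" "real (2 * n) \<le> real (X + 1)" by (simp_all only: of_nat_le_iff)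
    then show "real X / 2 \<le> real n" "real n \<le> (real X + 1) / 2" by auto
  qed
  have fin: "finite (nums c \<rho> (2 * i + 1))" for i using nums_card(1)[of "2 * i + 1"] r by simp
  have finS: "finite (Sigma {..<n} (\<lambda>i. nums c \<rho> (2 * i + 1)))" using fin by auto
  show "finite (oddpairs c \<rho> X)" unfolding oddpairs_eq n_def[symmetric] using finS by simp
  have "card (oddpairs c \<rho> X) = card (Sigma {..<n} (\<lambda>i. nums c \<rho> (2 * i + 1)))"
    unfolding oddpairs_eq n_def[symmetric] by (rule card_image) (auto simp: inj_on_def)
  also have "\<dots> = (\<Sum>i<n. card (nums c \<rho> (2 * i + 1)))" using fin by (intro card_SigmaI) auto
  finally have card: "real (card (oddpairs c \<rho> X)) = (\<Sum>i<n. real (card (nums c \<rho> (2 * i + 1))))" by simp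
  have "real (card (oddpairs c \<rho> X)) \<le> (\<Sum>i<n. 2 * \<rho> * real (2 * i + 1) + 1)"
    unfolding card by (intro sum_mono nums_card(2) r) simp
  also have "\<dots> = 2 * \<rho> * (real n)\<^sup>2 + real n" unfolding sum.distrib sum_distrib_left[symmetric] sum_odds by simp
  also have "\<dots> \<le> 2 * \<rho> * ((real X + 1) / 2)\<^sup>2 + (real X + 1) / 2"
    using n r by (intro add_mono mult_left_mono power_mono) auto
  also have "\<dots> = \<rho> * (real X + 1)\<^sup>2 / 2 + (real X + 1) / 2" by (simp add: power_divide)
  finally show "real (card (oddpairs c \<rho> X)) \<le> \<rho> * (real X + 1)\<^sup>2 / 2 + (real X + 1) / 2" .
  have "\<rho> * (real X)\<^sup>2 / 2 - (real X + 1) / 2 = 2 * \<rho> * (real X / 2)\<^sup>2 - (real X + 1) / 2" by (simp add: power_divide)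
  also have "\<dots> \<le> 2 * \<rho> * (real n)\<^sup>2 - real n"
    using n r by (intro diff_mono mult_left_mono power_mono) auto
  also have "\<dots> = (\<Sum>i<n. 2 * \<rho> * real (2 * i + 1) - 1)" unfolding sum_subtractf sum_distrib_left[symmetric] sum_odds by simp
  also have "\<dots> \<le> real (card (oddpairs c \<rho> X))" unfolding card by (intro sum_mono nums_card(3) r) simp
  finally show "\<rho> * (real X)\<^sup>2 / 2 - (real X + 1) / 2 \<le> real (card (oddpairs c \<rho> X))" .
qed

text \<open>A nontrivial common divisor of an odd q and p is odd, hence some 2j+3. Cancelling it
  keeps the value of the fraction and leaves a denominator of size at most Q/(2j+3).\<close>

lemma noncoprime_cover:
  "{x \<in> oddpairs c \<rho> Q. \<not> coprime (fst x) (int (snd x))} \<subseteq> (\<Union>j<Q. (\<lambda>(p,q). (int (2 * j + 3) * p, (2 * j + 3) * q)) ` oddpairs c \<rho> (Q div (2 * j + 3)))"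
proof
  fix x assume "x \<in> {x \<in> oddpairs c \<rho> Q. \<not> coprime (fst x) (int (snd x))}"
  then obtain p q where x: "x = (p,q)" "odd q" "q \<le> Q" "p \<in> nums c \<rho> q" "\<not> coprime p (int q)" by (auto simp: oddpairs_def)
  define d where "d = nat (gcd p (int q))"
  have q0: "q > 0" using x(2) by (auto intro: Nat.gr0I)
  have dint: "int d = gcd p (int q)" by (simp add: d_def)
  have dq: "d dvd q" using dint by (metis gcd_dvd2 int_dvd_int_iff)
  have d1: "d \<noteq> 1" using x(5) dint coprime_iff_gcd_eq_1 by (metis of_nat_1)
  have d0: "d > 0" using dq q0 by (auto intro: Nat.gr0I)
  have "odd d" using dq x(2) by (meson dvd_trans)
  then obtain i where i: "d = 2 * i + 1" by (elim oddE)
  have "i \<noteq> 0" using i d1 by auto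
  then obtain j where j: "i = Suc j" using not0_implies_Suc by blast
  have dj: "d = 2 * j + 3" using i j by simp
  obtain q' where q': "q = d * q'" using dq by auto
  have "int d dvd p" using dint by simp
  then obtain p' where p': "p = int d * p'" by auto
  have q'0: "q' > 0" using q' q0 by (auto intro: Nat.gr0I)
  have "d \<le> Q" using dvd_imp_le[OF dq q0] x(3) by linarith
  then have jQ: "j < Q" using dj by linarith
  have "odd q'" using x(2) q' by auto
  moreover have "q' \<le> Q div d" using x(3) q' d0 by (simp add: less_eq_div_iff_mult_less_eq mult.commute)
  moreover have "p' \<in> nums c \<rho> q'"
  proof -
    have "real_of_int p / real q = of_int p' / real q'" using p' q' d0 by simp
    then show ?thesis using x(4) by (simp add: nums_def)
  qed
  ultimately have "(p', q') \<in> oddpairs c \<rho> (Q div (2 * j + 3))" using dj by (simp add: oddpairs_def)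
  moreover have "x = (\<lambda>(p,q). (int (2 * j + 3) * p, (2 * j + 3) * q)) (p', q')" using x(1) p' q' dj by simp
  ultimately show "x \<in> (\<Union>j<Q. (\<lambda>(p,q). (int (2 * j + 3) * p, (2 * j + 3) * q)) ` oddpairs c \<rho> (Q div (2 * j + 3)))"
    using jQ by blast
qed

text \<open>(2j+3)^2 exceeds 4(j+1)(j+2) by just 1, and the reciprocals of the latter telescope to
  at most 1/4.\<close>

lemma sum_inverse_odd_squares: "(\<Sum>j<n. 1 / (real (2 * j + 3))\<^sup>2) \<le> 1/4"
proof -
  have "(\<Sum>j<n. 1 / (real (2 * j + 3))\<^sup>2) \<le> (\<Sum>j<n. 1/4 * (1 / real (j + 1) - 1 / real (Suc j + 1)))"
  proof (rule sum_mono)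
    fix j
    have "1/4 * (1 / real (j + 1) - 1 / real (Suc j + 1)) = 1 / (4 * (real j + 1) * (real j + 2))" by (simp add: field_simps)
    moreover have "4 * (real j + 1) * (real j + 2) \<le> (real (2 * j + 3))\<^sup>2" by (simp add: power2_eq_square algebra_simps)
    ultimately show "1 / (real (2 * j + 3))\<^sup>2 \<le> 1/4 * (1 / real (j + 1) - 1 / real (Suc j + 1))"
      by (simp only:) (intro frac_le, auto)
  qed
  also have "\<dots> = 1/4 * (\<Sum>j<n. 1 / real (j + 1) - 1 / real (Suc j + 1))" by (rule sum_distrib_left[symmetric])
  also have "(\<Sum>j<n. 1 / real (j + 1) - 1 / real (Suc j + 1)) = 1 / real (0 + 1) - 1 / real (n + 1)"
    by (rule sum_lessThan_telescope')
  also have "1/4 * (1 / real (0 + 1) - 1 / real (n + 1)) \<le> 1/4" by simp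
  finally show ?thesis .
qed

text \<open>There are about \<rho>Q^2/2 pairs, of which at most a quarter fail to be coprime, up to
  O(Q log Q). The remaining 3/8 is weakened to 1/4 to absorb the error. The threshold for Q is
  uniform in the centre c, since the Cantor construction fixes its scales before its
  centres.\<close>

lemma coprime_odd_count:
  assumes r: "\<rho> > 0"
  shows "eventually (\<lambda>Q::nat. \<forall>c. \<rho> * (real Q)\<^sup>2 / 4 \<le> real (card {x \<in> oddpairs c \<rho> Q. coprime (fst x) (int (snd x))})) sequentially"
proof -
  have r0: "\<rho> \<ge> 0" using r by simp
  have main: "3 / 8 * \<rho> * (real Q)\<^sup>2 - (\<rho> + 2) * real Q * (2 + ln (real Q + 1)) - 1 \<le> real (card {x \<in> oddpairs c \<rho> Q. coprime (fst x) (int (snd x))})" for c Q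
  proof -
    let ?C = "{x \<in> oddpairs c \<rho> Q. coprime (fst x) (int (snd x))}" and ?N = "{x \<in> oddpairs c \<rho> Q. \<not> coprime (fst x) (int (snd x))}"
    have fin: "finite (oddpairs c \<rho> Q)" by (rule oddpairs_card(1)[OF r0])
    have "card (oddpairs c \<rho> Q) = card ?C + card ?N"
    proof -
      have "oddpairs c \<rho> Q = ?C \<union> ?N" by auto
      moreover have "?C \<inter> ?N = {}" by auto
      ultimately show ?thesis using fin card_Un_disjoint[of ?C ?N] by (metis (no_types, lifting) finite_Un)
    qed
    then have eq: "real (card ?C) = real (card (oddpairs c \<rho> Q)) - real (card ?N)" by simp
    have "card ?N \<le> card (\<Union>j<Q. (\<lambda>(p,q). (int (2 * j + 3) * p, (2 * j + 3) * q)) ` oddpairs c \<rho> (Q div (2 * j + 3)))"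
      by (rule card_mono[OF _ noncoprime_cover]) (use oddpairs_card(1)[OF r0] in auto)
    also have "\<dots> \<le> (\<Sum>j<Q. card ((\<lambda>(p,q). (int (2 * j + 3) * p, (2 * j + 3) * q)) ` oddpairs c \<rho> (Q div (2 * j + 3))))"
      by (rule card_UN_le) simp
    also have "\<dots> \<le> (\<Sum>j<Q. card (oddpairs c \<rho> (Q div (2 * j + 3))))"
      by (intro sum_mono card_image_le oddpairs_card(1)[OF r0])
    finally have "real (card ?N) \<le> real (\<Sum>j<Q. card (oddpairs c \<rho> (Q div (2 * j + 3))))" by (simp only: of_nat_le_iff)
    also have "\<dots> = (\<Sum>j<Q. real (card (oddpairs c \<rho> (Q div (2 * j + 3)))))" by simp
    also have "\<dots> \<le> (\<Sum>j<Q. \<rho> * (real Q)\<^sup>2 / 2 * (1 / (real (2 * j + 3))\<^sup>2) + (\<rho> + 1/2) * real Q * (1 / real (Suc j)) + (\<rho> + 1) / 2)"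
    proof (rule sum_mono)
      fix j
      define D where "D = real (2 * j + 3)"
      have D: "D > 0" "D \<ge> real (Suc j)" by (auto simp: D_def)
      define X where "X = real (Q div (2 * j + 3))"
      have X: "0 \<le> X" "X \<le> real Q / D" unfolding X_def D_def by (simp, rule of_nat_div_le_of_nat)
      have XQ: "real Q / D \<le> real Q * (1 / real (Suc j))"
        using D by (simp add: divide_left_mono)
      have "real (card (oddpairs c \<rho> (Q div (2 * j + 3)))) \<le> \<rho> * (X + 1)\<^sup>2 / 2 + (X + 1) / 2"
        unfolding X_def by (rule oddpairs_card(2)[OF r0])
      also have "\<dots> = \<rho> / 2 * X\<^sup>2 + (\<rho> + 1/2) * X + (\<rho> + 1) / 2" by (simp add: power2_sum field_simps)
      also have "\<dots> \<le> \<rho> / 2 * (real Q / D)\<^sup>2 + (\<rho> + 1/2) * (real Q * (1 / real (Suc j))) + (\<rho> + 1) / 2"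
        using X XQ r0 by (intro add_mono mult_left_mono power_mono order_trans[OF X(2) XQ]) auto
      also have "\<dots> = \<rho> * (real Q)\<^sup>2 / 2 * (1 / D\<^sup>2) + (\<rho> + 1/2) * real Q * (1 / real (Suc j)) + (\<rho> + 1) / 2"
        by (simp add: power_divide)
      finally show "real (card (oddpairs c \<rho> (Q div (2 * j + 3)))) \<le> \<rho> * (real Q)\<^sup>2 / 2 * (1 / (real (2 * j + 3))\<^sup>2) + (\<rho> + 1/2) * real Q * (1 / real (Suc j)) + (\<rho> + 1) / 2"
        unfolding D_def .
    qed
    also have "\<dots> = \<rho> * (real Q)\<^sup>2 / 2 * (\<Sum>j<Q. 1 / (real (2 * j + 3))\<^sup>2) + (\<rho> + 1/2) * real Q * (\<Sum>j<Q. 1 / real (Suc j)) + real Q * ((\<rho> + 1) / 2)"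
      by (simp only: sum.distrib sum_distrib_left[symmetric] sum_constant card_lessThan)
    also have "\<dots> \<le> \<rho> * (real Q)\<^sup>2 / 2 * (1/4) + (\<rho> + 1/2) * real Q * (1 + ln (real Q + 1)) + real Q * ((\<rho> + 1) / 2)"
    proof (intro add_mono mult_left_mono sum_inverse_odd_squares)
      have "(\<Sum>j<Q. 1 / real (Suc j)) = harm Q"
        unfolding harm_def by (simp add: sum.atLeast1_atMost_eq divide_inverse)
      also note harm_le_ln[of Q]
      finally show "(\<Sum>j<Q. 1 / real (Suc j)) \<le> 1 + ln (real Q + 1)" .
    qed (use r0 in auto)
    finally have N: "real (card ?N) \<le> \<rho> * (real Q)\<^sup>2 / 8 + (\<rho> + 1/2) * real Q * (1 + ln (real Q + 1)) + real Q * ((\<rho> + 1) / 2)" by simp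
    have T: "\<rho> * (real Q)\<^sup>2 / 2 - (real Q + 1) / 2 \<le> real (card (oddpairs c \<rho> Q))" by (rule oddpairs_card(3)[OF r0])
    define l where "l = ln (real Q + 1)"
    have l: "l \<ge> 0" by (simp add: l_def)
    have "0 \<le> real Q * l" using l by simp
    moreover have "0 \<le> \<rho> * real Q" using r0 by simp
    moreover have "(\<rho> + 1/2) * real Q * (1 + l) = \<rho> * real Q + \<rho> * real Q * l + real Q / 2 + real Q * l / 2" by (simp add: algebra_simps add_divide_distrib)
    moreover have "real Q * ((\<rho> + 1) / 2) = \<rho> * real Q / 2 + real Q / 2" by (simp add: algebra_simps add_divide_distrib)
    moreover have "(\<rho> + 2) * real Q * (2 + l) = 2 * (\<rho> * real Q) + \<rho> * real Q * l + 4 * real Q + 2 * (real Q * l)" by (simp add: algebra_simps)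
    moreover have "(real Q + 1) / 2 = real Q / 2 + 1/2" "0 \<le> real Q" by (simp_all add: add_divide_distrib)
    moreover have "3 / 8 * \<rho> * (real Q)\<^sup>2 = \<rho> * (real Q)\<^sup>2 / 2 - \<rho> * (real Q)\<^sup>2 / 8" by simp
    ultimately show ?thesis unfolding eq using N T unfolding l_def[symmetric] by linarith
  qed
  have "eventually (\<lambda>Q::nat. \<rho> * (real Q)\<^sup>2 / 4 \<le> 3 / 8 * \<rho> * (real Q)\<^sup>2 - (\<rho> + 2) * real Q * (2 + ln (real Q + 1)) - 1) sequentially"
    using r by real_asymp
  then show ?thesis
  proof eventually_elim
    case (elim Q)
    show ?case
    proof
      fix c
      show "\<rho> * (real Q)\<^sup>2 / 4 \<le> real (card {x \<in> oddpairs c \<rho> Q. coprime (fst x) (int (snd x))})"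
        by (rule order_trans[OF elim main])
    qed
  qed
qed

text \<open>Distinct fractions with denominators up to Q differ by at least 1/Q^2. Sorting
  accumulates these gaps, so the distance grows in proportion to the difference of the indices; the
  Hoelder estimate needs this within one generation.\<close>

lemma pick_fractions:
  assumes r: "\<rho> > 0"
  shows "eventually (\<lambda>Q::nat. \<forall>c N. real N \<le> \<rho> * (real Q)\<^sup>2 / 4 \<longrightarrow> (\<exists>v::nat \<Rightarrow> real.
     (\<forall>i<N. \<bar>v i - c\<bar> \<le> \<rho> \<and> (\<exists>p q. 0 < q \<and> q \<le> Q \<and> odd q \<and> coprime p (int q) \<and> v i = of_int p / real q)) \<and>
     (\<forall>i j. i < j \<longrightarrow> j < N \<longrightarrow> real (j - i) / (real Q)\<^sup>2 \<le> v j - v i))) sequentially"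
  using coprime_odd_count[OF r]
proof eventually_elim
  case (elim Q)
  show ?case
  proof (intro allI impI)
    fix c :: real and N :: nat assume N: "real N \<le> \<rho> * (real Q)\<^sup>2 / 4"
    define S where "S = {x \<in> oddpairs c \<rho> Q. coprime (fst x) (int (snd x))}"
    define val where "val = (\<lambda>(p,q). real_of_int p / real q)"
    have S: "0 < q \<and> q \<le> Q \<and> odd q \<and> coprime p (int q) \<and> \<bar>val (p,q) - c\<bar> \<le> \<rho>" if "(p,q) \<in> S" for p q
      using that unfolding S_def oddpairs_def nums_def val_def by (auto intro: Nat.gr0I)
    have finS: "finite S" unfolding S_def using oddpairs_card(1)[of \<rho>] r by simp
    have sep: "1 / (real Q)\<^sup>2 \<le> \<bar>val x - val y\<bar>" if xy: "x \<in> S" "y \<in> S" "val x \<noteq> val y" for x y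
    proof -
      obtain p q where x: "x = (p,q)" by (cases x)
      obtain p' q' where y: "y = (p',q')" by (cases y)
      have q: "0 < q" "q \<le> Q" "0 < q'" "q' \<le> Q" using S xy x y by blast+
      have e: "val x - val y = of_int (p * int q' - p' * int q) / (real q * real q')"
        unfolding x y val_def using q by (simp add: field_simps)
      have "p * int q' - p' * int q \<noteq> 0"
      proof
        assume "p * int q' - p' * int q = 0"
        then have "val x - val y = 0" using e by (simp only: of_int_0 div_0)
        then show False using xy(3) by simp
      qed
      then have "1 \<le> \<bar>p * int q' - p' * int q\<bar>" by linarith
      then have "1 \<le> \<bar>real_of_int (p * int q' - p' * int q)\<bar>" by linarith
      then have "1 / (real q * real q') \<le> \<bar>val x - val y\<bar>" unfolding e abs_divide using q by (simp add: divide_right_mono)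
      moreover have "1 / (real Q)\<^sup>2 \<le> 1 / (real q * real q')"
        unfolding power2_eq_square using q by (intro divide_left_mono mult_mono mult_pos_pos) auto
      ultimately show ?thesis by linarith
    qed
    have inj: "inj_on val S"
    proof (rule inj_onI)
      fix x y assume xy: "x \<in> S" "y \<in> S" "val x = val y"
      obtain p q where x: "x = (p,q)" by (cases x)
      obtain p' q' where y: "y = (p',q')" by (cases y)
      have q: "0 < q" "coprime p (int q)" "0 < q'" "coprime p' (int q')" using S xy x y by blast+
      have "real_of_int p * real q' = real_of_int p' * real q" using xy(3) q unfolding x y val_def by (simp add: field_simps)
      then have "real_of_int (p * int q') = real_of_int (p' * int q)" by simp
      then have e: "p * int q' = p' * int q" by (simp only: of_int_eq_iff)
      have "int q dvd p * int q'" using e by simp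
      then have "int q dvd int q'" using q(2) by (simp add: coprime_dvd_mult_right_iff coprime_commute)
      moreover have "int q' dvd p' * int q" using e by (metis dvd_triv_right)
      then have "int q' dvd int q" using q(4) by (simp add: coprime_dvd_mult_right_iff coprime_commute)
      ultimately have "q = q'" by (simp add: dvd_antisym)
      then show "x = y" using e q x y by simp
    qed
    define xs where "xs = sorted_list_of_set (val ` S)"
    have len: "length xs = card S" unfolding xs_def using card_image[OF inj] by simp
    have "real N \<le> real (card S)" unfolding S_def by (rule order_trans[OF N elim[rule_format]])
    then have NS: "N \<le> length xs" unfolding len by simp
    have setxs: "set xs = val ` S" unfolding xs_def using finS by simp
    have srt: "xs ! i < xs ! j" if "i < j" "j < length xs" for i j
      using strict_sorted_list_of_set[of "val ` S"] sorted_wrt_nth_less[of "(<)" xs i j] that unfolding xs_def by blast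
    have gap: "1 / (real Q)\<^sup>2 \<le> xs ! Suc i - xs ! i" if "Suc i < length xs" for i
    proof -
      have "xs ! Suc i \<in> val ` S" "xs ! i \<in> val ` S"
        using nth_mem[of "Suc i" xs] nth_mem[of i xs] that unfolding setxs by simp_all
      then obtain x y where "x \<in> S" "y \<in> S" "xs ! Suc i = val x" "xs ! i = val y" by blast
      then show ?thesis using sep[of x y] srt[of i "Suc i"] that by simp
    qed
    have "real (j - i) / (real Q)\<^sup>2 \<le> xs ! j - xs ! i" if "i < j" "j < length xs" for i j
      using that
    proof (induction j)
      case (Suc j)
      show ?case
      proof (cases "i = j")
        case True
        then show ?thesis using gap[of j] Suc by simp
      next
        case False
        then have "real (j - i) / (real Q)\<^sup>2 \<le> xs ! j - xs ! i" using Suc by simp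
        moreover have "1 / (real Q)\<^sup>2 \<le> xs ! Suc j - xs ! j" using gap[of j] Suc by simp
        moreover have "real (Suc j - i) / (real Q)\<^sup>2 = real (j - i) / (real Q)\<^sup>2 + 1 / (real Q)\<^sup>2"
          using Suc.prems False by (simp add: Suc_diff_le add_divide_distrib[symmetric])
        ultimately show ?thesis by linarith
      qed
    qed simp
    moreover have "\<bar>xs ! i - c\<bar> \<le> \<rho> \<and> (\<exists>p q. 0 < q \<and> q \<le> Q \<and> odd q \<and> coprime p (int q) \<and> xs ! i = of_int p / real q)" if "i < N" for i
    proof -
      have "xs ! i \<in> val ` S" using nth_mem[of i xs] that NS unfolding setxs by simp
      then obtain x where x: "x \<in> S" "xs ! i = val x" by blast
      obtain p q where pq: "x = (p,q)" by (cases x)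
      show ?thesis using S[of p q] x pq unfolding val_def by auto
    qed
    ultimately show "\<exists>v::nat \<Rightarrow> real. (\<forall>i<N. \<bar>v i - c\<bar> \<le> \<rho> \<and> (\<exists>p q. 0 < q \<and> q \<le> Q \<and> odd q \<and> coprime p (int q) \<and> v i = of_int p / real q)) \<and>
       (\<forall>i j. i < j \<longrightarrow> j < N \<longrightarrow> real (j - i) / (real Q)\<^sup>2 \<le> v j - v i)"
      using NS by (intro exI[of _ "\<lambda>i. xs ! i"]) auto
  qed
qed

subsection \<open>A Cantor set of well approximable points\<close>

definition good_fracs :: "real \<Rightarrow> nat \<Rightarrow> nat \<Rightarrow> real \<Rightarrow> (nat \<Rightarrow> real) \<Rightarrow> bool" where
  "good_fracs \<rho> Q N c v \<longleftrightarrow>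
     (\<forall>i<N. \<bar>v i - c\<bar> \<le> \<rho> \<and> (\<exists>p q. 0 < q \<and> q \<le> Q \<and> odd q \<and> coprime p (int q) \<and> v i = of_int p / real q)) \<and>
     (\<forall>i j. i < j \<longrightarrow> j < N \<longrightarrow> real (j - i) / (real Q)\<^sup>2 \<le> v j - v i)"

text \<open>The quarter keeps generations apart: for \<tau> >= 2 the radius is at most a quarter of
  the minimal gap 1/Q^2, so two intervals about selected fractions keep half the distance of their
  centres.\<close>

definition crad :: "real \<Rightarrow> nat \<Rightarrow> real" where "crad \<tau> Q = real Q powr (- \<tau>) / 4"

text \<open>The number of children that \<open>pick_fractions\<close> provides within half the
  parent radius: a quarter of (crad/2) Q'^2.\<close>

definition cnum :: "real \<Rightarrow> nat \<Rightarrow> nat \<Rightarrow> nat" where "cnum \<tau> Q Q' = nat \<lfloor>crad \<tau> Q * (real Q')\<^sup>2 / 8\<rfloor>"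

text \<open>For fixed Q all requirements hold once Q' is large. The decisive one makes the number of
  children nearly Q'^2, so that a single generation already yields the dimension 2/\<tau>, however
  small the parent interval is.\<close>

lemma scale_exists:
  assumes \<tau>: "\<tau> \<ge> 2" and Q: "Q \<ge> 1"
  shows "\<exists>Q'. n \<le> Q' \<and> 1 \<le> Q' \<and> crad \<tau> Q' \<le> crad \<tau> Q / 2 \<and> 2 \<le> cnum \<tau> Q Q' \<and>
    crad \<tau> Q * (real Q')\<^sup>2 / 16 \<le> real (cnum \<tau> Q Q') \<and> real Q' powr (2 - 1 / real (Suc n)) \<le> real (cnum \<tau> Q Q') \<and>
    (\<forall>c. \<exists>v. good_fracs (crad \<tau> Q / 2) Q' (cnum \<tau> Q Q') c v)"
proof -
  define \<rho> where "\<rho> = crad \<tau> Q"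
  have r: "\<rho> > 0" using Q by (simp add: \<rho>_def crad_def)
  have e1: "eventually (\<lambda>Q'::nat. max n 1 \<le> Q') sequentially" by (rule eventually_ge_at_top)
  have "(\<lambda>Q'::nat. real Q' powr (- \<tau>) / 4) \<longlonglongrightarrow> 0" using \<tau> by real_asymp
  from order_tendstoD(2)[OF this, of "\<rho> / 2"]
  have e2: "eventually (\<lambda>Q'::nat. real Q' powr (- \<tau>) / 4 < \<rho> / 2) sequentially" using r by simp
  have e3: "eventually (\<lambda>Q'::nat. 4 \<le> \<rho> * (real Q')\<^sup>2 / 8) sequentially" using r by real_asymp
  define k where "k = 1 / real (Suc n)"
  have k: "k > 0" by (simp add: k_def)
  have e4: "eventually (\<lambda>Q'::nat. real Q' powr (2 - k) \<le> \<rho> * (real Q')\<^sup>2 / 16) sequentially" using r k by real_asymp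
  have e5: "eventually (\<lambda>Q'::nat. \<forall>c N. real N \<le> \<rho> / 2 * (real Q')\<^sup>2 / 4 \<longrightarrow> (\<exists>v. good_fracs (\<rho> / 2) Q' N c v)) sequentially"
    using pick_fractions[of "\<rho> / 2"] r unfolding good_fracs_def by simp
  obtain Q' where h: "max n 1 \<le> Q'" "real Q' powr (- \<tau>) / 4 < \<rho> / 2" "4 \<le> \<rho> * (real Q')\<^sup>2 / 8"
      "real Q' powr (2 - k) \<le> \<rho> * (real Q')\<^sup>2 / 16"
      "\<And>c N. real N \<le> \<rho> / 2 * (real Q')\<^sup>2 / 4 \<Longrightarrow> \<exists>v. good_fracs (\<rho> / 2) Q' N c v"
    using eventually_happens'[OF sequentially_bot eventually_conj[OF e1 eventually_conj[OF e2 eventually_conj[OF e3 eventually_conj[OF e4 e5]]]]]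
    by blast
  define N where "N = cnum \<tau> Q Q'"
  have N: "real N \<le> \<rho> * (real Q')\<^sup>2 / 8" "\<rho> * (real Q')\<^sup>2 / 8 - 1 \<le> real N"
    unfolding N_def cnum_def \<rho>_def[symmetric] using h(3) by linarith+
  have N2: "2 \<le> N" using N(2) h(3) by linarith
  have N3: "\<rho> * (real Q')\<^sup>2 / 16 \<le> real N" using N(2) h(3) by linarith
  have N4: "real Q' powr (2 - k) \<le> real N" using h(4) N3 by linarith
  have "\<exists>v. good_fracs (\<rho> / 2) Q' N c v" for c using h(5)[of N c] N(1) by simp
  moreover have "crad \<tau> Q' \<le> \<rho> / 2" using h(2) by (simp add: crad_def)
  ultimately show ?thesis using h(1) N2 N3 N4 unfolding \<rho>_def N_def k_def by (intro exI[of _ Q']) auto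
qed

locale cantor =
  fixes \<tau> :: real and Q :: "nat \<Rightarrow> nat"
  assumes tau: "\<tau> \<ge> 2" and Q0: "Q 0 = 1"
    and Qn: "\<And>n. n \<le> Q (Suc n)" "\<And>n. 1 \<le> Q (Suc n)" "\<And>n. crad \<tau> (Q (Suc n)) \<le> crad \<tau> (Q n) / 2"
      "\<And>n. 2 \<le> cnum \<tau> (Q n) (Q (Suc n))"
      "\<And>n. crad \<tau> (Q n) * (real (Q (Suc n)))\<^sup>2 / 16 \<le> real (cnum \<tau> (Q n) (Q (Suc n)))"
      "\<And>n. real (Q (Suc n)) powr (2 - 1 / real (Suc n)) \<le> real (cnum \<tau> (Q n) (Q (Suc n)))"
      "\<And>n c. \<exists>v. good_fracs (crad \<tau> (Q n) / 2) (Q (Suc n)) (cnum \<tau> (Q n) (Q (Suc n))) c v"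
begin

definition rad :: "nat \<Rightarrow> real" where "rad j = crad \<tau> (Q j)"
definition num :: "nat \<Rightarrow> nat" where "num j = cnum \<tau> (Q j) (Q (Suc j))"
definition pick :: "nat \<Rightarrow> real \<Rightarrow> nat \<Rightarrow> real" where
  "pick j c = (SOME v. good_fracs (rad j / 2) (Q (Suc j)) (num j) c v)"

lemma pick: "good_fracs (rad j / 2) (Q (Suc j)) (num j) c (pick j c)"
  unfolding pick_def rad_def num_def by (rule someI_ex[OF Qn(7)])

lemma Qpos: "Q j \<ge> 1" using Q0 Qn(2) by (cases j) auto

lemma rad_pos: "rad j > 0" using Qpos[of j] by (simp add: rad_def crad_def)

lemma rad_Suc: "rad (Suc j) \<le> rad j / 2" unfolding rad_def by (rule Qn(3))

lemma rad_0: "rad 0 = 1/4" by (simp add: rad_def crad_def Q0)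

lemma num_ge_2: "num j \<ge> 2" unfolding num_def by (rule Qn(4))

lemma rad_le: "rad j \<le> (1/2) ^ j"
  by (induction j) (use rad_Suc rad_0 in \<open>auto intro: order_trans\<close>)

section \<open>Nested intervals along a sequence of digits\<close>

primrec cen :: "(nat \<Rightarrow> nat) \<Rightarrow> nat \<Rightarrow> real" where
  "cen d 0 = 1/2" | "cen d (Suc j) = pick j (cen d j) (d j)"

lemma cen_step: "d j < num j \<Longrightarrow> \<bar>cen d (Suc j) - cen d j\<bar> \<le> rad j / 2"
  using pick[of j "cen d j"] unfolding good_fracs_def by simp

text \<open>A step of at most half the radius is paid for by the decrease of the radius; keeping the
  subtracted term makes the induction telescope.\<close>

lemma cen_dist:
  assumes "\<And>j. d j < num j"
  shows "\<bar>cen d (j + k) - cen d j\<bar> \<le> rad j - rad (j + k)"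
proof (induction k)
  case (Suc k)
  have "\<bar>cen d (Suc (j + k)) - cen d (j + k)\<bar> \<le> rad (j + k) / 2" by (rule cen_step[OF assms])
  moreover have "j + Suc k = Suc (j + k)" by simp
  ultimately show ?case using Suc rad_Suc[of "j + k"] by (simp only:)
qed simp

definition pt :: "(nat \<Rightarrow> nat) \<Rightarrow> real" where "pt d = lim (cen d)"

lemma pt_lim:
  assumes d: "\<And>j. d j < num j"
  shows "cen d \<longlonglongrightarrow> pt d"
proof -
  have "Cauchy (cen d)"
  proof (rule metric_CauchyI)
    fix e :: real assume e: "0 < e"
    obtain M where M: "(1/2) ^ M < e / 2" using e real_arch_pow_inv[of "e/2" "1/2"] by auto
    have rM: "rad M < e / 2" using rad_le[of M] M by linarith
    have near: "dist (cen d m) (cen d M) < e / 2" if m: "m \<ge> M" for m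
    proof -
      have "\<bar>cen d (M + (m - M)) - cen d M\<bar> \<le> rad M" using cen_dist[OF d, of M "m - M"] rad_pos[of "M + (m - M)"] by linarith
      then show ?thesis using rM m by (simp add: dist_real_def)
    qed
    have "dist (cen d m) (cen d n) < e" if "m \<ge> M" "n \<ge> M" for m n
      using near[OF that(1)] near[OF that(2)] by (metis dist_commute dist_triangle_half_l)
    then show "\<exists>M. \<forall>m\<ge>M. \<forall>n\<ge>M. dist (cen d m) (cen d n) < e" by blast
  qed
  then show ?thesis unfolding pt_def by (simp add: Cauchy_convergent convergent_LIMSEQ_iff[symmetric])
qed

lemma pt_near:
  assumes d: "\<And>j. d j < num j"
  shows "\<bar>pt d - cen d j\<bar> \<le> rad j"
proof -
  have "(\<lambda>k. cen d (j + k)) \<longlonglongrightarrow> pt d" using LIMSEQ_ignore_initial_segment[OF pt_lim[OF d], of j] by (simp add: add.commute)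
  then have "(\<lambda>k. \<bar>cen d (j + k) - cen d j\<bar>) \<longlonglongrightarrow> \<bar>pt d - cen d j\<bar>" by (intro tendsto_intros)
  then show ?thesis
  proof (rule LIMSEQ_le_const2, intro exI allI impI)
    fix k
    show "\<bar>cen d (j + k) - cen d j\<bar> \<le> rad j" using cen_dist[OF d, of j k] rad_pos[of "j + k"] by linarith
  qed
qed

lemma cen_cong: "(\<And>i. i < j \<Longrightarrow> d i = d' i) \<Longrightarrow> cen d j = cen d' j"
  by (induction j) auto

section \<open>Mixed radix coding of the unit interval\<close>

definition Mm :: "nat \<Rightarrow> nat" where "Mm j = (\<Prod>i<j. num i)"

lemma Mm_Suc: "Mm (Suc j) = Mm j * num j" by (simp add: Mm_def)

lemma Mm_ge: "2 ^ j \<le> Mm j"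
proof (induction j)
  case (Suc j)
  have "2 ^ j * 2 \<le> Mm j * num j" using Suc num_ge_2 by (intro mult_le_mono) auto
  then show ?case by (simp add: Mm_Suc mult.commute)
qed (simp add: Mm_def)

lemma Mm_pos: "Mm j > 0" using Mm_ge[of j] by (meson order_less_le_trans zero_less_numeral zero_less_power)

definition fl :: "real \<Rightarrow> nat \<Rightarrow> nat" where "fl u j = nat \<lfloor>u * real (Mm j)\<rfloor>"

text \<open>The digit of u to the mixed base \<open>num 0\<close>, \<open>num 1\<close>, ...; the
  natural subtraction is exact for u >= 0 by \<open>dig_props\<close>.\<close>

definition dig :: "real \<Rightarrow> nat \<Rightarrow> nat" where "dig u j = fl u (Suc j) - num j * fl u j"

lemma fl_bounds: "0 \<le> u \<Longrightarrow> real (fl u j) \<le> u * real (Mm j) \<and> u * real (Mm j) < real (fl u j) + 1"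
proof -
  assume "0 \<le> u"
  then have "0 \<le> u * real (Mm j)" by simp
  then show ?thesis unfolding fl_def by linarith
qed

lemma dig_props:
  assumes u: "0 \<le> u"
  shows "fl u (Suc j) = num j * fl u j + dig u j" "dig u j < num j"
proof -
  have e: "u * real (Mm (Suc j)) = (u * real (Mm j)) * real (num j)" by (simp add: Mm_Suc)
  have n0: "real (num j) > 0" using num_ge_2[of j] by simp
  have "real (fl u j) * real (num j) \<le> u * real (Mm (Suc j))" unfolding e using fl_bounds[OF u, of j] n0 by (intro mult_right_mono) auto
  then have "real (num j * fl u j) < real (fl u (Suc j)) + 1" using fl_bounds[OF u, of "Suc j"] by (simp add: mult.commute)
  then have 1: "num j * fl u j \<le> fl u (Suc j)" by linarith
  have "u * real (Mm (Suc j)) < (real (fl u j) + 1) * real (num j)" unfolding e using fl_bounds[OF u, of j] n0 by (intro mult_strict_right_mono) auto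
  then have "real (fl u (Suc j)) < (real (fl u j) + 1) * real (num j)" using fl_bounds[OF u, of "Suc j"] by linarith
  also have "\<dots> = real (num j * fl u j + num j)" by (simp add: algebra_simps)
  finally have 2: "fl u (Suc j) < num j * fl u j + num j" by (simp only: of_nat_less_iff)
  show "fl u (Suc j) = num j * fl u j + dig u j" "dig u j < num j" using 1 2 by (auto simp: dig_def)
qed

definition Phi :: "real \<Rightarrow> real" where "Phi u = pt (dig u)"

text \<open>Take the first generation at which the codes differ, with digits k apart. In the
  parameter the distance is at most k+1 <= 2k cells. In the image the two centres are at least k/Q^2
  apart, with Q the new denominator bound, and half of this survives inside the intervals. Keeping
  k, and not just k >= 1, covers all distances between the gap and the parent radius.\<close>

lemma separation:
  assumes u: "0 \<le> u" "u < u'" "u' < 1"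
  shows "\<exists>j k. 1 \<le> k \<and> k \<le> num j \<and> u' - u \<le> 2 * real k / (real (Mm j) * real (num j)) \<and>
     \<bar>Phi u - Phi u'\<bar> \<ge> real k * rad j / (32 * real (num j))"
proof -
  have u': "0 \<le> u'" using u by simp
  have fl0: "fl v 0 = 0" if "0 \<le> v" "v < 1" for v using that by (simp add: fl_def Mm_def floor_eq_iff)
  have ex: "\<exists>j. fl u (Suc j) \<noteq> fl u' (Suc j)"
  proof -
    obtain j where j: "1 / (u' - u) < 2 ^ j" using real_arch_pow[of 2 "1 / (u' - u)"] by auto
    have "(2::real) ^ j \<le> 2 ^ Suc j" by simp
    also have "\<dots> \<le> real (Mm (Suc j))" using Mm_ge[of "Suc j"] by (metis of_nat_le_iff of_nat_numeral of_nat_power)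
    finally have "1 / (u' - u) < real (Mm (Suc j))" using j by linarith
    then have "1 < u' * real (Mm (Suc j)) - u * real (Mm (Suc j))" using u by (simp add: field_simps)
    then have "real (fl u (Suc j)) \<noteq> real (fl u' (Suc j))" using fl_bounds[OF u(1), of "Suc j"] fl_bounds[OF u', of "Suc j"] by linarith
    then show ?thesis by auto
  qed
  define j where "j = (LEAST j. fl u (Suc j) \<noteq> fl u' (Suc j))"
  have jne: "fl u (Suc j) \<noteq> fl u' (Suc j)" unfolding j_def by (rule LeastI_ex[OF ex])
  have jl: "fl u (Suc i) = fl u' (Suc i)" if "i < j" for i using not_less_Least[of i "\<lambda>j. fl u (Suc j) \<noteq> fl u' (Suc j)"] that unfolding j_def by blast
  have jle: "fl u i = fl u' i" if "i \<le> j" for i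
    using that jl fl0[of u] fl0[of u'] u by (cases i) auto
  have deq: "dig u i = dig u' i" if "i < j" for i using jle[of i] jl[OF that] that by (simp add: dig_def)
  have "u * real (Mm (Suc j)) \<le> u' * real (Mm (Suc j))" using u by (intro mult_right_mono) auto
  then have "fl u (Suc j) \<le> fl u' (Suc j)" unfolding fl_def by (intro nat_mono floor_mono)
  then have lt: "fl u (Suc j) < fl u' (Suc j)" using jne by simp
  define k where "k = fl u' (Suc j) - fl u (Suc j)"
  have dk: "dig u' j = dig u j + k" using dig_props(1)[OF u(1), of j] dig_props(1)[OF u', of j] jle[of j] lt unfolding k_def by simp
  have k1: "1 \<le> k" using lt by (simp add: k_def)
  have kN: "k \<le> num j" using dk dig_props(2)[OF u', of j] by simp
  have N0: "real (num j) > 0" using num_ge_2[of j] by simp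
  have M0: "real (Mm j) > 0" using Mm_pos[of j] by simp
  have "u' * real (Mm (Suc j)) - u * real (Mm (Suc j)) \<le> real k + 1"
    using fl_bounds[OF u(1), of "Suc j"] fl_bounds[OF u', of "Suc j"] lt unfolding k_def by simp
  also have "\<dots> \<le> 2 * real k" using k1 by simp
  finally have "(u' - u) * (real (Mm j) * real (num j)) \<le> 2 * real k" by (simp add: Mm_Suc algebra_simps)
  then have A: "u' - u \<le> 2 * real k / (real (Mm j) * real (num j))" using M0 N0 by (simp add: pos_le_divide_eq)
  define q where "q = real (Q (Suc j))"
  have q1: "q \<ge> 1" using Qn(2)[of j] by (simp add: q_def)
  have ceq: "cen (dig u) j = cen (dig u') j" by (rule cen_cong) (rule deq)
  have g: "good_fracs (rad j / 2) (Q (Suc j)) (num j) (cen (dig u) j) (pick j (cen (dig u) j))" by (rule pick)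
  have lt2: "dig u j < dig u' j" using dk k1 by simp
  have "real (dig u' j - dig u j) / q\<^sup>2 \<le> pick j (cen (dig u) j) (dig u' j) - pick j (cen (dig u) j) (dig u j)"
    using g lt2 dig_props(2)[OF u', of j] unfolding good_fracs_def q_def by blast
  then have B: "real k / q\<^sup>2 \<le> cen (dig u') (Suc j) - cen (dig u) (Suc j)" using dk ceq by simp
  have near: "\<bar>Phi u - cen (dig u) (Suc j)\<bar> \<le> rad (Suc j)" "\<bar>Phi u' - cen (dig u') (Suc j)\<bar> \<le> rad (Suc j)"
    unfolding Phi_def by (rule pt_near, rule dig_props(2)[OF u(1)], rule pt_near, rule dig_props(2)[OF u'])
  have radq: "rad (Suc j) \<le> 1 / (4 * q\<^sup>2)"
  proof -
    have "q powr (- \<tau>) \<le> q powr (- 2)" using q1 tau by (intro powr_mono) auto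
    also have "\<dots> = 1 / q\<^sup>2" using q1 by (simp add: powr_minus divide_inverse)
    finally show ?thesis unfolding rad_def crad_def q_def[symmetric] by (simp add: field_simps)
  qed
  have q2: "q\<^sup>2 > 0" using q1 by simp
  have "1 / q\<^sup>2 \<le> real k / q\<^sup>2" using k1 by (intro divide_right_mono) auto
  moreover have "rad (Suc j) \<le> (1 / q\<^sup>2) / 4" using radq by simp
  moreover have "K / 2 \<le> \<bar>x - y\<bar>" if "A \<le> K" "r \<le> A / 4" "K \<le> cy - cx" "\<bar>x - cx\<bar> \<le> r" "\<bar>y - cy\<bar> \<le> r" for A K r x y cx cy :: real
    using that by linarith
  ultimately have C: "\<bar>Phi u - Phi u'\<bar> \<ge> (real k / q\<^sup>2) / 2" using B near by blast
  have "rad j * q\<^sup>2 / 16 \<le> real (num j)" unfolding rad_def num_def q_def by (rule Qn(5))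
  then have "rad j / (16 * real (num j)) \<le> 1 / q\<^sup>2" using q2 N0 by (simp add: field_simps)
  then have "real k * (rad j / (16 * real (num j))) / 2 \<le> real k * (1 / q\<^sup>2) / 2" by (intro divide_right_mono mult_left_mono) auto
  then have "real k * rad j / (32 * real (num j)) \<le> (real k / q\<^sup>2) / 2" by simp
  then have "\<bar>Phi u - Phi u'\<bar> \<ge> real k * rad j / (32 * real (num j))" using C by linarith
  then show ?thesis using k1 kN A by blast
qed

text \<open>The last generation alone gives \<open>Mm\<close> at least Q^(2-1/(j+1)), which beats
  the Q^(\<tau>t) lost in the radius once 1/(j+1) <= 2-\<tau>t. The finitely many earlier
  generations enter through a minimum.\<close>

lemma mass_bound:
  assumes t: "0 < t" "t < 2 / \<tau>"
  shows "\<exists>c>0. \<forall>j. c \<le> real (Mm j) * rad j powr t"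
proof -
  have t1: "t \<le> 1"
  proof -
    have "2 / \<tau> \<le> 2 / 2" using tau by (intro divide_left_mono) auto
    then show ?thesis using t by simp
  qed
  have g: "2 - \<tau> * t > 0" using t tau by (simp add: field_simps)
  define n where "n = nat \<lceil>1 / (2 - \<tau> * t)\<rceil>"
  have n: "1 / real (Suc j) \<le> 2 - \<tau> * t" if "j \<ge> n" for j
  proof -
    have "1 / (2 - \<tau> * t) \<le> real (Suc j)" using that unfolding n_def by linarith
    then show ?thesis using g by (simp add: field_simps)
  qed
  have big: "1/4 \<le> real (Mm (Suc j)) * rad (Suc j) powr t" if "j \<ge> n" for j
  proof -
    define q where "q = real (Q (Suc j))"
    have q1: "q \<ge> 1" using Qn(2)[of j] by (simp add: q_def)
    have "q powr (2 - 1 / real (Suc j)) \<le> real (num j)" unfolding q_def num_def by (rule Qn(6))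
    also have "\<dots> \<le> real (Mm (Suc j))" unfolding Mm_Suc of_nat_le_iff using Mm_pos[of j] by simp
    finally have M: "q powr (2 - 1 / real (Suc j)) \<le> real (Mm (Suc j))" .
    have "rad (Suc j) powr t = q powr (- \<tau> * t) / 4 powr t" unfolding rad_def crad_def q_def[symmetric] by (simp add: powr_divide powr_powr)
    moreover have "4 powr t \<le> (4::real)" using powr_mono[OF t1, of 4] by simp
    then have "q powr (- \<tau> * t) / 4 \<le> q powr (- \<tau> * t) / 4 powr t" by (rule divide_left_mono) auto
    ultimately have r: "rad (Suc j) powr t \<ge> q powr (- \<tau> * t) / 4" by (simp only:)
    have "1/4 = q powr 0 / 4" using q1 by simp
    also have "\<dots> \<le> q powr ((2 - 1 / real (Suc j)) + - \<tau> * t) / 4" using n[OF that] q1 by (intro divide_right_mono powr_mono) auto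
    also have "\<dots> = q powr (2 - 1 / real (Suc j)) * (q powr (- \<tau> * t) / 4)" by (simp only: powr_add times_divide_eq_right)
    also have "\<dots> \<le> real (Mm (Suc j)) * rad (Suc j) powr t" using M r by (intro mult_mono) auto
    finally show ?thesis .
  qed
  define c where "c = Min (insert (1/4) ((\<lambda>j. real (Mm j) * rad j powr t) ` {..n}))"
  have "c > 0" unfolding c_def using rad_pos Mm_pos by (subst Min_gr_iff) (auto simp: less_imp_neq[symmetric])
  moreover have "c \<le> real (Mm j) * rad j powr t" for j
  proof (cases "j \<le> n")
    case True
    then show ?thesis unfolding c_def by (intro Min_le) auto
  next
    case False
    then obtain i where i: "j = Suc i" "i \<ge> n" by (cases j) auto
    have "c \<le> 1/4" unfolding c_def by (intro Min_le) auto
    then show ?thesis using big[OF i(2)] unfolding i(1) by (rule order_trans)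
  qed
  ultimately show ?thesis by blast
qed

text \<open>With x = k/\<open>num j\<close>, \<open>separation\<close> bounds the parameter distance
  by 2x/\<open>Mm j\<close> and the image distance from below by x \<open>rad j\<close>/32. As x <=
  1 and t <= 1, x <= x^t, and \<open>mass_bound\<close> converts 1/\<open>Mm j\<close> into the t-th
  power of the radius.\<close>

lemma Phi_inverse_holder:
  assumes t: "0 < t" "t < 2 / \<tau>"
  shows "\<exists>C>0. \<forall>u\<in>{0..<1}. \<forall>v\<in>{0..<1}. \<bar>u - v\<bar> \<le> C * \<bar>Phi u - Phi v\<bar> powr t"
proof -
  have t1: "t \<le> 1"
  proof -
    have "2 / \<tau> \<le> 2 / 2" using tau by (intro divide_left_mono) auto
    then show ?thesis using t by simp
  qed
  obtain c where c: "c > 0" "\<And>j. c \<le> real (Mm j) * rad j powr t" using mass_bound[OF t] by blast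
  define C where "C = 2 * 32 powr t / c"
  have C: "C > 0" using c by (simp add: C_def)
  have main: "u' - u \<le> C * \<bar>Phi u - Phi u'\<bar> powr t" if u: "0 \<le> u" "u < u'" "u' < 1" for u u'
  proof -
    obtain j k where jk: "1 \<le> k" "k \<le> num j" "u' - u \<le> 2 * real k / (real (Mm j) * real (num j))"
       "\<bar>Phi u - Phi u'\<bar> \<ge> real k * rad j / (32 * real (num j))" using separation[OF u] by blast
    define x where "x = real k / real (num j)"
    have x: "0 < x" "x \<le> 1" using jk num_ge_2[of j] by (auto simp: x_def)
    have M0: "real (Mm j) > 0" using Mm_pos[of j] by simp
    have "u' - u \<le> 2 * x / real (Mm j)" using jk(3) by (simp add: x_def mult.commute)
    also have "\<dots> \<le> 2 * x powr t / real (Mm j)"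
    proof -
      have "x powr 1 \<le> x powr t" using x t1 by (intro powr_mono') auto
      then show ?thesis using x M0 by (intro divide_right_mono mult_left_mono) auto
    qed
    also have "\<dots> \<le> 2 * x powr t * (rad j powr t / c)"
    proof -
      have "1 / real (Mm j) \<le> rad j powr t / c" using c(2)[of j] c(1) M0 by (simp add: field_simps)
      then have "2 * x powr t * (1 / real (Mm j)) \<le> 2 * x powr t * (rad j powr t / c)" by (intro mult_left_mono) auto
      then show ?thesis by simp
    qed
    also have "\<dots> = C * (x * rad j / 32) powr t"
      using x rad_pos[of j] c(1) unfolding C_def by (simp add: powr_mult powr_divide)
    also have "\<dots> \<le> C * \<bar>Phi u - Phi u'\<bar> powr t"
    proof (intro mult_left_mono powr_mono2)
      have "x * rad j / 32 = real k * rad j / (32 * real (num j))" by (simp add: x_def)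
      then show "x * rad j / 32 \<le> \<bar>Phi u - Phi u'\<bar>" using jk(4) by simp
    qed (use t x C rad_pos[of j] in auto)
    finally show ?thesis .
  qed
  have "\<bar>u - v\<bar> \<le> C * \<bar>Phi u - Phi v\<bar> powr t" if uv: "u \<in> {0..<1}" "v \<in> {0..<1}" for u v
  proof (cases u v rule: linorder_cases)
    case less
    then show ?thesis using main[of u v] uv by simp
  next
    case equal
    then show ?thesis using C by simp
  next
    case greater
    then show ?thesis using main[of v u] uv by (simp add: abs_minus_commute)
  qed
  then show ?thesis using C by blast
qed

lemma Phi_range: "0 \<le> u \<Longrightarrow> Phi u \<in> {0..<1}"
proof -
  assume u: "0 \<le> u"
  have "\<bar>Phi u - cen (dig u) 0\<bar> \<le> rad 0" unfolding Phi_def by (rule pt_near, rule dig_props(2)[OF u])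
  then have "\<bar>Phi u - 1/2\<bar> \<le> 1/4" by (simp add: rad_0)
  then show ?thesis unfolding atLeastLessThan_iff by linarith
qed

lemma Phi_approximable:
  assumes u: "0 \<le> u"
  shows "\<exists>Q' q p. n \<le> Q' \<and> 0 < q \<and> q \<le> Q' \<and> odd q \<and> coprime p (int q) \<and> \<bar>of_int p / real q - Phi u\<bar> \<le> real Q' powr (- \<tau>)"
proof -
  have "\<exists>p q. 0 < q \<and> q \<le> Q (Suc n) \<and> odd q \<and> coprime p (int q) \<and> cen (dig u) (Suc n) = of_int p / real q"
    using pick[of n "cen (dig u) n"] dig_props(2)[OF u, of n] unfolding good_fracs_def by simp
  then obtain p q where pq: "0 < q" "q \<le> Q (Suc n)" "odd q" "coprime p (int q)" "cen (dig u) (Suc n) = of_int p / real q" by blast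
  have "\<bar>Phi u - cen (dig u) (Suc n)\<bar> \<le> rad (Suc n)" unfolding Phi_def by (rule pt_near, rule dig_props(2)[OF u])
  then have "\<bar>of_int p / real q - Phi u\<bar> \<le> rad (Suc n)" unfolding pq(5) by (simp add: abs_minus_commute)
  also have "rad (Suc n) \<le> real (Q (Suc n)) powr (- \<tau>)" by (simp add: rad_def crad_def)
  finally show ?thesis using pq Qn(1)[of n] by blast
qed

end

lemma cantor_map_exists:
  assumes \<tau>: "\<tau> \<ge> 2"
  shows "\<exists>\<Phi> :: real \<Rightarrow> real. (\<forall>u\<in>{0..<1}. \<Phi> u \<in> {0..<1}) \<and>
    (\<forall>u\<in>{0..<1}. \<forall>n. \<exists>Q q p. n \<le> Q \<and> 0 < q \<and> q \<le> Q \<and> odd q \<and> coprime p (int q) \<and> \<bar>of_int p / real q - \<Phi> u\<bar> \<le> real Q powr (- \<tau>)) \<and>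
    (\<forall>t. 0 < t \<longrightarrow> t < 2 / \<tau> \<longrightarrow> (\<exists>C>0. \<forall>u\<in>{0..<1}. \<forall>v\<in>{0..<1}. \<bar>u - v\<bar> \<le> C * \<bar>\<Phi> u - \<Phi> v\<bar> powr t))"
proof -
  define P where "P = (\<lambda>(n::nat) (Q::nat). 1 \<le> Q \<and> (n = 0 \<longrightarrow> Q = 1))"
  define Rel where "Rel = (\<lambda>n Q Q'. n \<le> Q' \<and> 1 \<le> Q' \<and> crad \<tau> Q' \<le> crad \<tau> Q / 2 \<and> 2 \<le> cnum \<tau> Q Q' \<and>
    crad \<tau> Q * (real Q')\<^sup>2 / 16 \<le> real (cnum \<tau> Q Q') \<and> real Q' powr (2 - 1 / real (Suc n)) \<le> real (cnum \<tau> Q Q') \<and>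
    (\<forall>c. \<exists>v. good_fracs (crad \<tau> Q / 2) Q' (cnum \<tau> Q Q') c v))"
  have "\<exists>Q. \<forall>n. P n (Q n) \<and> Rel n (Q n) (Q (Suc n))"
  proof (rule dependent_nat_choice)
    show "\<exists>Q. P 0 Q" by (simp add: P_def)
    fix Q n assume "P n Q"
    then have "1 \<le> Q" by (simp add: P_def)
    from scale_exists[OF \<tau> this, of n] show "\<exists>Q'. P (Suc n) Q' \<and> Rel n Q Q'" unfolding P_def Rel_def by auto
  qed
  then obtain Q where Q: "\<And>n. P n (Q n)" "\<And>n. Rel n (Q n) (Q (Suc n))" by blast
  interpret cantor \<tau> Q
    by unfold_locales (use \<tau> Q in \<open>auto simp: P_def Rel_def\<close>)
  show ?thesis
    using Phi_range Phi_approximable Phi_inverse_holder by (intro exI[of _ Phi]) auto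
qed

subsection \<open>The spectrum of singularities\<close>

lemma hausdorff_content_mono: "A \<subseteq> B \<Longrightarrow> hausdorff_content \<delta> t A \<le> hausdorff_content \<delta> t B"
  unfolding hausdorff_content_def by (rule INF_superset_mono) auto

lemma hausdorff_measure_mono: "A \<subseteq> B \<Longrightarrow> hausdorff_measure t A \<le> hausdorff_measure t B"
  unfolding hausdorff_measure_def by (intro SUP_mono) (auto intro: hausdorff_content_mono)

lemma hausdorff_null_subset: "A \<subseteq> B \<Longrightarrow> hausdorff_measure t B = 0 \<Longrightarrow> hausdorff_measure t A = 0"
  using hausdorff_measure_mono[of A B t] by simp

lemma hausdorff_content_null: "hausdorff_measure t A = 0 \<Longrightarrow> \<delta> > 0 \<Longrightarrow> hausdorff_content \<delta> t A = 0"
proof -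
  assume h: "hausdorff_measure t A = 0" and d: "\<delta> > 0"
  have "hausdorff_content \<delta> t A \<le> hausdorff_measure t A"
    unfolding hausdorff_measure_def by (rule SUP_upper) (use d in simp)
  then show ?thesis using h by simp
qed

lemma hausdorff_null_exponent_mono:
  assumes t: "0 \<le> t" "t < t'" and h: "hausdorff_measure t A = 0"
  shows "hausdorff_measure t' A = 0"
proof -
  have "hausdorff_content \<delta> t' A = 0" if d: "\<delta> > 0" for \<delta>
  proof -
    \<comment> \<open>A larger exponent gives a smaller power only for diameters up to 1, hence the
      restriction to finer covers.\<close>
    have "hausdorff_content \<delta> t' A \<le> hausdorff_content (min \<delta> 1) t A"
      unfolding hausdorff_content_def[of "min \<delta> 1"]
    proof (rule INF_greatest)
      fix C :: "nat \<Rightarrow> real set" assume C: "C \<in> {C. A \<subseteq> (\<Union>n. C n) \<and> (\<forall>n. bounded (C n) \<and> diameter (C n) \<le> min \<delta> 1)}"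
      have "hausdorff_content \<delta> t' A \<le> (\<Sum>n. hd_term (C n) t')"
        unfolding hausdorff_content_def by (rule INF_lower) (use C in auto)
      also have "\<dots> \<le> (\<Sum>n. hd_term (C n) t)"
      proof (rule suminf_le)
        fix n
        have dm: "0 \<le> diameter (C n)" "diameter (C n) \<le> 1" using C diameter_ge_0[of "C n"] by auto
        have "diameter (C n) powr t' \<le> diameter (C n) powr t" using dm t by (intro powr_mono') auto
        moreover have "diameter (C n) powr t' \<le> 1" using dm t by (intro powr_le1) auto
        ultimately show "hd_term (C n) t' \<le> hd_term (C n) t"
          unfolding hd_term_def using t by (auto intro: ennreal_leI)
      qed auto
      finally show "hausdorff_content \<delta> t' A \<le> (\<Sum>n. hd_term (C n) t)" .
    qed
    also have "\<dots> = 0" by (rule hausdorff_content_null[OF h]) (use d in simp)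
    finally show ?thesis by simp
  qed
  then show ?thesis unfolding hausdorff_measure_def by simp
qed

text \<open>This replaces a Frostman measure on the Cantor set.\<close>

lemma negligible_preimage:
  fixes \<Phi> :: "real \<Rightarrow> real"
  assumes t: "t > 0" and C: "C > 0" "\<And>u v. u \<in> U \<Longrightarrow> v \<in> U \<Longrightarrow> \<bar>u - v\<bar> \<le> C * \<bar>\<Phi> u - \<Phi> v\<bar> powr t"
    and h: "hausdorff_measure t A = 0"
  shows "negligible {u \<in> U. \<Phi> u \<in> A}"
  unfolding negligible_outer
proof (intro allI impI)
  fix \<epsilon> :: real assume e: "\<epsilon> > 0"
  define \<eta> where "\<eta> = \<epsilon> / (2 * C)"
  have eta: "\<eta> > 0" using e C by (simp add: \<eta>_def)
  have "hausdorff_content 1 t A < ennreal \<eta>" using hausdorff_content_null[OF h, of 1] eta by simp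
  then obtain K :: "nat \<Rightarrow> real set" where K: "A \<subseteq> (\<Union>n. K n)" "\<And>n. bounded (K n)" and sum: "(\<Sum>n. hd_term (K n) t) < ennreal \<eta>"
    unfolding hausdorff_content_def INF_less_iff by blast
  \<comment> \<open>The Hoelder estimate compares points of U only, so each covering set is
    represented by some preimage in U, about which the whole preimage lies in an interval.\<close>
  define base where "base = (\<lambda>n. SOME u. u \<in> U \<and> \<Phi> u \<in> K n)"
  define T where "T = (\<lambda>n. if \<exists>u. u \<in> U \<and> \<Phi> u \<in> K n then {base n - C * diameter (K n) powr t .. base n + C * diameter (K n) powr t} else {})"
  have base: "base n \<in> U" "\<Phi> (base n) \<in> K n" if "\<exists>u. u \<in> U \<and> \<Phi> u \<in> K n" for n
    using someI_ex[OF that] unfolding base_def by auto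
  have sub: "{u \<in> U. \<Phi> u \<in> A} \<subseteq> (\<Union>n. T n)"
  proof
    fix u assume "u \<in> {u \<in> U. \<Phi> u \<in> A}"
    then obtain n where u: "u \<in> U" "\<Phi> u \<in> K n" using K(1) by auto
    then have ex: "\<exists>u. u \<in> U \<and> \<Phi> u \<in> K n" by blast
    have "\<bar>\<Phi> u - \<Phi> (base n)\<bar> \<le> diameter (K n)"
      using diameter_bounded_bound[OF K(2) u(2) base(2)[OF ex]] by (simp add: dist_real_def)
    then have "\<bar>\<Phi> u - \<Phi> (base n)\<bar> powr t \<le> diameter (K n) powr t" using t by (intro powr_mono2) auto
    then have "\<bar>u - base n\<bar> \<le> C * diameter (K n) powr t"
      using C(2)[OF u(1) base(1)[OF ex]] mult_left_mono[of "\<bar>\<Phi> u - \<Phi> (base n)\<bar> powr t" "diameter (K n) powr t" C] C(1) by linarith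
    then have "u \<in> T n" unfolding T_def using ex by auto
    then show "u \<in> (\<Union>n. T n)" by blast
  qed
  have Ts: "T n \<in> sets lebesgue" for n unfolding T_def by auto
  have Te: "emeasure lebesgue (T n) \<le> ennreal (2 * C) * hd_term (K n) t" for n
  proof (cases "\<exists>u. u \<in> U \<and> \<Phi> u \<in> K n")
    case True
    then have ne: "K n \<noteq> {}" by auto
    have "0 \<le> C * diameter (K n) powr t" using C by simp
    then have "emeasure lebesgue (T n) = ennreal (2 * C * diameter (K n) powr t)" unfolding T_def using True by simp
    also have "\<dots> = ennreal (2 * C) * hd_term (K n) t" unfolding hd_term_def using ne t C by (simp add: ennreal_mult)
    finally show ?thesis by simp
  next
    case False
    then have "T n = {}" unfolding T_def by (simp only: if_False)
    then show ?thesis by simp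
  qed
  have "emeasure lebesgue (\<Union>n. T n) \<le> (\<Sum>n. emeasure lebesgue (T n))"
    by (rule emeasure_subadditive_countably) (use Ts in auto)
  also have "\<dots> \<le> (\<Sum>n. ennreal (2 * C) * hd_term (K n) t)" by (intro suminf_le Te) auto
  also have "\<dots> = ennreal (2 * C) * (\<Sum>n. hd_term (K n) t)" by (rule ennreal_suminf_cmult)
  also have "\<dots> < ennreal (2 * C) * ennreal \<eta>"
    using sum C by (intro ennreal_mult_strict_left_mono) auto
  also have "\<dots> = ennreal \<epsilon>" using C eta by (simp add: ennreal_mult[symmetric] \<eta>_def)
  finally have lt: "emeasure lebesgue (\<Union>n. T n) < ennreal \<epsilon>" .
  have TU: "(\<Union>n. T n) \<in> sets lebesgue" using Ts by auto
  have lm: "(\<Union>n. T n) \<in> lmeasurable" by (rule fmeasurableI[OF TU]) (use lt order_less_trans[OF lt] in auto)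
  have "ennreal (measure lebesgue (\<Union>n. T n)) < ennreal \<epsilon>" using lt unfolding emeasure_eq_measure2[OF lm] .
  then have "measure lebesgue (\<Union>n. T n) < \<epsilon>" by (simp only: ennreal_less_iff measure_nonneg)
  then show "\<exists>T. {u \<in> U. \<Phi> u \<in> A} \<subseteq> T \<and> T \<in> lmeasurable \<and> measure lebesgue T < \<epsilon>" using sub lm by blast
qed

text \<open>The fraction 0/1 equals 0, so 0 is approximable to every order \<tau>, and 1/(2\<tau>)
  can be made arbitrarily small.\<close>

lemma holder_exponent_at_0:
  assumes s: "s > 1/2"
  shows "holder_exponent (R s) 0 = ereal (s - 1/2)"
proof (rule antisym)
  show "holder_exponent (R s) 0 \<le> ereal (s - 1/2)"
  proof (rule ereal_le_epsilon2)
    fix \<epsilon> :: real assume e: "\<epsilon> > 0"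
    define \<tau> where "\<tau> = max 2 (1 / (2 * \<epsilon>))"
    have tau: "\<tau> \<ge> 2" "1 / (2 * \<epsilon>) \<le> \<tau>" by (auto simp: \<tau>_def)
    have "holder_exponent (R s) 0 \<le> ereal (s - 1/2 + 1 / (2 * \<tau>))"
    proof (rule holder_exponent_le_approximable[OF s tau(1)])
      fix n :: nat
      show "\<exists>Q q p. n \<le> Q \<and> 0 < q \<and> q \<le> Q \<and> odd q \<and> coprime p (int q) \<and> \<bar>real_of_int p / real q - 0\<bar> \<le> real Q powr (- \<tau>)"
        by (rule exI[of _ "Suc n"], rule exI[of _ 1], rule exI[of _ 0]) auto
    qed
    also have "1 / (2 * \<tau>) \<le> \<epsilon>" using tau e by (simp add: field_simps)
    then have "ereal (s - 1/2 + 1 / (2 * \<tau>)) \<le> ereal (s - 1/2) + ereal \<epsilon>" by simp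
    finally show "holder_exponent (R s) 0 \<le> ereal (s - 1/2) + ereal \<epsilon>" .
  qed
qed (rule holder_exponent_ge[OF s])

text \<open>The endpoint \<alpha> = s-1/2 is left out because D = 0 would call for \<tau> infinite.
  Nonemptiness is a separate claim, since the dimension of the empty set is set to
  -\<infinity>.\<close>

lemma level_set_not_null:
  assumes s: "s > 1/2" and a: "s - 1/2 < \<alpha>" "\<alpha> \<le> s - 1/4"
  shows "{x \<in> {0..<1}. holder_exponent (R s) x = ereal \<alpha>} \<noteq> {}"
    "\<And>t. 0 \<le> t \<Longrightarrow> t < 4 * \<alpha> - 4 * s + 2 \<Longrightarrow> hausdorff_measure t {x \<in> {0..<1}. holder_exponent (R s) x = ereal \<alpha>} \<noteq> 0"
proof -
  define E where "E = {x \<in> {0..<1}. holder_exponent (R s) x = ereal \<alpha>}"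
  define D where "D = 4 * \<alpha> - 4 * s + 2"
  have D: "0 < D" "D \<le> 1" using a by (auto simp: D_def)
  define \<tau> where "\<tau> = 2 / D"
  have tau: "\<tau> \<ge> 2" using D by (simp add: \<tau>_def field_simps)
  have tD: "2 / \<tau> = D" using D by (simp add: \<tau>_def)
  have at: "s - 1/2 + 1 / (2 * \<tau>) = \<alpha>" unfolding \<tau>_def D_def using D by (simp add: D_def field_simps)
  obtain \<Phi> where rng: "\<And>u. u \<in> {0..<1} \<Longrightarrow> \<Phi> u \<in> {0..<1::real}"
    and app: "\<And>u n. u \<in> {0..<1} \<Longrightarrow> \<exists>Q q p. n \<le> Q \<and> 0 < q \<and> q \<le> Q \<and> odd q \<and> coprime p (int q) \<and> \<bar>of_int p / real q - \<Phi> u\<bar> \<le> real Q powr (- \<tau>)"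
    and hol: "\<And>t. 0 < t \<Longrightarrow> t < D \<Longrightarrow> \<exists>C>0. \<forall>u\<in>{0..<1}. \<forall>v\<in>{0..<1}. \<bar>u - v\<bar> \<le> C * \<bar>\<Phi> u - \<Phi> v\<bar> powr t"
    using cantor_map_exists[OF tau] unfolding tD by blast
  have null: "negligible {u \<in> {0..<1}. \<Phi> u \<in> A}" if t: "0 < t" "t < D" "hausdorff_measure t A = 0" for t A
  proof -
    obtain C where "C > 0" "\<forall>u\<in>{0..<1}. \<forall>v\<in>{0..<1}. \<bar>u - v\<bar> \<le> C * \<bar>\<Phi> u - \<Phi> v\<bar> powr t" using hol[OF t(1,2)] by blast
    then show ?thesis using negligible_preimage[OF t(1), of C "{0..<1}" \<Phi> A] t(3) by blast
  qed
  define low where "low = (\<lambda>n. {x \<in> {0..<1}. holder_exponent (R s) x \<le> ereal (\<alpha> - 1 / real (Suc n))})"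
  have lown: "negligible {u \<in> {0..<1}. \<Phi> u \<in> low n}" for n
  proof -
    define y where "y = 1 / real (Suc n)"
    have y: "y > 0" by (simp add: y_def)
    \<comment> \<open>Must lie below D for the map to have a t-Hoelder inverse, and above both 0 and
      D - 4y, the bound for points of exponent at most \<alpha> - y.\<close>
    define t where "t = max (D / 2) (D - 2 * y)"
    have t: "0 < t" "t < D" using D y by (auto simp: t_def)
    have "t \<ge> D - 2 * y" by (simp add: t_def)
    then have "t > 4 * (\<alpha> - 1 / real (Suc n)) - 4 * s + 2"
      unfolding y_def[symmetric] D_def using y by (simp add: algebra_simps)
    then have "hausdorff_measure t (low n) = 0" unfolding low_def by (intro hausdorff_null_low_exponent s t)
    then show ?thesis by (rule null[OF t])
  qed
  have cover: "{0..<1} \<subseteq> {u \<in> {0..<1}. \<Phi> u \<in> E} \<union> (\<Union>n. {u \<in> {0..<1}. \<Phi> u \<in> low n})"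
  proof
    fix u :: real assume u: "u \<in> {0..<1}"
    have le: "holder_exponent (R s) (\<Phi> u) \<le> ereal \<alpha>"
      using holder_exponent_le_approximable[OF s tau app[OF u]] unfolding at .
    show "u \<in> {u \<in> {0..<1}. \<Phi> u \<in> E} \<union> (\<Union>n. {u \<in> {0..<1}. \<Phi> u \<in> low n})"
    proof (cases "holder_exponent (R s) (\<Phi> u) = ereal \<alpha>")
      case True
      then show ?thesis using u rng[OF u] by (auto simp: E_def)
    next
      case False
      then have "holder_exponent (R s) (\<Phi> u) < ereal \<alpha>" using le by simp
      then obtain b where b: "holder_exponent (R s) (\<Phi> u) < ereal b" "ereal b < ereal \<alpha>" using ereal_dense2 by blast
      then have "\<alpha> - b > 0" by simp
      then obtain n where n: "inverse (real (Suc n)) < \<alpha> - b" using reals_Archimedean by blast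
      have "b \<le> \<alpha> - 1 / real (Suc n)" using n by (simp add: inverse_eq_divide)
      then have "ereal b \<le> ereal (\<alpha> - 1 / real (Suc n))" by simp
      then have "holder_exponent (R s) (\<Phi> u) \<le> ereal (\<alpha> - 1 / real (Suc n))" using b(1) by (meson less_imp_le order_trans)
      then have "\<Phi> u \<in> low n" using rng[OF u] by (simp add: low_def)
      then show ?thesis using u by blast
    qed
  qed
  have notnull: "\<not> negligible {u \<in> {0..<1}. \<Phi> u \<in> E}"
  proof
    assume "negligible {u \<in> {0..<1}. \<Phi> u \<in> E}"
    then have "negligible ({u \<in> {0..<1}. \<Phi> u \<in> E} \<union> (\<Union>n. {u \<in> {0..<1}. \<Phi> u \<in> low n}))"
      by (intro negligible_Un negligible_countable_Union) (use lown in auto)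
    then have "negligible {0..<1::real}" using cover by (rule negligible_subset)
    then have "negligible (cbox (1/4) (3/4::real))" by (rule negligible_subset) auto
    then have "box (1/4) (3/4::real) = {}" by (simp only: negligible_interval)
    moreover have "1/2 \<in> box (1/4) (3/4::real)" unfolding box_real by simp
    ultimately show False by blast
  qed
  show "{x \<in> {0..<1}. holder_exponent (R s) x = ereal \<alpha>} \<noteq> {}"
  proof
    assume "{x \<in> {0..<1}. holder_exponent (R s) x = ereal \<alpha>} = {}"
    then have "{u \<in> {0..<1}. \<Phi> u \<in> E} = {}" by (simp add: E_def)
    then show False using notnull negligible_empty by metis
  qed
  fix t assume t: "0 \<le> t" "t < 4 * \<alpha> - 4 * s + 2"
  show "hausdorff_measure t {x \<in> {0..<1}. holder_exponent (R s) x = ereal \<alpha>} \<noteq> 0"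
  proof
    assume "hausdorff_measure t {x \<in> {0..<1}. holder_exponent (R s) x = ereal \<alpha>} = 0"
    then have h: "hausdorff_measure t E = 0" by (simp add: E_def)
    define t' where "t' = (t + D) / 2"
    have t': "t < t'" "t' < D" "0 < t'" using t D by (auto simp: t'_def D_def)
    have "hausdorff_measure t' E = 0" by (rule hausdorff_null_exponent_mono[OF t(1) t'(1) h])
    then show False using null[OF t'(3,2)] notnull by blast
  qed
qed

lemma spectrum_R:
  assumes s: "s > 1/2" and a: "\<alpha> \<le> s - 1/4"
  shows "spectrum_sing s \<alpha> = (if \<alpha> < s - 1/2 then - \<infinity> else ereal (4 * \<alpha> - 4 * s + 2))"
proof -
  define E where "E = {x \<in> {0..<1}. holder_exponent (R s) x = ereal \<alpha>}"
  define D where "D = 4 * \<alpha> - 4 * s + 2"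
  have sp: "spectrum_sing s \<alpha> = hausdorff_dim E" by (simp add: spectrum_sing_def E_def)
  show ?thesis
  proof (cases "\<alpha> < s - 1/2")
    case True
    have "E = {}"
    proof (rule ccontr)
      assume "E \<noteq> {}"
      then obtain x where "holder_exponent (R s) x = ereal \<alpha>" by (auto simp: E_def)
      then have "ereal (s - 1/2) \<le> ereal \<alpha>" using holder_exponent_ge[OF s, of x] by simp
      then show False using True by simp
    qed
    then show ?thesis using True by (simp add: sp hausdorff_dim_def)
  next
    case False
    have D0: "D \<ge> 0" using False by (simp add: D_def)
    have ne: "E \<noteq> {}" and low: "\<And>t. 0 \<le> t \<Longrightarrow> t < D \<Longrightarrow> hausdorff_measure t E \<noteq> 0"
    proof -
      show "E \<noteq> {}"
      \<comment> \<open>At this endpoint D = 0, so no lower bound on the measure is asked for and a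
        single point of the level set is enough.\<close>
      proof (cases "\<alpha> = s - 1/2")
        case True
        then have "0 \<in> E" using holder_exponent_at_0[OF s] by (simp add: E_def)
        then show ?thesis by blast
      next
        case F: False
        then show ?thesis unfolding E_def using level_set_not_null(1)[OF s _ a] False by simp
      qed
      show "hausdorff_measure t E \<noteq> 0" if "0 \<le> t" "t < D" for t
        unfolding E_def using level_set_not_null(2)[OF s _ a that(1)] that by (simp add: D_def)
    qed
    have dim: "hausdorff_dim E = Inf (ereal ` {t. t \<ge> 0 \<and> hausdorff_measure t E = 0})" using ne by (simp add: hausdorff_dim_def)
    have "hausdorff_dim E = ereal D"
    proof (rule antisym)
      show "hausdorff_dim E \<le> ereal D"
      proof (rule ereal_le_epsilon2)
        fix \<epsilon> :: real assume e: "\<epsilon> > 0"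
        have "hausdorff_measure (D + \<epsilon>) {x \<in> {0..<1}. holder_exponent (R s) x \<le> ereal \<alpha>} = 0"
          by (rule hausdorff_null_low_exponent[OF s]) (use e D0 in \<open>auto simp: D_def\<close>)
        then have "hausdorff_measure (D + \<epsilon>) E = 0" by (rule hausdorff_null_subset[rotated]) (auto simp: E_def)
        then have "hausdorff_dim E \<le> ereal (D + \<epsilon>)" unfolding dim using e D0 by (intro Inf_lower) auto
        then show "hausdorff_dim E \<le> ereal D + ereal \<epsilon>" by simp
      qed
      show "ereal D \<le> hausdorff_dim E" unfolding dim
        by (rule Inf_greatest) (use low in \<open>force simp: not_less[symmetric]\<close>)
    qed
    then show ?thesis using False by (simp add: sp D_def)
  qed
qed

theorem theoremD:
  fixes s \<alpha> :: real
  assumes "s > 1 / 2" and "\<alpha> \<le> s - 1 / 4"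
  shows "spectrum_sing s \<alpha> = (INF p \<in> {0<..}. ereal (\<alpha> * p) - eta s p + 1)"
  using spectrum_R[OF assms] legendre_transform_eta[OF assms] by simp

end
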